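(* Suppose the following conditions hold for $\mathbf b$, $r$, $f$ (defined in the context): (1) $\mathbf b(t,\mathbf y,v)$ is continuous in its variables; (2) there is $C>0$ such that $|\mathbf b(t,\mathbf y_1,v)-\mathbf b(t,\mathbf y_2,v)|\le C|\mathbf y_1-\mathbf y_2|$ for all $\mathbf y_1,\mathbf y_2\in\mathbb R^4$ and all $(t,v)\in[0,T]\times\mathcal A$; (3) there is $C>0$ such that $|\mathbf b(t,\mathbf y,v)|\le C(1+|\mathbf y|)$ for all $\mathbf y\in\mathbb R^4$ and all $(t,v)\in[0,T]\times\mathcal A$; (4) there are $C>0$, $p_0\ge1$ such that $|r(\mathbf y,v)|\le C(1+|v|^{p_0}+|\mathbf y|^{p_0})$ and $|f(\mathbf y)|\le C(1+|\mathbf y|^{p_0})$ for all $\mathbf y\in\mathbb R^4$, $v\in\mathcal A$. Let $\pi$ be an admissible policy. Then the exploratory state equation $$\mathrm d\tilde{\mathbf Y}^\pi_t=\tilde{\mathbf b}\big(t,\tilde{\mathbf Y}^\pi_t,\pi(\cdot\mid t,\tilde{\mathbf Y}^\pi_t)\big)\,\mathrm dt+\boldsymbol\sigma\,\mathrm dW_t+\boldsymbol\eta_{1+N_{t-}}\,\mathrm dN_t$$ admits a unique strong solution. Furthermore, if $p\ge2$, then there exists $C=C(p)$ such that $$\mathbb E^{\mathbb P^{W,N}}\Big[\max_{t\le s\le T}|\tilde{\mathbf Y}^\pi_s|^p\,\Big|\,\tilde{\mathbf Y}^\pi_t=\mathbf y\Big]\le C(1+|\mathbf y|^p).$$ Moreover,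 the value function $$V^\pi(t,\mathbf y)=\mathbb E^{\mathbb P^{W,N}}_{t,\mathbf y}\Big[f(\tilde{\mathbf Y}^\pi_T)-\int_t^T\!\!\int_{\mathcal A}\big(\varphi(v-\rho\mu_u)^2+\gamma\log\pi_u(v)\big)\pi_u(v)\,\mathrm dv\,\mathrm du\Big]$$ is finite.
   Context: Fix $T>0$ and constants $b,k,\gamma\ge0$, $\sigma,\kappa,\alpha,\varphi,\rho$ and $\lambda>0$. $W$ is a standard one-dimensional Brownian motion and $N$ a homogeneous Poisson process with intensity $\lambda$ on a probability space $(\Omega,\mathcal F,\mathbb P^{W,N})$ with filtration $\{\mathcal F^{W,N}_t\}_{0\le t\le T}$ generated by $W$ and $N$; it is enlarged to $(\Omega,\mathcal F,\mathbb P,\{\mathcal F_t\})$, $\mathcal F_t=\mathcal F_t^{W,N}\vee\sigma(Z)$, with $Z$ a random variable independent of $W,N$ used to randomize actions. $\eta_1,\eta_2,\dots$ are non-negative i.i.d. random variables distributed as $\eta$, all of whose moments are finite. $\mathcal A\subset\mathbb R$ is the action space (trading speeds). States are $\mathbf y=(S,x,q,\mu)^{\mathsf T}\in\mathbb R^4$ (midprice, cash, inventory, market trading speed), and $$\mathbf b(t,\mathbf y,v)=(-bv,\ (S-kv)v,\ -v,\ -\kappa\mu)^{\mathsf T},\quad \boldsymbol\sigma=(\sigma,0,0,0)^{\mathsf T},\quad \boldsymbol\eta_m=(0,0,0,\eta_m)^{\mathsf T},$$ $$f(\mathbf y)=x+q(S-\alpha q),\qquad r(\mathbf y,v)=-\varphi(v-\rho\mu)^2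 .$$ For a probability density $\pi(\cdot\mid t,\mathbf y)$ on $\mathcal A$, $\tilde{\mathbf b}(t,\mathbf y,\pi(\cdot\mid t,\mathbf y))=\int_{\mathcal A}\mathbf b(t,\mathbf y,v)\pi(v\mid t,\mathbf y)\,\mathrm dv$. The exploratory state is $\tilde{\mathbf Y}^\pi_t=(\tilde S^\pi_t,\tilde X^\pi_t,\tilde Q^\pi_t,\mu_t)^{\mathsf T}$, and $\pi_u(v)$ abbreviates $\pi(v\mid u,\tilde{\mathbf Y}^\pi_u)$. $\mathbb E_{t,\mathbf y}$ denotes expectation conditional on state $\mathbf y$ at time $t$. $|\cdot|$ is the Euclidean/Frobenius norm. A policy $\pi$ is admissible if: (i) $\pi(\cdot\mid t,\mathbf y)$ is a probability distribution (density) on $\mathcal A$ and is $\mathcal F_t$-measurable; (ii) for every initial $(t,\mathbf y)\in[0,T]\times\mathbb R^4$ the exploratory state equation above admits a unique weak solution; (iii) $\pi$ is continuous in $(t,\mathbf y)$ in the sense that $\int_{\mathcal A}|\pi(v\mid t,\mathbf y)-\pi(v\mid t',\mathbf y')|\,\mathrm dv\to0$ as $(t,\mathbf y)\to(t',\mathbf y')$, and there is $C>0$ with $\int_{\mathcal A}|\pi(v\mid t,\mathbf y)-\pi(v\mid t,\mathbf y')|\,\mathrm dv\le C|\mathbf y-\mathbf y'|$ for all $t$, $\mathbf y,\mathbf y'$; (iv) there are $C>0$, $p\ge1$ such that $\int_{\mathcal A}|\varphi(v-\rho\mu)^2+\gamma\log\pi(v\mid t,\mathbf y)|\,\pi(v\mid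 t,\mathbf y)\,\mathrm dv\le C(1+|\mathbf y|^p)$ for all $(t,\mathbf y)\in[0,T]\times\mathbb R^4$. *)

theory Defs
  imports "HOL-Probability.Probability"
begin

(* A state is y = (S, x, q, mu): midprice, cash, inventory, market trading speed.  The norm on
   the iterated product type is the Euclidean norm of R^4. *)
type_synonym state = "real \<times> real \<times> real \<times> real"

fun drift :: "real \<Rightarrow> real \<Rightarrow> real \<Rightarrow> real \<Rightarrow> state \<Rightarrow> real \<Rightarrow> state" where
  "drift b k \<kappa> t (S, x, q, \<mu>) v = (- (b * v), (S - k * v) * v, - v, - (\<kappa> * \<mu>))"

definition diffusion :: "real \<Rightarrow> state" where
  "diffusion \<sigma> = (\<sigma>, 0, 0, 0)"

definition jump :: "real \<Rightarrow> state" where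
  "jump e = (0, 0, 0, e)"

fun terminal_reward :: "real \<Rightarrow> state \<Rightarrow> real" where
  "terminal_reward \<alpha> (S, x, q, \<mu>) = x + q * (S - \<alpha> * q)"

fun running_reward :: "real \<Rightarrow> real \<Rightarrow> state \<Rightarrow> real \<Rightarrow> real" where
  "running_reward \<phi> \<rho> (S, x, q, \<mu>) v = - (\<phi> * (v - \<rho> * \<mu>)\<^sup>2)"

(* A policy pol assigns to (t, y) the density v \<mapsto> pol t y v on the action space A.
   Only the values for v in A matter. *)
type_synonym policy = "real \<Rightarrow> state \<Rightarrow> real \<Rightarrow> real"

definition exploratory_drift ::
    "real set \<Rightarrow> (real \<Rightarrow> state \<Rightarrow> real \<Rightarrow> state) \<Rightarrow> policy \<Rightarrow> real \<Rightarrow> state \<Rightarrow> state" where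
  "exploratory_drift A B pol t y = (LINT v:A|lborel. pol t y v *\<^sub>R B t y v)"

(* phi (v - rho mu)^2 + gamma log pi(v | t, y).  As ln 0 = 0, its product with pi(v | t, y)
   follows the convention 0 log 0 = 0. *)
fun regularized_cost ::
    "real \<Rightarrow> real \<Rightarrow> real \<Rightarrow> policy \<Rightarrow> real \<Rightarrow> state \<Rightarrow> real \<Rightarrow> real" where
  "regularized_cost \<phi> \<rho> \<gamma> pol t (S, x, q, \<mu>) v =
     \<phi> * (v - \<rho> * \<mu>)\<^sup>2 + \<gamma> * ln (pol t (S, x, q, \<mu>) v)"

definition brownian_motion :: "'a measure \<Rightarrow> (real \<Rightarrow> 'a \<Rightarrow> real) \<Rightarrow> bool" where
  "brownian_motion M W \<longleftrightarrow>
     (\<forall>t\<ge>0. W t \<in> borel_measurable M) \<and>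
     (AE \<omega> in M. W 0 \<omega> = 0) \<and>
     (\<forall>\<omega>\<in>space M. continuous_on {0..} (\<lambda>t. W t \<omega>)) \<and>
     (\<forall>s t. 0 \<le> s \<and> s < t \<longrightarrow>
        distributed M lborel (\<lambda>\<omega>. W t \<omega> - W s \<omega>) (normal_density 0 (sqrt (t - s)))) \<and>
     (\<forall>n (\<tau> :: nat \<Rightarrow> real). 0 \<le> \<tau> 0 \<and> mono \<tau> \<longrightarrow>
        prob_space.indep_vars M (\<lambda>_. borel) (\<lambda>i \<omega>. W (\<tau> (Suc i)) \<omega> - W (\<tau> i) \<omega>) {..<n})"

definition poisson_process :: "'a measure \<Rightarrow> real \<Rightarrow> (real \<Rightarrow> 'a \<Rightarrow> nat) \<Rightarrow> bool" where
  "poisson_process M lam N \<longleftrightarrow>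
     (\<forall>t\<ge>0. N t \<in> measurable M (count_space UNIV)) \<and>
     (AE \<omega> in M. N 0 \<omega> = 0) \<and>
     (\<forall>\<omega>\<in>space M. mono_on {0..} (\<lambda>t. N t \<omega>) \<and>
        (\<forall>t\<ge>0. continuous (at_right t) (\<lambda>s. N s \<omega>))) \<and>
     (\<forall>s t. 0 \<le> s \<and> s < t \<longrightarrow>
        distr M (count_space UNIV) (\<lambda>\<omega>. N t \<omega> - N s \<omega>) = measure_pmf (poisson_pmf (lam * (t - s)))) \<and>
     (\<forall>n (\<tau> :: nat \<Rightarrow> real). 0 \<le> \<tau> 0 \<and> mono \<tau> \<longrightarrow>
        prob_space.indep_vars M (\<lambda>_. count_space UNIV)
          (\<lambda>i \<omega>. N (\<tau> (Suc i)) \<omega> - N (\<tau> i) \<omega>) {..<n})"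

(* The marks are eta_1, eta_2, ...; the value eta_0 is irrelevant. *)
definition iid_marks :: "'a measure \<Rightarrow> real measure \<Rightarrow> (nat \<Rightarrow> 'a \<Rightarrow> real) \<Rightarrow> bool" where
  "iid_marks M \<nu> \<eta> \<longleftrightarrow>
     prob_space.indep_vars M (\<lambda>_. borel) \<eta> {1..} \<and> (\<forall>m\<ge>1. distr M borel (\<eta> m) = \<nu>)"

(* The sigma-algebra on space M generated by the family X i, i \<in> I. *)
definition generated_algebra ::
    "'a measure \<Rightarrow> 'i set \<Rightarrow> 'b measure \<Rightarrow> ('i \<Rightarrow> 'a \<Rightarrow> 'b) \<Rightarrow> 'a measure" where
  "generated_algebra M I K X = vimage_algebra (space M) (\<lambda>\<omega>. \<lambda>i\<in>I. X i \<omega>) (Pi\<^sub>M I (\<lambda>_. K))"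

definition driving_noise ::
    "'a measure \<Rightarrow> real \<Rightarrow> real measure \<Rightarrow> (real \<Rightarrow> 'a \<Rightarrow> real) \<Rightarrow> (real \<Rightarrow> 'a \<Rightarrow> nat) \<Rightarrow>
     (nat \<Rightarrow> 'a \<Rightarrow> real) \<Rightarrow> bool" where
  "driving_noise M lam \<nu> W N \<eta> \<longleftrightarrow>
     prob_space M \<and> brownian_motion M W \<and> poisson_process M lam N \<and> iid_marks M \<nu> \<eta> \<and>
     prob_space.indep_sets M
       (\<lambda>i. [sets (generated_algebra M {0..} borel W),
             sets (generated_algebra M {0..} (count_space UNIV) N),
             sets (generated_algebra M {1..} borel \<eta>)] ! i) {..<3}"

definition noise_algebra ::
    "'a measure \<Rightarrow> (real \<Rightarrow> 'a \<Rightarrow> real) \<Rightarrow> (real \<Rightarrow> 'a \<Rightarrow> nat) \<Rightarrow> (nat \<Rightarrow> 'a \<Rightarrow> real) \<Rightarrow> 'a measure" where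
  "noise_algebra M W N \<eta> = sigma (space M)
     (sets (generated_algebra M {0..} borel W) \<union>
      sets (generated_algebra M {0..} (count_space UNIV) N) \<union>
      sets (generated_algebra M {1..} borel \<eta>))"

(* The filtration generated by W and the marked Poisson process (N, eta): the mark eta_m is
   revealed once N has reached m.  The marks have to be included, since the state jumps by
   eta_(1 + N_(t-)) at the jump times of N. *)
definition noise_filtration ::
    "'a measure \<Rightarrow> (real \<Rightarrow> 'a \<Rightarrow> real) \<Rightarrow> (real \<Rightarrow> 'a \<Rightarrow> nat) \<Rightarrow> (nat \<Rightarrow> 'a \<Rightarrow> real) \<Rightarrow>
     real \<Rightarrow> 'a measure" where
  "noise_filtration M W N \<eta> t = sigma (space M)
     (sets (generated_algebra M {0..t} borel W) \<union>
      sets (generated_algebra M {0..t} (count_space UNIV) N) \<union>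
      sets (generated_algebra M ({0..t} \<times> {1..}) borel
        (\<lambda>(s, m) \<omega>. if m \<le> N s \<omega> then \<eta> m \<omega> else 0)))"

definition enlarged_filtration ::
    "'a measure \<Rightarrow> (real \<Rightarrow> 'a \<Rightarrow> real) \<Rightarrow> (real \<Rightarrow> 'a \<Rightarrow> nat) \<Rightarrow> (nat \<Rightarrow> 'a \<Rightarrow> real) \<Rightarrow>
     ('a \<Rightarrow> real) \<Rightarrow> real \<Rightarrow> 'a measure" where
  "enlarged_filtration M W N \<eta> Z t = sigma (space M)
     (sets (noise_filtration M W N \<eta> t) \<union> sets (vimage_algebra (space M) Z borel))"

(* The sigma-algebra of the noise arriving after time s. *)
definition future_noise_algebra ::
    "'a measure \<Rightarrow> (real \<Rightarrow> 'a \<Rightarrow> real) \<Rightarrow> (real \<Rightarrow> 'a \<Rightarrow> nat) \<Rightarrow> (nat \<Rightarrow> 'a \<Rightarrow> real) \<Rightarrow>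
     real \<Rightarrow> 'a measure" where
  "future_noise_algebra M W N \<eta> s = sigma (space M)
     (sets (generated_algebra M {s..} borel (\<lambda>u \<omega>. W u \<omega> - W s \<omega>)) \<union>
      sets (generated_algebra M {s..} (count_space UNIV) (\<lambda>u \<omega>. N u \<omega> - N s \<omega>)) \<union>
      sets (generated_algebra M {1..} borel (\<lambda>m \<omega>. \<eta> (N s \<omega> + m) \<omega>)))"

definition driving_noise_wrt ::
    "'a measure \<Rightarrow> (real \<Rightarrow> 'a measure) \<Rightarrow> real \<Rightarrow> real measure \<Rightarrow> (real \<Rightarrow> 'a \<Rightarrow> real) \<Rightarrow>
     (real \<Rightarrow> 'a \<Rightarrow> nat) \<Rightarrow> (nat \<Rightarrow> 'a \<Rightarrow> real) \<Rightarrow> bool" where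
  "driving_noise_wrt M F lam \<nu> W N \<eta> \<longleftrightarrow>
     driving_noise M lam \<nu> W N \<eta> \<and> filtration (space M) F \<and>
     (\<forall>s\<ge>0. sets (F s) \<subseteq> sets M \<and> sets (noise_filtration M W N \<eta> s) \<subseteq> sets (F s) \<and>
        prob_space.indep_set M (sets (F s)) (sets (future_noise_algebra M W N \<eta> s)))"

definition left_limit :: "(real \<Rightarrow> nat) \<Rightarrow> real \<Rightarrow> nat" where
  "left_limit n u = Lim (at_left u) n"

(* The pathwise Stieltjes integral of g over (t, s] against a right-continuous nondecreasing
   integer-valued path n: the sum of g(u) (n(u) - n(u-)) over the finitely many jump times u. *)
definition counting_integral ::
    "(real \<Rightarrow> 'b::real_vector) \<Rightarrow> (real \<Rightarrow> nat) \<Rightarrow> real \<Rightarrow> real \<Rightarrow> 'b" where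
  "counting_integral g n t s =
     (\<Sum>u\<in>{u\<in>{t<..s}. n u \<noteq> left_limit n u}. (real (n u) - real (left_limit n u)) *\<^sub>R g u)"

definition cadlag_on :: "real \<Rightarrow> real \<Rightarrow> (real \<Rightarrow> 'b::topological_space) \<Rightarrow> bool" where
  "cadlag_on t T x \<longleftrightarrow>
     (\<forall>s\<in>{t..<T}. (x \<longlongrightarrow> x s) (at_right s)) \<and> (\<forall>s\<in>{t<..T}. \<exists>l. (x \<longlongrightarrow> l) (at_left s))"

(* Y solves dY = beta(u, Y_u) du + sigma dW_u + jump(eta_(1 + N_(u-))) dN_u on [t, T] with Y_t = y.
   The integrand of the stochastic integral is the constant vector sigma, so that the integral
   over (t, s] is (W_s - W_t) sigma. *)
definition sde_solution ::
    "'a measure \<Rightarrow> (real \<Rightarrow> 'a measure) \<Rightarrow> (real \<Rightarrow> 'a \<Rightarrow> real) \<Rightarrow> (real \<Rightarrow> 'a \<Rightarrow> nat) \<Rightarrow>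
     (nat \<Rightarrow> 'a \<Rightarrow> real) \<Rightarrow> (real \<Rightarrow> state \<Rightarrow> state) \<Rightarrow> real \<Rightarrow> real \<Rightarrow> real \<Rightarrow> state \<Rightarrow>
     (real \<Rightarrow> 'a \<Rightarrow> state) \<Rightarrow> bool" where
  "sde_solution M F W N \<eta> \<beta> \<sigma> T t y Y \<longleftrightarrow>
     (\<forall>s\<in>{t..T}. Y s \<in> borel_measurable (F s)) \<and>
     (\<forall>\<omega>\<in>space M. cadlag_on t T (\<lambda>s. Y s \<omega>)) \<and>
     (AE \<omega> in M. set_integrable lborel {t..T} (\<lambda>u. \<beta> u (Y u \<omega>)) \<and>
        (\<forall>s\<in>{t..T}. Y s \<omega> = y + (LINT u:{t..s}|lborel. \<beta> u (Y u \<omega>))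
           + (W s \<omega> - W t \<omega>) *\<^sub>R diffusion \<sigma>
           + counting_integral (\<lambda>u. jump (\<eta> (1 + left_limit (\<lambda>r. N r \<omega>) u) \<omega>)) (\<lambda>r. N r \<omega>) t s))"

definition strong_solution ::
    "'a measure \<Rightarrow> (real \<Rightarrow> 'a \<Rightarrow> real) \<Rightarrow> (real \<Rightarrow> 'a \<Rightarrow> nat) \<Rightarrow>
     (nat \<Rightarrow> 'a \<Rightarrow> real) \<Rightarrow> (real \<Rightarrow> state \<Rightarrow> state) \<Rightarrow> real \<Rightarrow> real \<Rightarrow> real \<Rightarrow> state \<Rightarrow>
     (real \<Rightarrow> 'a \<Rightarrow> state) \<Rightarrow> bool" where
  "strong_solution M W N \<eta> \<beta> \<sigma> T t y Y \<longleftrightarrow>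
     sde_solution M (noise_filtration M W N \<eta>) W N \<eta> \<beta> \<sigma> T t y Y"

definition unique_strong_solution ::
    "'a measure \<Rightarrow> (real \<Rightarrow> 'a \<Rightarrow> real) \<Rightarrow> (real \<Rightarrow> 'a \<Rightarrow> nat) \<Rightarrow>
     (nat \<Rightarrow> 'a \<Rightarrow> real) \<Rightarrow> (real \<Rightarrow> state \<Rightarrow> state) \<Rightarrow> real \<Rightarrow> real \<Rightarrow> real \<Rightarrow> state \<Rightarrow> bool" where
  "unique_strong_solution M W N \<eta> \<beta> \<sigma> T t y \<longleftrightarrow>
     (\<exists>Y. strong_solution M W N \<eta> \<beta> \<sigma> T t y Y \<and>
        (\<forall>Y'. strong_solution M W N \<eta> \<beta> \<sigma> T t y Y' \<longrightarrow>
           (AE \<omega> in M. \<forall>s\<in>{t..T}. Y' s \<omega> = Y s \<omega>)))"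

definition weak_solution ::
    "real \<Rightarrow> real measure \<Rightarrow> (real \<Rightarrow> state \<Rightarrow> state) \<Rightarrow> real \<Rightarrow> real \<Rightarrow> real \<Rightarrow> state \<Rightarrow>
     'a measure \<Rightarrow> (real \<Rightarrow> 'a measure) \<Rightarrow> (real \<Rightarrow> 'a \<Rightarrow> real) \<Rightarrow> (real \<Rightarrow> 'a \<Rightarrow> nat) \<Rightarrow>
     (nat \<Rightarrow> 'a \<Rightarrow> real) \<Rightarrow> (real \<Rightarrow> 'a \<Rightarrow> state) \<Rightarrow> bool" where
  "weak_solution lam \<nu> \<beta> \<sigma> T t y M F W N \<eta> Y \<longleftrightarrow>
     driving_noise_wrt M F lam \<nu> W N \<eta> \<and> sde_solution M F W N \<eta> \<beta> \<sigma> T t y Y"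

(* Weak solutions may live on any filtered probability space.  HOL cannot quantify over the type
   of the sample points, so they are taken on spaces of joint paths of (W, N, eta, Y); this loses
   no generality, because a weak solution on any other space can be transported to such a space by
   the map sending a sample point to its joint path. *)
type_synonym joint_path = "(real \<Rightarrow> real) \<times> (real \<Rightarrow> nat) \<times> (nat \<Rightarrow> real) \<times> (real \<Rightarrow> state)"

(* Existence, and uniqueness in law on the path space over [t, T]. *)
definition unique_weak_solution ::
    "real \<Rightarrow> real measure \<Rightarrow> (real \<Rightarrow> state \<Rightarrow> state) \<Rightarrow> real \<Rightarrow> real \<Rightarrow> real \<Rightarrow> state \<Rightarrow> bool" where
  "unique_weak_solution lam \<nu> \<beta> \<sigma> T t y \<longleftrightarrow>
     (\<exists>(M :: joint_path measure) F W N \<eta> Y. weak_solution lam \<nu> \<beta> \<sigma> T t y M F W N \<eta> Y) \<and>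
     (\<forall>(M :: joint_path measure) F W N \<eta> Y (M' :: joint_path measure) F' W' N' \<eta>' Y'.
        weak_solution lam \<nu> \<beta> \<sigma> T t y M F W N \<eta> Y \<and>
        weak_solution lam \<nu> \<beta> \<sigma> T t y M' F' W' N' \<eta>' Y' \<longrightarrow>
          distr M (Pi\<^sub>M {t..T} (\<lambda>_. borel)) (\<lambda>\<omega>. \<lambda>s\<in>{t..T}. Y s \<omega>) =
          distr M' (Pi\<^sub>M {t..T} (\<lambda>_. borel)) (\<lambda>\<omega>. \<lambda>s\<in>{t..T}. Y' s \<omega>))"

(* G is the filtration with respect to which the randomized actions are chosen; the second clause
   says that the random distribution pi(. | t, xi) is G_t-measurable for every G_t-measurable
   state xi. *)
definition admissible_policy ::
    "real set \<Rightarrow> real \<Rightarrow> real \<Rightarrow> real \<Rightarrow> real \<Rightarrow> real \<Rightarrow> real \<Rightarrow> real measure \<Rightarrow>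
     (real \<Rightarrow> state \<Rightarrow> real \<Rightarrow> state) \<Rightarrow> (real \<Rightarrow> 'a measure) \<Rightarrow> policy \<Rightarrow> bool" where
  "admissible_policy A T \<phi> \<rho> \<gamma> \<sigma> lam \<nu> B G pol \<longleftrightarrow>
     (\<forall>t\<in>{0..T}. \<forall>y. set_borel_measurable lborel A (pol t y) \<and> (\<forall>v\<in>A. 0 \<le> pol t y v) \<and>
        (\<integral>\<^sup>+v\<in>A. ennreal (pol t y v) \<partial>lborel) = 1) \<and>
     (\<forall>t\<in>{0..T}. \<forall>\<xi>\<in>borel_measurable (G t). \<forall>D\<in>sets borel.
        (\<lambda>\<omega>. LINT v:A \<inter> D|lborel. pol t (\<xi> \<omega>) v) \<in> borel_measurable (G t)) \<and>
     (\<forall>t\<in>{0..T}. \<forall>y. unique_weak_solution lam \<nu> (exploratory_drift A B pol) \<sigma> T t y) \<and>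
     (\<forall>t\<in>{0..T}. \<forall>y.
        ((\<lambda>(t', y'). LINT v:A|lborel. \<bar>pol t y v - pol t' y' v\<bar>) \<longlongrightarrow> 0)
          (at (t, y) within {0..T} \<times> UNIV)) \<and>
     (\<exists>C>0. \<forall>t\<in>{0..T}. \<forall>y y'.
        (LINT v:A|lborel. \<bar>pol t y v - pol t y' v\<bar>) \<le> C * norm (y - y')) \<and>
     (\<exists>C>0. \<exists>p\<ge>1. \<forall>t\<in>{0..T}. \<forall>y.
        (\<integral>\<^sup>+v\<in>A. ennreal (\<bar>regularized_cost \<phi> \<rho> \<gamma> pol t y v\<bar> * pol t y v) \<partial>lborel)
          \<le> ennreal (C * (1 + norm y powr p)))"

definition expected_running_cost ::
    "real set \<Rightarrow> real \<Rightarrow> real \<Rightarrow> real \<Rightarrow> policy \<Rightarrow> real \<Rightarrow> state \<Rightarrow> real" where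
  "expected_running_cost A \<phi> \<rho> \<gamma> pol u y =
     (LINT v:A|lborel. regularized_cost \<phi> \<rho> \<gamma> pol u y v * pol u y v)"

definition payoff ::
    "real set \<Rightarrow> real \<Rightarrow> real \<Rightarrow> real \<Rightarrow> real \<Rightarrow> real \<Rightarrow> policy \<Rightarrow> real \<Rightarrow> (real \<Rightarrow> 'a \<Rightarrow> state) \<Rightarrow>
     'a \<Rightarrow> real" where
  "payoff A \<phi> \<rho> \<gamma> \<alpha> T pol t Y \<omega> = terminal_reward \<alpha> (Y T \<omega>)
     - (LINT u:{t..T}|lborel. expected_running_cost A \<phi> \<rho> \<gamma> pol u (Y u \<omega>))"

(* The expected payoff exists and equals V, where all three nested integrals (over actions, time
   and sample points) have to converge absolutely and do not take a default value. *)
definition has_value ::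
    "'a measure \<Rightarrow> real set \<Rightarrow> real \<Rightarrow> real \<Rightarrow> real \<Rightarrow> real \<Rightarrow> real \<Rightarrow> policy \<Rightarrow> real \<Rightarrow>
     (real \<Rightarrow> 'a \<Rightarrow> state) \<Rightarrow> real \<Rightarrow> bool" where
  "has_value M A \<phi> \<rho> \<gamma> \<alpha> T pol t Y V \<longleftrightarrow>
     (AE \<omega> in M.
        (\<forall>u\<in>{t..T}. set_integrable lborel A
           (\<lambda>v. regularized_cost \<phi> \<rho> \<gamma> pol u (Y u \<omega>) v * pol u (Y u \<omega>) v)) \<and>
        set_integrable lborel {t..T} (\<lambda>u. expected_running_cost A \<phi> \<rho> \<gamma> pol u (Y u \<omega>))) \<and>
     has_bochner_integral M (payoff A \<phi> \<rho> \<gamma> \<alpha> T pol t Y) V"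

end

theory Submission
  imports Defs
begin

text \<open>
The diffusion and jump coefficients do not depend on the state. Hence the equation on \<open>[t, T]\<close> is,
for each sample point separately, a deterministic integral equation
\<open>x(s) = y + \<integral>\<^sub>t\<^sup>s \<beta>(u, x(u)) du + g(s)\<close>, where \<open>\<beta>\<close> is the exploratory drift and \<open>g\<close> is the
path of \<open>(W\<^sub>s - W\<^sub>t) \<sigma>\<close> plus the jumps in \<open>(t, s]\<close>. No stochastic integration is involved, and
everything reduces to three ingredients.

The first is the regularity of \<open>\<beta>\<close>. An average of the drift against a policy that is
continuous, respectively Lipschitz, in \<open>L\<^sup>1\<close> is continuous in \<open>(t, y)\<close> and locally Lipschitz in
\<open>y\<close>; the Lipschitz constant grows with \<open>|y|\<close> because the drift itself does, but the growth of
\<open>\<beta>\<close> stays linear (\<open>exploratory_drift_field\<close>). Linear growth bounds all Picard iterates by one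
constant, on the corresponding ball \<open>\<beta>\<close> is Lipschitz, and the iteration converges without any
truncation (\<open>picard_limit_solution\<close>, \<open>driven_solution_unique\<close>). Each iterate is right-continuous
and adapted, so its integral is adapted, and so is the limit: the solution is strong
(\<open>adapted_solution_exists\<close>). The filtration is not completed; therefore the solution is
constructed at every sample point, and the jump part has to be shown measurable at every sample
point, including those where several units of \<open>N\<close> arrive at once (\<open>counting_integral_measurable\<close>).

The second is a moment bound. Gronwall's inequality gives
\<open>|Y\<^sub>s| \<le> K (|y| + X)\<close> on \<open>[t, T]\<close>, where the random variable \<open>X\<close> is, up to an additive
constant, a bound for \<open>|g|\<close> that does not depend on \<open>t\<close> and \<open>y\<close>. It remains to find such an
\<open>X\<close> with a finite moment of given order (\<open>sde_noise_moment\<close>). For the Brownian part this is a dyadic chaining argument, based on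
the Gaussian moments of the increments (\<open>brownian_running_max_moment\<close>). The jump part is at most
\<open>N\<^sub>T (|\<eta>\<^sub>1| + \<dots> + |\<eta>\<^bsub>N\<^sub>T\<^esub>|)\<close>, whose moments are estimated by moments of \<open>N\<^sub>T\<close> and of the marks
separately (\<open>jump_total_moment\<close>).

The third is the measurability of the expected running cost in \<open>(t, y)\<close>. The policy is continuous
in \<open>L\<^sup>1\<close> only, which does not make its entropy continuous. The entropy is, however, a limit of
integrals of Lipschitz functions of the density, and these are continuous
(\<open>expected_running_cost_measurable\<close>). The Lipschitz condition on the drift forces the action space
to be bounded (\<open>action_space_bounded\<close>), so the quadratic part of the cost is continuous. As the cost
and the terminal reward grow polynomially, the second ingredient makes the payoff integrable
(\<open>additive_payoff_integrable\<close>).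
\<close>

section \<open>Pathwise equations driven by a locally Lipschitz field\<close>

lemma set_integrable_const_Icc:
  fixes c :: "'b::{banach, second_countable_topology}"
  shows "set_integrable lborel {t..s::real} (\<lambda>_. c)"
  unfolding set_integrable_def
  by (intro integrable_scaleR_left integrable_real_indicator) (auto simp: emeasure_lborel_Icc_eq)

lemma set_integral_const_Icc:
  fixes c :: "'b::{banach, second_countable_topology}"
  shows "t \<le> s \<Longrightarrow> (LINT r:{t..s::real}|lborel. c) = (s - t) *\<^sub>R c"
  by (simp add: set_lebesgue_integral_def)

lemma set_integrable_norm:
  fixes f :: "'a \<Rightarrow> 'b::{banach, second_countable_topology}"
  assumes "set_integrable M A f"
  shows "set_integrable M A (\<lambda>x. norm (f x))"
  using integrable_norm[OF assms[unfolded set_integrable_def]] by (simp add: set_integrable_def)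

lemma bounded_set_integrable:
  fixes f :: "real \<Rightarrow> 'b::{banach, second_countable_topology}"
  assumes "set_borel_measurable lborel {t..s} f" "\<And>r. r \<in> {t..s} \<Longrightarrow> norm (f r) \<le> B"
  shows "set_integrable lborel {t..s} f"
proof -
  have "set_integrable lborel {t..s} (\<lambda>_. B)"
    by (rule set_integrable_const_Icc)
  then show ?thesis
  proof (rule set_integrable_bound)
    show "AE r in lborel. r \<in> {t..s} \<longrightarrow> norm (f r) \<le> norm B"
      using assms(2) by (intro AE_I2) fastforce
  qed (rule assms(1))
qed

text \<open>
The weight \<open>exp (2L(r - t))\<close> turns integration with factor \<open>L\<close> into a contraction with constant
one half. It replaces the factorials of the usual Picard and Gronwall estimates.
\<close>

lemma exp_weight_integral:
  fixes t s L c :: real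
  assumes "t \<le> s" "0 < L"
  shows "set_integrable lborel {t..s} (\<lambda>r. L * (c * exp (2 * L * (r - t))))"
    and "(LINT r:{t..s}|lborel. L * (c * exp (2 * L * (r - t)))) = c / 2 * (exp (2 * L * (s - t)) - 1)"
proof -
  have H: "has_bochner_integral lborel (\<lambda>r. indicator {t..s} r *\<^sub>R (L * (c * exp (2 * L * (r - t)))))
      (c / 2 * exp (2 * L * (s - t)) - c / 2 * exp (2 * L * (t - t)))"
    using assms
    by (intro has_bochner_integral_FTC_Icc)
       (auto intro!: derivative_eq_intros continuous_intros
         simp flip: has_real_derivative_iff_has_vector_derivative)
  show "set_integrable lborel {t..s} (\<lambda>r. L * (c * exp (2 * L * (r - t))))"
    using H by (simp only: has_bochner_integral_iff set_integrable_def)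
  have "(LINT r:{t..s}|lborel. L * (c * exp (2 * L * (r - t)))) =
      c / 2 * exp (2 * L * (s - t)) - c / 2 * exp (2 * L * (t - t))"
    using H by (simp only: has_bochner_integral_iff set_lebesgue_integral_def)
  also have "\<dots> = c / 2 * (exp (2 * L * (s - t)) - 1)"
    by (simp add: right_diff_distrib)
  finally show "(LINT r:{t..s}|lborel. L * (c * exp (2 * L * (r - t)))) = c / 2 * (exp (2 * L * (s - t)) - 1)" .
qed

lemma exp_weighted_integral_bound:
  fixes f :: "real \<Rightarrow> 'b::{banach, second_countable_topology}"
  assumes "t \<le> s" "0 < L" "set_integrable lborel {t..s} f"
    and bound: "\<And>r. r \<in> {t..s} \<Longrightarrow> norm (f r) \<le> d + L * (c * exp (2 * L * (r - t)))"
  shows "norm (LINT r:{t..s}|lborel. f r) \<le> d * (s - t) + c / 2 * (exp (2 * L * (s - t)) - 1)"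
proof -
  have d: "set_integrable lborel {t..s} (\<lambda>_. d)"
    by (rule set_integrable_const_Icc)
  note w = exp_weight_integral[OF assms(1,2), of c]
  have "norm (LINT r:{t..s}|lborel. f r) \<le> (LINT r:{t..s}|lborel. norm (f r))"
    using assms(3) by (rule set_integral_norm_bound)
  also have "\<dots> \<le> (LINT r:{t..s}|lborel. d + L * (c * exp (2 * L * (r - t))))"
    using bound by (intro set_integral_mono set_integral_add(1) d w(1) set_integrable_norm assms(3)) auto
  also have "\<dots> = d * (s - t) + c / 2 * (exp (2 * L * (s - t)) - 1)"
    unfolding set_integral_add(2)[OF d w(1)] w(2)
    using assms(1) by (simp add: set_integral_const_Icc)
  finally show ?thesis .
qed

lemma norm_sum3_le:
  fixes a b c :: "'b::real_normed_vector"
  shows "norm (a + b + c) \<le> norm a + norm b + norm c"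
  by (intro norm_triangle_mono order_refl)

text \<open>
Let \<open>K\<close> be the supremum of \<open>u\<close> divided by the weight \<open>exp (2L(s - t))\<close>. The integral inequality
yields \<open>K \<le> a + K/2\<close>, which bounds \<open>K\<close> because boundedness of \<open>u\<close> makes \<open>K\<close> finite. The factor 2
is not sharp, but harmless for the existence of constants.
\<close>

lemma gronwall:
  fixes u :: "real \<Rightarrow> real"
  assumes "0 < L" and meas: "set_borel_measurable lborel {t..T} u"
    and bounds: "\<And>s. s \<in> {t..T} \<Longrightarrow> 0 \<le> u s \<and> u s \<le> B"
    and step: "\<And>s. s \<in> {t..T} \<Longrightarrow> u s \<le> a + L * (LINT r:{t..s}|lborel. u r)"
    and s: "s \<in> {t..T}"
  shows "u s \<le> 2 * a * exp (2 * L * (s - t))"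
proof -
  define K where "K = (SUP s\<in>{t..T}. u s * exp (- (2 * L * (s - t))))"
  have e1: "0 < exp (- (2 * L * (r - t)))" "exp (- (2 * L * (r - t))) \<le> 1" if "r \<in> {t..T}" for r
    using that \<open>0 < L\<close> by (auto simp: zero_le_mult_iff)
  have bdd: "bdd_above ((\<lambda>s. u s * exp (- (2 * L * (s - t)))) ` {t..T})"
  proof (rule bdd_aboveI2)
    fix r assume r: "r \<in> {t..T}"
    show "u r * exp (- (2 * L * (r - t))) \<le> B"
      using mult_left_le[OF e1(2)[OF r], of "u r"] bounds[OF r] by linarith
  qed
  have K: "u r \<le> K * exp (2 * L * (r - t))" if "r \<in> {t..T}" for r
  proof -
    have "u r * exp (- (2 * L * (r - t))) \<le> K"
      using cSUP_upper[OF that bdd] by (simp add: K_def)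
    then have "u r * exp (- (2 * L * (r - t))) * exp (2 * L * (r - t)) \<le> K * exp (2 * L * (r - t))"
      by (rule mult_right_mono) simp
    then show ?thesis by (simp add: mult.assoc flip: exp_add)
  qed
  have "K \<ge> 0"
  proof -
    have "0 \<le> u s * exp (- (2 * L * (s - t)))" using bounds[OF s] by simp
    also have "\<dots> \<le> K" using cSUP_upper[OF s bdd] by (simp add: K_def)
    finally show ?thesis .
  qed
  have int: "set_integrable lborel {t..r} u" if "r \<in> {t..T}" for r
  proof -
    have "set_integrable lborel {t..T} u"
      using meas bounds by (intro bounded_set_integrable[where B = B]) auto
    then show ?thesis
      by (rule set_integrable_subset) (use that in auto)
  qed
  have "u r \<le> a + K / 2 * (exp (2 * L * (r - t)) - 1)" if r: "r \<in> {t..T}" for r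
  proof -
    have "norm (LINT q:{t..r}|lborel. L * u q) \<le> 0 * (r - t) + K / 2 * (exp (2 * L * (r - t)) - 1)"
      using r \<open>0 < L\<close> int[OF r] K bounds by (intro exp_weighted_integral_bound) auto
    then show ?thesis using step[OF r] by simp
  qed
  note * = this
  have "a \<ge> 0" using *[of t] bounds[of t] s by auto
  have "u r * exp (- (2 * L * (r - t))) \<le> a + K / 2" if r: "r \<in> {t..T}" for r
  proof -
    have "u r * exp (- (2 * L * (r - t))) \<le> (a + K / 2 * (exp (2 * L * (r - t)) - 1)) * exp (- (2 * L * (r - t)))"
      using * r by (intro mult_right_mono) auto
    also have "\<dots> = a * exp (- (2 * L * (r - t))) + K / 2 - K / 2 * exp (- (2 * L * (r - t)))"
      by (simp add: algebra_simps flip: exp_add)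
    also have "\<dots> \<le> a * 1 + K / 2"
      using \<open>a \<ge> 0\<close> \<open>K \<ge> 0\<close> mult_left_mono[OF e1(2)[OF r] \<open>a \<ge> 0\<close>]
        mult_nonneg_nonneg[OF \<open>K \<ge> 0\<close> exp_ge_zero[of "- (2 * L * (r - t))"]] by linarith
    finally show ?thesis by simp
  qed
  then have "K \<le> a + K / 2"
    unfolding K_def using s by (intro cSUP_least) auto
  then have "K \<le> 2 * a" by simp
  then have "K * exp (2 * L * (s - t)) \<le> 2 * a * exp (2 * L * (s - t))"
    by (rule mult_right_mono) simp
  then show ?thesis using K[OF s] by linarith
qed

lemma set_lborel_integral_diff_bound:
  fixes f :: "real \<Rightarrow> 'b::{banach, second_countable_topology}"
  assumes f: "set_integrable lborel {t..T} f" "\<And>r. r \<in> {t..T} \<Longrightarrow> norm (f r) \<le> B"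
    and s: "t \<le> s" "s \<le> s'" "s' \<le> T"
  shows "norm ((LINT r:{t..s'}|lborel. f r) - (LINT r:{t..s}|lborel. f r)) \<le> B * (s' - s)"
proof -
  have i: "set_integrable lborel {t..s} f" "set_integrable lborel {s<..s'} f"
    using s by (auto intro!: set_integrable_subset[OF f(1)])
  have "{t..s'} = {t..s} \<union> {s<..s'}" using s by auto
  then have "(LINT r:{t..s'}|lborel. f r) = (LINT r:{t..s}|lborel. f r) + (LINT r:{s<..s'}|lborel. f r)"
    using i by (simp only:) (rule set_integral_Un, auto)
  also have "norm (\<dots> - (LINT r:{t..s}|lborel. f r)) \<le> (LINT r:{s<..s'}|lborel. norm (f r))"
    using set_integral_norm_bound[OF i(2)] by simp
  also have "\<dots> \<le> (LINT r:{s<..s'}|lborel. B)"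
  proof (rule set_integral_mono)
    show "set_integrable lborel {s<..s'} (\<lambda>_. B)"
      by (rule set_integrable_subset[OF set_integrable_const_Icc[of s s']]) auto
  qed (use s i(2) f(2) in \<open>auto intro: set_integrable_norm\<close>)
  also have "\<dots> = B * (s' - s)"
    using s by (simp add: set_lebesgue_integral_def mult.commute)
  finally show ?thesis .
qed

lemma indefinite_integral_regular:
  fixes f :: "real \<Rightarrow> 'b::{banach, second_countable_topology}"
  assumes f: "set_integrable lborel {t..T} f" "\<And>r. r \<in> {t..T} \<Longrightarrow> norm (f r) \<le> B"
  shows "continuous_on {t..T} (\<lambda>s. LINT r:{t..s}|lborel. f r)"
    and "set_borel_measurable lborel {t..T} (\<lambda>s. LINT r:{t..s}|lborel. f r)"
proof -
  have *: "norm ((LINT r:{t..s}|lborel. f r) - (LINT r:{t..s'}|lborel. f r)) \<le> B * \<bar>s - s'\<bar>"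
    if "s \<in> {t..T}" "s' \<in> {t..T}" for s s'
    using set_lborel_integral_diff_bound[OF f, of s s'] set_lborel_integral_diff_bound[OF f, of s' s] that
    by (cases "s \<le> s'") (auto simp: norm_minus_commute)
  show c: "continuous_on {t..T} (\<lambda>s. LINT r:{t..s}|lborel. f r)"
  proof (cases "t \<le> T")
    case True
    then have "0 \<le> B" using f(2)[of t] by (simp add: order_trans[OF norm_ge_zero])
    show ?thesis
      by (rule lipschitz_on_continuous_on[where L = B])
         (auto intro!: lipschitz_onI * \<open>0 \<le> B\<close> simp: dist_norm)
  qed auto
  then show "set_borel_measurable lborel {t..T} (\<lambda>s. LINT r:{t..s}|lborel. f r)"
    by (auto intro!: borel_measurable_continuous_on_indicator simp: set_borel_measurable_def)
qed

locale locally_lipschitz_field =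
  fixes T L :: real and \<beta> :: "real \<Rightarrow> 'b::euclidean_space \<Rightarrow> 'b"
  assumes L_pos: "0 < L"
    and field_continuous: "continuous_on ({0..T} \<times> UNIV) (\<lambda>(t, y). \<beta> t y)"
    and linear_growth: "\<And>t y. t \<in> {0..T} \<Longrightarrow> norm (\<beta> t y) \<le> L * (1 + norm y)"
    and locally_lipschitz: "\<And>R. \<exists>\<Lambda>>0. \<forall>t\<in>{0..T}. \<forall>y y'. norm y \<le> R \<and> norm y' \<le> R \<longrightarrow>
          norm (\<beta> t y - \<beta> t y') \<le> \<Lambda> * norm (y - y')"
begin

lemma field_measurable:
  "(\<lambda>(u, z). indicator {0..T} u *\<^sub>R \<beta> u z) \<in> borel_measurable borel"
proof -
  have "(\<lambda>p. indicator ({0..T} \<times> UNIV) p *\<^sub>R (case p of (u, z) \<Rightarrow> \<beta> u z)) \<in> borel_measurable borel"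
    using field_continuous by (intro borel_measurable_continuous_on_indicator) (auto intro!: borel_closed closed_Times)
  also have "(\<lambda>p. indicator ({0..T} \<times> UNIV) p *\<^sub>R (case p of (u, z) \<Rightarrow> \<beta> u z)) =
      (\<lambda>(u, z). indicator {0..T} u *\<^sub>R \<beta> u z)"
    by (auto simp: indicator_def)
  finally show ?thesis .
qed

lemma field_along_path_measurable:
  assumes "0 \<le> t" "set_borel_measurable lborel {t..T} x"
  shows "set_borel_measurable lborel {t..T} (\<lambda>u. \<beta> u (x u))"
proof -
  have [measurable]: "(\<lambda>u. indicator {t..T} u *\<^sub>R x u) \<in> borel_measurable borel"
    using assms(2) by (simp add: set_borel_measurable_def)
  have f[measurable]: "(\<lambda>(u, z). indicator {0..T} u *\<^sub>R \<beta> u z) \<in> borel_measurable (borel \<Otimes>\<^sub>M borel)"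
    using field_measurable by (simp add: borel_prod)
  have "(\<lambda>u. indicator {t..T} u *\<^sub>R (case (u, indicator {t..T} u *\<^sub>R x u) of (u, z) \<Rightarrow> indicator {0..T} u *\<^sub>R \<beta> u z)) \<in> borel_measurable borel"
    by measurable
  also have "(\<lambda>u. indicator {t..T} u *\<^sub>R (case (u, indicator {t..T} u *\<^sub>R x u) of (u, z) \<Rightarrow> indicator {0..T} u *\<^sub>R \<beta> u z)) =
     (\<lambda>u. indicator {t..T} u *\<^sub>R \<beta> u (x u))"
    using assms(1) by (auto simp: indicator_def)
  finally show ?thesis by (simp add: set_borel_measurable_def)
qed

definition driven_solution :: "real \<Rightarrow> 'b \<Rightarrow> (real \<Rightarrow> 'b) \<Rightarrow> (real \<Rightarrow> 'b) \<Rightarrow> bool" where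
  "driven_solution t y g x \<longleftrightarrow> set_integrable lborel {t..T} (\<lambda>u. \<beta> u (x u)) \<and>
     (\<forall>s\<in>{t..T}. x s = y + (LINT u:{t..s}|lborel. \<beta> u (x u)) + g s)"

text \<open>
A solution is bounded because its drift is integrable by definition. Gronwall's inequality requires this
below.
\<close>

lemma driven_solution_bounded:
  assumes "driven_solution t y g x" "\<And>s. s \<in> {t..T} \<Longrightarrow> norm (g s) \<le> G"
  shows "\<exists>B. \<forall>s\<in>{t..T}. norm (x s) \<le> B"
proof (intro exI ballI)
  let ?f = "\<lambda>u. \<beta> u (x u)"
  fix s assume s: "s \<in> {t..T}"
  have i: "set_integrable lborel {t..T} ?f" using assms(1) by (simp add: driven_solution_def)
  have int_s: "set_integrable lborel {t..s} ?f" by (rule set_integrable_subset[OF i]) (use s in auto)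
  have "norm (LINT u:{t..s}|lborel. ?f u) \<le> (LINT u:{t..s}|lborel. norm (?f u))"
    using int_s by (rule set_integral_norm_bound)
  also have "\<dots> \<le> (LINT u:{t..T}|lborel. norm (?f u))"
    unfolding set_lebesgue_integral_def using s
    by (intro integral_mono set_integrable_norm[unfolded set_integrable_def, OF i[unfolded set_integrable_def]]
          set_integrable_norm[unfolded set_integrable_def, OF int_s[unfolded set_integrable_def]])
       (auto simp: indicator_def)
  finally have "norm (LINT u:{t..s}|lborel. ?f u) \<le> (LINT u:{t..T}|lborel. norm (?f u))" .
  moreover have "norm (x s) \<le> norm y + norm (LINT u:{t..s}|lborel. ?f u) + norm (g s)"
    using assms(1) s by (simp add: driven_solution_def norm_sum3_le)
  ultimately show "norm (x s) \<le> norm y + (LINT u:{t..T}|lborel. norm (?f u)) + G"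
    using assms(2)[OF s] by linarith
qed

lemma driven_solution_growth:
  assumes "0 \<le> t" and x: "driven_solution t y g x" "set_borel_measurable lborel {t..T} x"
    and G: "\<And>s. s \<in> {t..T} \<Longrightarrow> norm (g s) \<le> G"
    and s: "s \<in> {t..T}"
  shows "norm (x s) \<le> 2 * (norm y + L * T + G) * exp (2 * L * (s - t))"
proof -
  obtain B where B: "\<And>s. s \<in> {t..T} \<Longrightarrow> norm (x s) \<le> B"
    using driven_solution_bounded[of t y g x G, OF x(1) G] by metis
  have mx: "set_borel_measurable lborel {t..T} (\<lambda>s. norm (x s))"
  proof -
    have "(\<lambda>u. norm (indicator {t..T} u *\<^sub>R x u)) \<in> borel_measurable lborel"
      using x(2) unfolding set_borel_measurable_def by (rule measurable_compose[OF _ borel_measurable_norm])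
    then show ?thesis by (simp add: set_borel_measurable_def)
  qed
  show ?thesis
  proof (rule gronwall[OF L_pos mx _ _ s])
    fix r assume r: "r \<in> {t..T}"
    show "0 \<le> norm (x r) \<and> norm (x r) \<le> B" using B[OF r] by simp
    have "set_integrable lborel {t..T} (\<lambda>s. norm (x s))"
      using mx B by (intro bounded_set_integrable[where B = B]) auto
    then have i: "set_integrable lborel {t..r} (\<lambda>s. norm (x s))"
      by (rule set_integrable_subset) (use r in auto)
    have ib: "set_integrable lborel {t..r} (\<lambda>u. \<beta> u (x u))"
      by (rule set_integrable_subset[of _ "{t..T}"]) (use r x(1) in \<open>auto simp: driven_solution_def\<close>)
    have "norm (LINT u:{t..r}|lborel. \<beta> u (x u)) \<le> (LINT u:{t..r}|lborel. norm (\<beta> u (x u)))"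
      using ib by (rule set_integral_norm_bound)
    also have "\<dots> \<le> (LINT u:{t..r}|lborel. L + L * norm (x u))"
    proof (rule set_integral_mono)
      show "set_integrable lborel {t..r} (\<lambda>u. L + L * norm (x u))"
        using i by (intro set_integral_add set_integrable_const_Icc) auto
    qed (use r \<open>0 \<le> t\<close> linear_growth in \<open>auto intro: set_integrable_norm[OF ib] simp: algebra_simps\<close>)
    also have "\<dots> = (LINT u:{t..r}|lborel. L) + (LINT u:{t..r}|lborel. L * norm (x u))"
      using i by (intro set_integral_add set_integrable_const_Icc) auto
    also have "\<dots> = L * (r - t) + L * (LINT u:{t..r}|lborel. norm (x u))"
      using r by (simp add: set_integral_const_Icc mult.commute)
    also have "L * (r - t) \<le> L * T" using r \<open>0 \<le> t\<close> L_pos by (intro mult_left_mono) auto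
    finally have "norm (LINT u:{t..r}|lborel. \<beta> u (x u)) \<le> L * T + L * (LINT u:{t..r}|lborel. norm (x u))"
      by simp
    moreover have "norm (x r) \<le> norm y + norm (LINT u:{t..r}|lborel. \<beta> u (x u)) + norm (g r)"
      using x(1) r by (simp add: driven_solution_def norm_sum3_le)
    ultimately show "norm (x r) \<le> norm y + L * T + G + L * (LINT u:{t..r}|lborel. norm (x u))"
      using G[OF r] by linarith
  qed
qed

lemma driven_solution_unique:
  assumes "0 \<le> t" and x: "driven_solution t y g x" "set_borel_measurable lborel {t..T} x"
    and x': "driven_solution t y g x'" "set_borel_measurable lborel {t..T} x'"
    and G: "\<And>s. s \<in> {t..T} \<Longrightarrow> norm (g s) \<le> G"
    and s: "s \<in> {t..T}"
  shows "x s = x' s"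
proof -
  obtain B0 where B0: "\<And>s. s \<in> {t..T} \<Longrightarrow> norm (x s) \<le> B0"
    using driven_solution_bounded[of t y g x G, OF x(1) G] by metis
  obtain B1 where B1: "\<And>s. s \<in> {t..T} \<Longrightarrow> norm (x' s) \<le> B1"
    using driven_solution_bounded[of t y g x' G, OF x'(1) G] by metis
  define B where "B = max B0 B1"
  have B: "norm (x s) \<le> B" "norm (x' s) \<le> B" if "s \<in> {t..T}" for s
    using B0[OF that] B1[OF that] by (auto simp: B_def)
  obtain \<Lambda> where \<Lambda>: "\<Lambda> > 0" "\<And>t y y'. t \<in> {0..T} \<Longrightarrow> norm y \<le> B \<Longrightarrow> norm y' \<le> B \<Longrightarrow>
      norm (\<beta> t y - \<beta> t y') \<le> \<Lambda> * norm (y - y')"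
    using locally_lipschitz[of B] by auto
  have md: "set_borel_measurable lborel {t..T} (\<lambda>s. norm (x s - x' s))"
  proof -
    have "(\<lambda>u. norm (indicator {t..T} u *\<^sub>R x u - indicator {t..T} u *\<^sub>R x' u)) \<in> borel_measurable lborel"
      using x(2) x'(2) unfolding set_borel_measurable_def
      by (intro measurable_compose[OF _ borel_measurable_norm] borel_measurable_diff)
    then show ?thesis by (simp add: set_borel_measurable_def flip: scaleR_diff_right)
  qed
  have Bd: "norm (x r - x' r) \<le> 2 * B" if "r \<in> {t..T}" for r
    using B[OF that] norm_triangle_ineq4[of "x r" "x' r"] by linarith
  have "norm (x s - x' s) \<le> 2 * 0 * exp (2 * \<Lambda> * (s - t))"
  proof (rule gronwall[OF \<Lambda>(1) md _ _ s])
    fix r assume r: "r \<in> {t..T}"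
    show "0 \<le> norm (x r - x' r) \<and> norm (x r - x' r) \<le> 2 * B" using Bd[OF r] by simp
    have "set_integrable lborel {t..T} (\<lambda>s. norm (x s - x' s))"
      using md Bd by (intro bounded_set_integrable[where B = "2 * B"]) auto
    then have i: "set_integrable lborel {t..r} (\<lambda>s. norm (x s - x' s))"
      by (rule set_integrable_subset) (use r in auto)
    have ib: "set_integrable lborel {t..r} (\<lambda>u. \<beta> u (x u))" "set_integrable lborel {t..r} (\<lambda>u. \<beta> u (x' u))"
      by (rule set_integrable_subset[of _ "{t..T}"]; use r x(1) x'(1) in \<open>auto simp: driven_solution_def\<close>)+
    have "x r - x' r = (LINT u:{t..r}|lborel. \<beta> u (x u) - \<beta> u (x' u))"
      using x(1) x'(1) r ib by (simp add: driven_solution_def)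
    also have "norm \<dots> \<le> (LINT u:{t..r}|lborel. norm (\<beta> u (x u) - \<beta> u (x' u)))"
      using ib by (intro set_integral_norm_bound set_integral_diff)
    also have "\<dots> \<le> (LINT u:{t..r}|lborel. \<Lambda> * norm (x u - x' u))"
    proof (rule set_integral_mono)
      show "set_integrable lborel {t..r} (\<lambda>u. norm (\<beta> u (x u) - \<beta> u (x' u)))"
        by (rule set_integrable_norm[OF set_integral_diff(1)[OF ib]])
    qed (use i r \<open>0 \<le> t\<close> in \<open>auto intro!: \<Lambda>(2) B\<close>)
    finally show "norm (x r - x' r) \<le> 0 + \<Lambda> * (LINT u:{t..r}|lborel. norm (x u - x' u))"
      by simp
  qed
  then show ?thesis by simp
qed

primrec picard :: "real \<Rightarrow> 'b \<Rightarrow> (real \<Rightarrow> 'b) \<Rightarrow> nat \<Rightarrow> real \<Rightarrow> 'b" where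
  "picard t y g 0 = (\<lambda>s. y)"
| "picard t y g (Suc j) = (\<lambda>s. y + (LINT u:{t..s}|lborel. \<beta> u (picard t y g j u)) + g s)"

definition picard_limit :: "real \<Rightarrow> 'b \<Rightarrow> (real \<Rightarrow> 'b) \<Rightarrow> real \<Rightarrow> 'b" where
  "picard_limit t y g s = lim (\<lambda>j. picard t y g j s)"

lemma field_along_bounded_path:
  assumes "0 \<le> t" "set_borel_measurable lborel {t..T} x" "\<And>u. u \<in> {t..T} \<Longrightarrow> norm (x u) \<le> R"
  shows "set_integrable lborel {t..T} (\<lambda>u. \<beta> u (x u))"
    and "\<And>u. u \<in> {t..T} \<Longrightarrow> norm (\<beta> u (x u)) \<le> L * (1 + R)"
proof -
  show *: "\<And>u. u \<in> {t..T} \<Longrightarrow> norm (\<beta> u (x u)) \<le> L * (1 + R)"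
    using linear_growth assms(1,3) L_pos by (smt (verit) atLeastAtMost_iff mult_left_mono)
  show "set_integrable lborel {t..T} (\<lambda>u. \<beta> u (x u))"
    using * field_along_path_measurable[OF assms(1,2)] by (rule_tac bounded_set_integrable[where B = "L * (1 + R)"])
qed

context
  fixes t :: real and y :: 'b and g :: "real \<Rightarrow> 'b" and G :: real
  assumes t: "0 \<le> t"
    and g_measurable: "set_borel_measurable lborel {t..T} g"
    and g_bound: "\<And>s. s \<in> {t..T} \<Longrightarrow> norm (g s) \<le> G"
begin

text \<open>
The bound is an invariant of the iteration: inserting it into the linear growth condition reproduces
it. One ball therefore contains all iterates, and a Lipschitz constant on that ball is enough.
\<close>

lemma picard_invariant:
  "set_borel_measurable lborel {t..T} (picard t y g j) \<and>
   (\<forall>s\<in>{t..T}. norm (picard t y g j s) \<le> 2 * (norm y + L * T + G) * exp (2 * L * (s - t)))"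
proof (cases "t \<le> T")
  case False
  then have "{t..T} = {}" by auto
  then show ?thesis by (simp add: set_borel_measurable_def)
next
  case True
  \<comment> \<open>\<open>a\<close> collects the contributions that do not involve the previous iterate\<close>
  define a where "a = norm y + L * T + G"
  have LT: "0 \<le> L * T" using L_pos t True by simp
  have "0 \<le> G" using g_bound[of t] True by (simp add: order_trans[OF norm_ge_zero])
  then have a: "0 \<le> a" "norm y \<le> a" using LT by (auto simp: a_def)
  have e1: "1 \<le> exp (2 * L * (s - t))" if "s \<in> {t..T}" for s
    using that L_pos by auto
  have e2: "exp (2 * L * (s - t)) \<le> exp (2 * L * (T - t))" if "s \<in> {t..T}" for s
    using that L_pos by auto
  show ?thesis unfolding a_def[symmetric]
  proof (induction j)
    case 0
    have "norm y \<le> 2 * a * exp (2 * L * (s - t))" if "s \<in> {t..T}" for s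
      using a mult_mono[of 1 2 a a] mult_left_mono[OF e1[OF that], of "2 * a"] by simp
    then show ?case by (auto simp: set_borel_measurable_def)
  next
    case (Suc j)
    let ?x = "picard t y g j"
    note IH = Suc[THEN conjunct1] Suc[THEN conjunct2, rule_format]
    have B: "norm (?x s) \<le> 2 * a * exp (2 * L * (T - t))" if "s \<in> {t..T}" for s
      using IH(2)[OF that] mult_left_mono[OF e2[OF that], of "2 * a"] a(1) by simp
    note f = field_along_bounded_path[OF t IH(1) B]
    have "norm (picard t y g (Suc j) s) \<le> 2 * a * exp (2 * L * (s - t))" if s: "s \<in> {t..T}" for s
    proof -
      have i: "set_integrable lborel {t..s} (\<lambda>u. \<beta> u (?x u))"
        by (rule set_integrable_subset[OF f(1)]) (use s in auto)
      have "norm (LINT u:{t..s}|lborel. \<beta> u (?x u)) \<le> L * (s - t) + 2 * a / 2 * (exp (2 * L * (s - t)) - 1)"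
      proof (rule exp_weighted_integral_bound[OF _ L_pos i])
        fix r assume r: "r \<in> {t..s}"
        then have "norm (\<beta> r (?x r)) \<le> L * (1 + norm (?x r))"
          using s t by (intro linear_growth) auto
        also have "\<dots> \<le> L * (1 + 2 * a * exp (2 * L * (r - t)))"
          using IH(2)[of r] r s L_pos by (intro mult_left_mono) auto
        finally show "norm (\<beta> r (?x r)) \<le> L + L * (2 * a * exp (2 * L * (r - t)))"
          by (simp add: algebra_simps)
      qed (use s in auto)
      also have "L * (s - t) \<le> L * T" using s t L_pos by (intro mult_left_mono) auto
      finally have "norm (LINT u:{t..s}|lborel. \<beta> u (?x u)) \<le> L * T + a * (exp (2 * L * (s - t)) - 1)"
        by simp
      moreover have "norm (picard t y g (Suc j) s) \<le> norm y + norm (LINT u:{t..s}|lborel. \<beta> u (?x u)) + norm (g s)"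
        by (simp add: norm_sum3_le)
      moreover have "norm (g s) \<le> G" using g_bound[OF s] .
      moreover have "0 \<le> a * exp (2 * L * (s - t))" using a by simp
      ultimately show ?thesis unfolding a_def[symmetric] using a_def by (simp add: algebra_simps)
    qed
    moreover have "set_borel_measurable lborel {t..T} (picard t y g (Suc j))"
    proof -
      have "(\<lambda>s. indicator {t..T} s *\<^sub>R y + indicator {t..T} s *\<^sub>R (LINT u:{t..s}|lborel. \<beta> u (?x u)) + indicator {t..T} s *\<^sub>R g s)
        \<in> borel_measurable lborel"
        using g_measurable indefinite_integral_regular(2)[OF f] unfolding set_borel_measurable_def
        by measurable
      then show ?thesis
        by (simp add: set_borel_measurable_def scaleR_add_right)
    qed
    ultimately show ?case by blast
  qed
qed

lemmas picard_measurable = picard_invariant[THEN conjunct1]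

lemma picard_bound:
  assumes "s \<in> {t..T}"
  shows "norm (picard t y g j s) \<le> 2 * (norm y + L * T + G) * exp (2 * L * (T - t))"
proof -
  have "0 \<le> G" using g_bound[OF assms] norm_ge_zero order_trans by blast
  then have "2 * (norm y + L * T + G) * exp (2 * L * (s - t)) \<le> 2 * (norm y + L * T + G) * exp (2 * L * (T - t))"
    using L_pos t assms by (intro mult_left_mono) auto
  then show ?thesis using picard_invariant[of j] assms by fastforce
qed

text \<open>
With \<open>\<Lambda>\<close> the Lipschitz constant on the invariant ball, the distance of consecutive iterates, weighted
by \<open>exp (2 \<Lambda> (r - t))\<close>, is halved in each step, so the telescoping series converges.
\<close>

lemma picard_convergent:
  assumes s: "s \<in> {t..T}"
  shows "convergent (\<lambda>j. picard t y g j s)"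
proof -
  define R where "R = 2 * (norm y + L * T + G) * exp (2 * L * (T - t))"
  have R: "norm (picard t y g j r) \<le> R" if "r \<in> {t..T}" for j r
    using picard_bound[OF that] by (simp add: R_def)
  have "0 \<le> R" using R[OF s, of 0] by (simp add: order_trans[OF norm_ge_zero])
  obtain \<Lambda> where \<Lambda>: "\<Lambda> > 0" "\<And>t y y'. t \<in> {0..T} \<Longrightarrow> norm y \<le> R \<Longrightarrow> norm y' \<le> R \<Longrightarrow>
      norm (\<beta> t y - \<beta> t y') \<le> \<Lambda> * norm (y - y')"
    using locally_lipschitz[of R] by auto
  note f = field_along_bounded_path[OF t picard_measurable R]
  have step: "norm (picard t y g (Suc j) r - picard t y g j r) \<le> 2 * R * (1 / 2) ^ j * exp (2 * \<Lambda> * (r - t))"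
    if "r \<in> {t..T}" for j r
    using that
  proof (induction j arbitrary: r)
    case 0
    have "norm (picard t y g (Suc 0) r - picard t y g 0 r) \<le> 2 * R"
      using R[OF 0, of "Suc 0"] R[OF 0, of 0] norm_triangle_ineq4 by (smt (verit))
    also have "\<dots> \<le> 2 * R * exp (2 * \<Lambda> * (r - t))"
      using \<open>0 \<le> R\<close> \<Lambda>(1) 0 mult_left_mono[of 1 "exp (2 * \<Lambda> * (r - t))" "2 * R"] by simp
    finally show ?case by simp
  next
    case (Suc j)
    have i: "set_integrable lborel {t..r} (\<lambda>u. \<beta> u (picard t y g j u))" for j
      by (rule set_integrable_subset[OF f(1)]) (use Suc.prems in auto)
    let ?D = "\<lambda>u. \<beta> u (picard t y g (Suc j) u) - \<beta> u (picard t y g j u)"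
    have "picard t y g (Suc (Suc j)) r - picard t y g (Suc j) r = (LINT u:{t..r}|lborel. ?D u)"
      using set_integral_diff(2)[OF i[of "Suc j"] i[of j]] by simp
    also have "norm \<dots> \<le> 0 * (r - t) + (2 * R * (1 / 2) ^ j) / 2 * (exp (2 * \<Lambda> * (r - t)) - 1)"
    proof (rule exp_weighted_integral_bound[OF _ \<Lambda>(1) set_integral_diff(1)[OF i i]])
      fix u assume u: "u \<in> {t..r}"
      have "norm (?D u) \<le> \<Lambda> * norm (picard t y g (Suc j) u - picard t y g j u)"
        using u Suc.prems t by (intro \<Lambda>(2) R) auto
      also have "\<dots> \<le> \<Lambda> * (2 * R * (1 / 2) ^ j * exp (2 * \<Lambda> * (u - t)))"
        using u Suc.prems \<Lambda>(1) by (intro mult_left_mono Suc.IH) auto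
      finally show "norm (?D u) \<le> 0 + \<Lambda> * (2 * R * (1 / 2) ^ j * exp (2 * \<Lambda> * (u - t)))" by simp
    qed (use Suc.prems in auto)
    also have "\<dots> \<le> 2 * R * (1 / 2) ^ Suc j * exp (2 * \<Lambda> * (r - t))"
      using \<open>0 \<le> R\<close> by (simp add: algebra_simps)
    finally show ?case .
  qed
  have "summable (\<lambda>j. picard t y g (Suc j) s - picard t y g j s)"
  proof (rule summable_comparison_test')
    show "summable (\<lambda>j. 2 * R * (1 / 2) ^ j * exp (2 * \<Lambda> * (s - t)))"
      by (intro summable_mult summable_mult2 summable_geometric) auto
  qed (use step[OF s] in simp)
  then have "convergent (\<lambda>n. \<Sum>j<n. picard t y g (Suc j) s - picard t y g j s)"
    by (simp add: summable_iff_convergent)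
  then have "convergent (\<lambda>n. (picard t y g n s - picard t y g 0 s) + picard t y g 0 s)"
    unfolding sum_lessThan_telescope[of "\<lambda>j. picard t y g j s"] by (rule convergent_add) (simp add: convergent_const)
  then show ?thesis by simp
qed

lemma picard_tendsto: "s \<in> {t..T} \<Longrightarrow> (\<lambda>j. picard t y g j s) \<longlonglongrightarrow> picard_limit t y g s"
  unfolding picard_limit_def by (simp add: picard_convergent convergent_LIMSEQ_iff[symmetric])

lemma picard_limit_measurable: "set_borel_measurable lborel {t..T} (picard_limit t y g)"
  unfolding set_borel_measurable_def
proof (rule borel_measurable_LIMSEQ_metric)
  show "(\<lambda>s. indicator {t..T} s *\<^sub>R picard t y g j s) \<in> borel_measurable lborel" for j
    using picard_measurable by (simp add: set_borel_measurable_def)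
  show "(\<lambda>j. indicator {t..T} s *\<^sub>R picard t y g j s) \<longlonglongrightarrow> indicator {t..T} s *\<^sub>R picard_limit t y g s" for s
    by (cases "s \<in> {t..T}") (auto intro: picard_tendsto)
qed

lemma picard_limit_bound:
  assumes "s \<in> {t..T}"
  shows "norm (picard_limit t y g s) \<le> 2 * (norm y + L * T + G) * exp (2 * L * (T - t))"
  by (rule Lim_norm_ubound[OF _ picard_tendsto[OF assms]]) (use picard_bound[OF assms] in \<open>auto intro!: always_eventually simp del: distrib_left_numeral\<close>)

lemma picard_limit_solution: "driven_solution t y g (picard_limit t y g)"
  unfolding driven_solution_def
proof (intro conjI ballI)
  let ?x = "picard_limit t y g"
  define R where "R = 2 * (norm y + L * T + G) * exp (2 * L * (T - t))"
  note f = field_along_bounded_path[OF t picard_limit_measurable picard_limit_bound]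
  note fj = field_along_bounded_path[OF t picard_measurable picard_bound]
  show "set_integrable lborel {t..T} (\<lambda>u. \<beta> u (?x u))" by (rule f(1))
  fix s assume s: "s \<in> {t..T}"
  have "(\<lambda>j. LINT u:{t..s}|lborel. \<beta> u (picard t y g j u)) \<longlonglongrightarrow> (LINT u:{t..s}|lborel. \<beta> u (?x u))"
    unfolding set_lebesgue_integral_def
  proof (rule integral_dominated_convergence)
    show "integrable lborel (\<lambda>u. indicator {t..s} u * (L * (1 + R)))"
      using set_integrable_const_Icc[of t s "L * (1 + R)"] by (simp add: set_integrable_def)
    have "set_integrable lborel {t..s} (\<lambda>u. \<beta> u (?x u))"
      by (rule set_integrable_subset[OF f(1)]) (use s in auto)
    then show "(\<lambda>u. indicator {t..s} u *\<^sub>R \<beta> u (?x u)) \<in> borel_measurable lborel"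
      by (simp add: set_integrable_def borel_measurable_integrable)
    show "(\<lambda>u. indicator {t..s} u *\<^sub>R \<beta> u (picard t y g j u)) \<in> borel_measurable lborel" for j
    proof -
      have "set_integrable lborel {t..s} (\<lambda>u. \<beta> u (picard t y g j u))"
        by (rule set_integrable_subset[OF fj(1)]) (use s in auto)
      then show ?thesis by (simp add: set_integrable_def borel_measurable_integrable)
    qed
    show "AE u in lborel. norm (indicator {t..s} u *\<^sub>R \<beta> u (picard t y g j u)) \<le> indicator {t..s} u * (L * (1 + R))" for j
      using fj(2) s by (auto intro!: AE_I2 simp: indicator_def R_def)
    show "AE u in lborel. (\<lambda>j. indicator {t..s} u *\<^sub>R \<beta> u (picard t y g j u)) \<longlonglongrightarrow> indicator {t..s} u *\<^sub>R \<beta> u (?x u)"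
    proof (rule AE_I2)
      fix u :: real
      have "(\<lambda>j. \<beta> u (picard t y g j u)) \<longlonglongrightarrow> \<beta> u (?x u)" if u: "u \<in> {t..s}"
      proof -
        have "continuous_on UNIV (\<lambda>z. (\<lambda>(t, y). \<beta> t y) (u, z))"
          using u s t by (intro continuous_on_compose2[OF field_continuous]) (auto intro!: continuous_intros)
        then have "isCont (\<lambda>z. \<beta> u z) (?x u)" by (simp add: continuous_on_eq_continuous_at)
        then show ?thesis
          by (rule isCont_tendsto_compose) (use u s in \<open>auto intro!: picard_tendsto\<close>)
      qed
      then show "(\<lambda>j. indicator {t..s} u *\<^sub>R \<beta> u (picard t y g j u)) \<longlonglongrightarrow> indicator {t..s} u *\<^sub>R \<beta> u (?x u)"
        by (auto simp: indicator_def)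
    qed
  qed
  then have "(\<lambda>j. picard t y g (Suc j) s) \<longlonglongrightarrow> y + (LINT u:{t..s}|lborel. \<beta> u (?x u)) + g s"
    by (auto intro!: tendsto_intros)
  moreover have "(\<lambda>j. picard t y g (Suc j) s) \<longlonglongrightarrow> ?x s"
    using picard_tendsto[OF s] LIMSEQ_Suc by blast
  ultimately show "?x s = y + (LINT u:{t..s}|lborel. \<beta> u (?x u)) + g s"
    by (rule LIMSEQ_unique[rotated])
qed

end

end


section \<open>Adapted solutions\<close>

text \<open>
The path is evaluated at the first point of a grid of width \<open>1/(n+1)\<close> to the right of \<open>u\<close>. This is
jointly measurable since countably many evaluation points occur, all of them in \<open>[t, s]\<close>, where \<open>x\<close> is
adapted; right continuity gives convergence.
\<close>

lemma right_continuous_progressive: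
  fixes x :: "real \<Rightarrow> 'a \<Rightarrow> 'b::euclidean_space"
  assumes adapted: "\<And>u. u \<in> {t..s} \<Longrightarrow> x u \<in> borel_measurable F"
    and right_cont: "\<And>\<omega> u. \<omega> \<in> space F \<Longrightarrow> u \<in> {t..<s} \<Longrightarrow> ((\<lambda>r. x r \<omega>) \<longlongrightarrow> x u \<omega>) (at_right u)"
    and "t \<le> s"
  shows "(\<lambda>(\<omega>, u). indicator {t..s} u *\<^sub>R x u \<omega>) \<in> borel_measurable (F \<Otimes>\<^sub>M borel)"
proof (rule borel_measurable_LIMSEQ_metric)
  \<comment> \<open>the minimum and the maximum keep the evaluation points in \<open>[t, s]\<close>\<close>
  define c where "c n i = max t (min s (t + (real_of_int i + 1) / real (Suc n)))" for n i
  have c: "c n i \<in> {t..s}" for n i using \<open>t \<le> s\<close> by (auto simp: c_def)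
  define grid where "grid n u = \<lfloor>(u - t) * real (Suc n)\<rfloor>" for n u
  show "(\<lambda>(\<omega>, u). indicator {t..s} u *\<^sub>R x (c n (grid n u)) \<omega>) \<in> borel_measurable (F \<Otimes>\<^sub>M borel)" for n
  proof -
    have "(\<lambda>p. indicator {t..s} (snd p) *\<^sub>R x (c n (grid n (snd p))) (fst p)) \<in> borel_measurable (F \<Otimes>\<^sub>M borel)"
    proof (rule measurable_compose_countable'[where I = UNIV
          and f = "\<lambda>i p. indicator {t..s} (snd p) *\<^sub>R x (c n i) (fst p)" and g = "\<lambda>p. grid n (snd p)"])
      fix i :: int assume "i \<in> UNIV"
      have [measurable]: "x (c n i) \<in> borel_measurable F" using adapted c by blast
      show "(\<lambda>p. indicator {t..s} (snd p) *\<^sub>R x (c n i) (fst p)) \<in> borel_measurable (F \<Otimes>\<^sub>M borel)"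
        by measurable
    qed (auto simp: grid_def)
    then show ?thesis by (simp add: case_prod_beta')
  qed
  fix p assume "p \<in> space (F \<Otimes>\<^sub>M (borel :: real measure))"
  then obtain \<omega> u where p: "p = (\<omega>, u)" "\<omega> \<in> space F" by (auto simp: space_pair_measure)
  have "(\<lambda>n. x (c n (grid n u)) \<omega>) \<longlonglongrightarrow> x u \<omega>" if u: "u \<in> {t..s}"
  proof (cases "u = s")
    case True
    have "c n (grid n u) = s" for n
    proof -
      have "(s - t) * real (Suc n) \<le> real_of_int (grid n s) + 1" unfolding grid_def by linarith
      then have "s \<le> t + (real_of_int (grid n s) + 1) / real (Suc n)" by (simp add: field_simps)
      then show ?thesis using True \<open>t \<le> s\<close> by (simp add: c_def)
    qed
    then show ?thesis using True by simp
  next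
    case False
    have gt: "u < c n (grid n u)" for n
    proof -
      have "(u - t) * real (Suc n) < real_of_int (grid n u) + 1" unfolding grid_def by linarith
      then have "u < t + (real_of_int (grid n u) + 1) / real (Suc n)" by (simp add: field_simps)
      then show ?thesis using False u by (auto simp: c_def)
    qed
    have le: "c n (grid n u) \<le> u + 1 / real (Suc n)" for n
    proof -
      have "real_of_int (grid n u) + 1 \<le> (u - t) * real (Suc n) + 1" unfolding grid_def by linarith
      then have "(real_of_int (grid n u) + 1) / real (Suc n) \<le> ((u - t) * real (Suc n) + 1) / real (Suc n)"
        by (rule divide_right_mono) simp
      also have "\<dots> = (u - t) + 1 / real (Suc n)" by (simp add: add_divide_distrib)
      finally have *: "(real_of_int (grid n u) + 1) / real (Suc n) \<le> (u - t) + 1 / real (Suc n)" .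
      have "0 \<le> 1 / real (Suc n)" by simp
      then show ?thesis using * u unfolding c_def max_def min_def atLeastAtMost_iff by (smt (verit))
    qed
    have "(\<lambda>n. c n (grid n u)) \<longlonglongrightarrow> u"
    proof (rule tendsto_sandwich[of "\<lambda>_. u" _ _ "\<lambda>n. u + 1 / real (Suc n)"])
      show "(\<lambda>n. u + 1 / real (Suc n)) \<longlonglongrightarrow> u"
        using tendsto_add[OF tendsto_const LIMSEQ_inverse_real_of_nat, of u] by (simp add: inverse_eq_divide)
    qed (use gt le in \<open>auto intro!: always_eventually less_imp_le\<close>)
    then have "filterlim (\<lambda>n. c n (grid n u)) (at_right u) sequentially"
      using gt unfolding filterlim_at
      by (intro conjI always_eventually allI) (auto simp: less_imp_neq[THEN not_sym])
    moreover have "((\<lambda>r. x r \<omega>) \<longlongrightarrow> x u \<omega>) (at_right u)"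
      using right_cont[OF p(2)] u False by auto
    ultimately show ?thesis by (rule filterlim_compose[rotated])
  qed
  then show "(\<lambda>n. (\<lambda>(\<omega>, u). indicator {t..s} u *\<^sub>R x (c n (grid n u)) \<omega>) p) \<longlonglongrightarrow> (\<lambda>(\<omega>, u). indicator {t..s} u *\<^sub>R x u \<omega>) p"
    by (auto simp: p indicator_def)
qed

text \<open>
The integrand is only assumed to be jointly measurable, because the expected running cost need not be
continuous. The indicator restricts the assumption to the time interval on which it is available.
\<close>

lemma integral_along_adapted_path:
  fixes x :: "real \<Rightarrow> 'a \<Rightarrow> 'b::euclidean_space" and h :: "real \<Rightarrow> 'b \<Rightarrow> 'c::euclidean_space"
  assumes h: "(\<lambda>(u, z). indicator {0..T} u *\<^sub>R h u z) \<in> borel_measurable borel"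
    and x: "\<And>u. u \<in> {t..s} \<Longrightarrow> x u \<in> borel_measurable F"
       "\<And>\<omega> u. \<omega> \<in> space F \<Longrightarrow> u \<in> {t..<s} \<Longrightarrow> ((\<lambda>r. x r \<omega>) \<longlongrightarrow> x u \<omega>) (at_right u)"
    and ts: "0 \<le> t" "t \<le> s" "s \<le> T"
  shows "(\<lambda>\<omega>. LINT u:{t..s}|lborel. h u (x u \<omega>)) \<in> borel_measurable F"
    and "\<And>\<omega>. \<omega> \<in> space F \<Longrightarrow> set_borel_measurable lborel {t..s} (\<lambda>u. h u (x u \<omega>))"
proof -
  have [measurable]: "(\<lambda>(\<omega>, u). indicator {t..s} u *\<^sub>R x u \<omega>) \<in> borel_measurable (F \<Otimes>\<^sub>M borel)"
    using x ts(2) by (rule right_continuous_progressive)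
  have [measurable]: "(\<lambda>(u, z). indicator {0..T} u *\<^sub>R h u z) \<in> borel_measurable (borel \<Otimes>\<^sub>M borel)"
    using h by (simp add: borel_prod)
  have "(\<lambda>(\<omega>, u). indicator {t..s} u *\<^sub>R (case (u, indicator {t..s} u *\<^sub>R x u \<omega>) of (u, z) \<Rightarrow> indicator {0..T} u *\<^sub>R h u z))
      \<in> borel_measurable (F \<Otimes>\<^sub>M borel)"
    by measurable
  also have "(\<lambda>(\<omega>, u). indicator {t..s} u *\<^sub>R (case (u, indicator {t..s} u *\<^sub>R x u \<omega>) of (u, z) \<Rightarrow> indicator {0..T} u *\<^sub>R h u z))
      = (\<lambda>(\<omega>, u). indicator {t..s} u *\<^sub>R h u (x u \<omega>))"
    using ts by (auto simp: indicator_def fun_eq_iff)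
  finally have *: "(\<lambda>(\<omega>, u). indicator {t..s} u *\<^sub>R h u (x u \<omega>)) \<in> borel_measurable (F \<Otimes>\<^sub>M borel)" .
  then have "(\<lambda>(\<omega>, u). indicator {t..s} u *\<^sub>R h u (x u \<omega>)) \<in> borel_measurable (F \<Otimes>\<^sub>M lborel)"
    by (simp cong: measurable_cong_sets sets_pair_measure_cong)
  then show "(\<lambda>\<omega>. LINT u:{t..s}|lborel. h u (x u \<omega>)) \<in> borel_measurable F"
    unfolding set_lebesgue_integral_def by (rule lborel.borel_measurable_lebesgue_integral)
  show "set_borel_measurable lborel {t..s} (\<lambda>u. h u (x u \<omega>))" if "\<omega> \<in> space F" for \<omega>
    using measurable_compose[OF measurable_Pair1'[OF that] *] by (simp add: set_borel_measurable_def)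
qed

lemma adapted_path_measurable:
  fixes x :: "real \<Rightarrow> 'a \<Rightarrow> 'b::euclidean_space"
  assumes "\<And>u. u \<in> {t..s} \<Longrightarrow> x u \<in> borel_measurable F"
    and "\<And>\<omega> u. \<omega> \<in> space F \<Longrightarrow> u \<in> {t..<s} \<Longrightarrow> ((\<lambda>r. x r \<omega>) \<longlongrightarrow> x u \<omega>) (at_right u)"
    and "\<omega> \<in> space F"
  shows "set_borel_measurable lborel {t..s} (\<lambda>u. x u \<omega>)"
proof (cases "t \<le> s")
  case True
  from measurable_compose[OF measurable_Pair1'[OF assms(3)] right_continuous_progressive[OF assms(1,2) True]]
  show ?thesis by (simp add: set_borel_measurable_def)
qed (simp add: set_borel_measurable_def)

lemma filtration_measurable_mono:
  assumes "filtration \<Omega> F" "u \<le> s" "f \<in> measurable (F u) N"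
  shows "f \<in> measurable (F s) N"
proof -
  interpret filtration \<Omega> F by fact
  show ?thesis using assms(3) sets_F_mono[OF assms(2)] space_F by (auto simp: measurable_def)
qed

lemma cadlag_path_plus_integral:
  fixes f :: "real \<Rightarrow> 'b::{banach, second_countable_topology}"
  assumes f: "set_integrable lborel {t..T} f" "\<And>r. r \<in> {t..T} \<Longrightarrow> norm (f r) \<le> B"
    and g: "cadlag_on t T g"
  shows "cadlag_on t T (\<lambda>s. y + (LINT r:{t..s}|lborel. f r) + g s)"
  unfolding cadlag_on_def
proof (intro conjI ballI)
  let ?I = "\<lambda>s. LINT r:{t..s}|lborel. f r"
  note c = indefinite_integral_regular(1)[OF f]
  fix s assume s: "s \<in> {t..<T}"
  have "continuous_on {s..T} ?I" using s by (auto intro: continuous_on_subset[OF c])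
  then have "(?I \<longlongrightarrow> ?I s) (at_right s)" using s by (auto intro: continuous_on_Icc_at_rightD)
  moreover have "(g \<longlongrightarrow> g s) (at_right s)" using g s by (auto simp: cadlag_on_def)
  ultimately show "((\<lambda>s. y + ?I s + g s) \<longlongrightarrow> y + ?I s + g s) (at_right s)"
    by (intro tendsto_intros)
next
  let ?I = "\<lambda>s. LINT r:{t..s}|lborel. f r"
  note c = indefinite_integral_regular(1)[OF f]
  fix s assume s: "s \<in> {t<..T}"
  have "continuous_on {t..s} ?I" using s by (auto intro: continuous_on_subset[OF c])
  then have "(?I \<longlongrightarrow> ?I s) (at_left s)" using s by (auto intro: continuous_on_Icc_at_leftD)
  moreover obtain l where "(g \<longlongrightarrow> l) (at_left s)" using g s unfolding cadlag_on_def by blast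
  ultimately have "((\<lambda>s. y + ?I s + g s) \<longlongrightarrow> y + ?I s + l) (at_left s)"
    by (intro tendsto_intros)
  then show "\<exists>l. ((\<lambda>s. y + ?I s + g s) \<longlongrightarrow> l) (at_left s)" ..
qed

context locally_lipschitz_field
begin

text \<open>
The solution is the pointwise limit of the Picard iterates, each of which is adapted and right-continuous.
Boundedness of the driver is required for each sample point only, without uniformity.
\<close>

lemma adapted_solution_exists:
  fixes g :: "real \<Rightarrow> 'a \<Rightarrow> 'b"
  assumes F: "filtration \<Omega> F" and t: "0 \<le> t"
    and g_adapted: "\<And>s. s \<in> {t..T} \<Longrightarrow> g s \<in> borel_measurable (F s)"
    and g_cadlag: "\<And>\<omega>. \<omega> \<in> \<Omega> \<Longrightarrow> cadlag_on t T (\<lambda>s. g s \<omega>)"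
    and g_bounded: "\<And>\<omega>. \<omega> \<in> \<Omega> \<Longrightarrow> \<exists>G. \<forall>s\<in>{t..T}. norm (g s \<omega>) \<le> G"
  shows "\<exists>x. (\<forall>s\<in>{t..T}. x s \<in> borel_measurable (F s)) \<and>
     (\<forall>\<omega>\<in>\<Omega>. cadlag_on t T (\<lambda>s. x s \<omega>) \<and> driven_solution t y (\<lambda>s. g s \<omega>) (\<lambda>s. x s \<omega>))"
proof -
  interpret filtration \<Omega> F by fact
  define P where "P j s \<omega> = picard t y (\<lambda>s. g s \<omega>) j s" for j s \<omega>
  have mono: "f \<in> borel_measurable (F u) \<Longrightarrow> u \<le> s \<Longrightarrow> f \<in> borel_measurable (F s)" for u s and f :: "'a \<Rightarrow> 'b"
    using filtration_measurable_mono[OF F] by blast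
  have g_meas: "set_borel_measurable lborel {t..T} (\<lambda>s. g s \<omega>)" if "\<omega> \<in> \<Omega>" for \<omega>
    by (rule adapted_path_measurable[where F = "F T"])
       (use that g_cadlag in \<open>auto simp: space_F cadlag_on_def intro: mono[OF g_adapted]\<close>)
  obtain G where G: "\<And>s \<omega>. \<omega> \<in> \<Omega> \<Longrightarrow> s \<in> {t..T} \<Longrightarrow> norm (g s \<omega>) \<le> G \<omega>"
    using g_bounded by metis
  have Pc: "cadlag_on t T (\<lambda>s. P j s \<omega>)" if "\<omega> \<in> \<Omega>" for j \<omega>
  proof (cases j)
    case 0
    then show ?thesis by (auto simp: P_def cadlag_on_def)
  next
    case (Suc i)
    note inv = picard_measurable[OF t g_meas[OF that] G[OF that]] picard_bound[OF t g_meas[OF that] G[OF that]]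
    note f = field_along_bounded_path[OF t inv, simplified]
    from cadlag_path_plus_integral[OF f g_cadlag[OF that]]
    show ?thesis by (simp add: P_def Suc)
  qed
  have Pm: "P j s \<in> borel_measurable (F s)" if "s \<in> {t..T}" for j s
    using that
  proof (induction j arbitrary: s)
    case 0
    then show ?case by (simp add: P_def[abs_def])
  next
    case (Suc j)
    have "(\<lambda>\<omega>. LINT u:{t..s}|lborel. \<beta> u (P j u \<omega>)) \<in> borel_measurable (F s)"
    proof (rule integral_along_adapted_path(1)[OF field_measurable])
      show "P j u \<in> borel_measurable (F s)" if "u \<in> {t..s}" for u
        using Suc that by (auto intro: mono[of _ u s])
      show "((\<lambda>r. P j r \<omega>) \<longlongrightarrow> P j u \<omega>) (at_right u)" if "\<omega> \<in> space (F s)" "u \<in> {t..<s}" for \<omega> u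
        using Pc[of \<omega> j] that Suc.prems by (auto simp: cadlag_on_def space_F)
    qed (use Suc.prems t in auto)
    moreover have "g s \<in> borel_measurable (F s)" by (rule g_adapted[OF Suc.prems])
    moreover have "P (Suc j) s = (\<lambda>\<omega>. y + (LINT u:{t..s}|lborel. \<beta> u (P j u \<omega>)) + g s \<omega>)"
      by (simp add: P_def fun_eq_iff)
    ultimately show ?case by simp
  qed
  define x where "x s \<omega> = picard_limit t y (\<lambda>s. g s \<omega>) s" for s \<omega>
  have sol: "driven_solution t y (\<lambda>s. g s \<omega>) (\<lambda>s. x s \<omega>)" if "\<omega> \<in> \<Omega>" for \<omega>
    unfolding x_def by (rule picard_limit_solution[OF t g_meas[OF that] G[OF that]])
  have "x s \<in> borel_measurable (F s)" if s: "s \<in> {t..T}" for s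
  proof (rule borel_measurable_LIMSEQ_metric)
    show "(\<lambda>\<omega>. P j s \<omega>) \<in> borel_measurable (F s)" for j using Pm[OF s] by simp
    show "(\<lambda>j. P j s \<omega>) \<longlonglongrightarrow> x s \<omega>" if "\<omega> \<in> space (F s)" for \<omega>
      using that s unfolding P_def x_def space_F by (intro picard_tendsto[OF t g_meas G])
  qed
  moreover have "cadlag_on t T (\<lambda>s. x s \<omega>)" if "\<omega> \<in> \<Omega>" for \<omega>
  proof -
    let ?x = "picard_limit t y (\<lambda>s. g s \<omega>)"
    note inv = picard_limit_measurable[OF t g_meas[OF that] G[OF that]] picard_limit_bound[OF t g_meas[OF that] G[OF that]]
    note f = field_along_bounded_path[OF t inv, simplified]
    have c: "cadlag_on t T (\<lambda>s. y + (LINT u:{t..s}|lborel. \<beta> u (?x u)) + g s \<omega>)"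
      by (rule cadlag_path_plus_integral[OF f g_cadlag[OF that]]) auto
    have eq: "x s \<omega> = y + (LINT u:{t..s}|lborel. \<beta> u (?x u)) + g s \<omega>" if "s \<in> {t..T}" for s
      using sol[OF \<open>\<omega> \<in> \<Omega>\<close>] that by (simp add: driven_solution_def x_def)
    show ?thesis
      unfolding cadlag_on_def
    proof (intro conjI ballI)
      fix s assume s: "s \<in> {t..<T}"
      have "eventually (\<lambda>r. r \<in> {s<..<T}) (at_right s)"
        using s by (intro eventually_at_right_real) auto
      then have "eventually (\<lambda>r. y + (LINT u:{t..r}|lborel. \<beta> u (?x u)) + g r \<omega> = x r \<omega>) (at_right s)"
        by eventually_elim (use s in \<open>auto simp: eq\<close>)
      moreover have "((\<lambda>r. y + (LINT u:{t..r}|lborel. \<beta> u (?x u)) + g r \<omega>) \<longlongrightarrow> x s \<omega>) (at_right s)"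
        using c s eq[of s] by (auto simp: cadlag_on_def)
      ultimately show "((\<lambda>s. x s \<omega>) \<longlongrightarrow> x s \<omega>) (at_right s)" by (rule Lim_transform_eventually[rotated])
    next
      fix s assume s: "s \<in> {t<..T}"
      have "eventually (\<lambda>r. r \<in> {t<..<s}) (at_left s)"
        using s by (intro eventually_at_left_real) auto
      then have "eventually (\<lambda>r. y + (LINT u:{t..r}|lborel. \<beta> u (?x u)) + g r \<omega> = x r \<omega>) (at_left s)"
        by eventually_elim (use s in \<open>auto simp: eq\<close>)
      moreover obtain l where "((\<lambda>r. y + (LINT u:{t..r}|lborel. \<beta> u (?x u)) + g r \<omega>) \<longlongrightarrow> l) (at_left s)"
        using c s unfolding cadlag_on_def by blast
      ultimately have "((\<lambda>s. x s \<omega>) \<longlongrightarrow> l) (at_left s)" by (rule Lim_transform_eventually[rotated])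
      then show "\<exists>l. ((\<lambda>s. x s \<omega>) \<longlongrightarrow> l) (at_left s)" ..
    qed
  qed
  ultimately show ?thesis using sol by blast
qed

end


section \<open>Integrals against counting paths\<close>

locale counting_path =
  fixes n :: "real \<Rightarrow> nat"
  assumes mono: "mono_on {0..} n"
    and right_cont: "\<And>t. 0 \<le> t \<Longrightarrow> continuous (at_right t) n"
begin

lemma le: "0 \<le> r \<Longrightarrow> r \<le> s \<Longrightarrow> n r \<le> n s"
  using mono by (auto simp: mono_on_def)

text \<open>
A monotone path with values in the natural numbers is bounded to the left of \<open>u\<close>, attains its maximum
there and stays constant afterwards.
\<close>

lemma constant_on_left:
  assumes "0 < u"
  obtains r where "0 \<le> r" "r < u" "\<And>q. r \<le> q \<Longrightarrow> q < u \<Longrightarrow> n q = left_limit n u"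
proof -
  have fin: "finite (n ` {0..<u})"
    by (rule finite_subset[of _ "{..n u}"]) (auto intro: le)
  have ne: "n ` {0..<u} \<noteq> {}" using assms by auto
  define m where "m = Max (n ` {0..<u})"
  have "m \<in> n ` {0..<u}" unfolding m_def using fin ne by (rule Max_in)
  then obtain r where r: "0 \<le> r" "r < u" "n r = m" by auto
  have const: "n q = m" if "r \<le> q" "q < u" for q
    using that r le[of r q] Max_ge[OF fin, of "n q"] by (force simp: m_def)
  have "(n \<longlongrightarrow> m) (at_left u)"
  proof (rule tendsto_eventually)
    have "eventually (\<lambda>q. q \<in> {r<..<u}) (at_left u)"
      using r by (intro eventually_at_left_real) auto
    then show "eventually (\<lambda>q. n q = m) (at_left u)"
      by eventually_elim (auto intro: const)
  qed
  then have "left_limit n u = m"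
    unfolding left_limit_def by (intro tendsto_Lim) auto
  then show ?thesis using that r const by blast
qed

lemma le_left_limit:
  assumes "0 \<le> r" "r < u"
  shows "n r \<le> left_limit n u"
proof -
  obtain q where q: "0 \<le> q" "q < u" "\<And>p. q \<le> p \<Longrightarrow> p < u \<Longrightarrow> n p = left_limit n u"
    using constant_on_left[of u] assms by auto
  then show ?thesis using le[of r "max q r"] q(3)[of "max q r"] assms by auto
qed

lemma left_limit_le:
  assumes "0 < u"
  shows "left_limit n u \<le> n u"
proof -
  obtain q where q: "0 \<le> q" "q < u" "\<And>p. q \<le> p \<Longrightarrow> p < u \<Longrightarrow> n p = left_limit n u"
    using constant_on_left[OF assms] by auto
  then show ?thesis using le[of q u] by force
qed

lemma eventually_constant_right:
  assumes "0 \<le> t"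
  shows "eventually (\<lambda>r. n r = n t) (at_right t)"
proof -
  have "(n \<longlongrightarrow> n t) (at_right t)"
    using right_cont[OF assms] by (simp add: continuous_within)
  then have "eventually (\<lambda>r. n r \<in> {n t}) (at_right t)"
    by (rule topological_tendstoD) (auto simp: Topological_Spaces.open_discrete)
  then show ?thesis by simp
qed

definition jump_times :: "real \<Rightarrow> real \<Rightarrow> real set" where
  "jump_times t s = {u \<in> {t<..s}. n u \<noteq> left_limit n u}"

text \<open>
Distinct jump times have distinct values, all of them at most \<open>n s\<close>.
\<close>

lemma finite_jump_times:
  assumes "0 \<le> t"
  shows "finite (jump_times t s)"
proof (rule inj_on_finite)
  show "inj_on n (jump_times t s)"
  proof (rule linorder_inj_onI')
    fix u v assume u: "u \<in> jump_times t s" and v: "v \<in> jump_times t s" and "u < v"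
    then have "n u \<le> left_limit n v" using assms by (intro le_left_limit) (auto simp: jump_times_def)
    moreover have "left_limit n v < n v"
      using v left_limit_le[of v] assms by (auto simp: jump_times_def)
    ultimately show "n u \<noteq> n v" by simp
  qed
  show "n ` jump_times t s \<subseteq> {..n s}"
    using assms by (auto simp: jump_times_def intro: le)
qed auto

text \<open>
The jump that crosses level \<open>m\<close> happens at the first time at which the path is at least \<open>m\<close>; by right
continuity the level is reached at that very time.
\<close>

lemma crossing_time_exists:
  assumes "0 \<le> t" "t \<le> s" "m \<in> {n t<..n s}"
  shows "\<exists>u\<in>jump_times t s. left_limit n u < m \<and> m \<le> n u"
proof -
  define A where "A = {r \<in> {t..s}. m \<le> n r}"
  have A: "s \<in> A" "bdd_below A" using assms by (auto simp: A_def)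
  define u where "u = Inf A"
  have "t \<le> u" unfolding u_def using A by (intro cInf_greatest) (auto simp: A_def)
  have "u \<le> s" unfolding u_def using A by (intro cInf_lower)
  have mu: "m \<le> n u"
  proof (rule ccontr)
    assume "\<not> m \<le> n u"
    have "eventually (\<lambda>r. n r = n u) (at_right u)"
      using assms(1) \<open>t \<le> u\<close> by (intro eventually_constant_right) auto
    then obtain b where b: "u < b" "\<And>r. u < r \<Longrightarrow> r < b \<Longrightarrow> n r = n u"
      unfolding eventually_at_right_field by auto
    obtain a where a: "a \<in> A" "a < b" using cInf_lessD[of A b] A b(1) unfolding u_def by auto
    have "u \<le> a" unfolding u_def using A a by (intro cInf_lower)
    then have "n a = n u" using b(2)[of a] a(2) by (cases "a = u") auto
    then show False using a(1) \<open>\<not> m \<le> n u\<close> by (simp add: A_def)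
  qed
  have "t < u" using \<open>t \<le> u\<close> mu assms(3) by (cases "t = u") auto
  obtain q where q: "0 \<le> q" "q < u" "\<And>p. q \<le> p \<Longrightarrow> p < u \<Longrightarrow> n p = left_limit n u"
    using constant_on_left[of u] assms \<open>t < u\<close> by auto
  define p where "p = max q t"
  have p: "t \<le> p" "p < u" "n p = left_limit n u" using q \<open>t < u\<close> by (auto simp: p_def)
  then have "p \<notin> A" using A(2) cInf_lower[of p A] unfolding u_def by fastforce
  then have "left_limit n u < m" using p \<open>u \<le> s\<close> by (auto simp: A_def)
  then show ?thesis using mu \<open>t < u\<close> \<open>u \<le> s\<close> by (intro bexI[of _ u]) (auto simp: jump_times_def)
qed

lemma crossing_time_unique:
  assumes "0 \<le> t" "u \<in> jump_times t s" "v \<in> jump_times t s"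
    and "left_limit n u < m" "m \<le> n u" "left_limit n v < m" "m \<le> n v"
  shows "u = v"
  using assms le_left_limit[of u v] le_left_limit[of v u]
  by (cases u v rule: linorder_cases) (auto simp: jump_times_def)

lemma crossed_level:
  assumes "0 \<le> t" "u \<in> jump_times t s" "left_limit n u < m" "m \<le> n u"
  shows "m \<in> {n t<..n s}"
  using assms le_left_limit[of t u] le[of u s] by (auto simp: jump_times_def)

text \<open>
The last value that the path takes before it crosses level \<open>m\<close>. It is expressed by visited values rather
than by a left limit at a random time, so that its measurability can be read off.
\<close>

definition level_before :: "real \<Rightarrow> real \<Rightarrow> nat \<Rightarrow> nat" where
  "level_before t s m = Max {j. j < m \<and> (\<exists>r\<in>{t..s}. n r = j)}"

lemma level_before_crossing:
  assumes "0 \<le> t" "u \<in> jump_times t s" "left_limit n u < m" "m \<le> n u"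
  shows "level_before t s m = left_limit n u"
  unfolding level_before_def
proof (rule Max_eqI)
  have u: "t < u" "u \<le> s" using assms by (auto simp: jump_times_def)
  fix j assume "j \<in> {j. j < m \<and> (\<exists>r\<in>{t..s}. n r = j)}"
  then obtain r where r: "t \<le> r" "n r = j" "j < m" by auto
  then have "r < u" using le[of u r] assms(1,4) u by (cases "r < u") auto
  then show "j \<le> left_limit n u" using le_left_limit[of r u] r assms(1) by auto
next
  have u: "t < u" "u \<le> s" using assms by (auto simp: jump_times_def)
  obtain q where q: "0 \<le> q" "q < u" "\<And>p. q \<le> p \<Longrightarrow> p < u \<Longrightarrow> n p = left_limit n u"
    using constant_on_left[of u] assms u by auto
  have "max q t \<in> {t..s}" "n (max q t) = left_limit n u" using q u by auto
  then show "left_limit n u \<in> {j. j < m \<and> (\<exists>r\<in>{t..s}. n r = j)}" using assms(3) by blast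
qed auto

text \<open>
A jump of height \<open>d\<close> contributes \<open>d\<close> equal terms, one for each level that it crosses; the sum over the
jump times becomes a sum over all levels between \<open>n t\<close> and \<open>n s\<close>. The formula also covers paths with
jumps of height above one.
\<close>

lemma counting_integral_eq_sum_levels:
  fixes h :: "nat \<Rightarrow> 'b::real_vector"
  assumes "0 \<le> t" "t \<le> s"
  shows "counting_integral (\<lambda>u. h (left_limit n u)) n t s = (\<Sum>m\<in>{n t<..n s}. h (level_before t s m))"
proof -
  let ?C = "\<lambda>u. {left_limit n u<..n u}"
  have "counting_integral (\<lambda>u. h (left_limit n u)) n t s =
      (\<Sum>u\<in>jump_times t s. (real (n u) - real (left_limit n u)) *\<^sub>R h (left_limit n u))"
    by (simp add: counting_integral_def jump_times_def)
  also have "\<dots> = (\<Sum>u\<in>jump_times t s. \<Sum>m\<in>?C u. h (left_limit n u))"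
  proof (rule sum.cong[OF refl])
    fix u assume "u \<in> jump_times t s"
    then have "left_limit n u \<le> n u" using assms by (intro left_limit_le) (auto simp: jump_times_def)
    then show "(real (n u) - real (left_limit n u)) *\<^sub>R h (left_limit n u) = (\<Sum>m\<in>?C u. h (left_limit n u))"
      by (simp add: sum_constant_scaleR of_nat_diff)
  qed
  also have "\<dots> = (\<Sum>(u, m)\<in>Sigma (jump_times t s) ?C. h (left_limit n u))"
    using finite_jump_times[OF assms(1)] by (simp add: sum.Sigma)
  also have "\<dots> = (\<Sum>(u, m)\<in>Sigma (jump_times t s) ?C. h (level_before t s m))"
    by (rule sum.cong) (auto simp: level_before_crossing[OF assms(1)])
  also have "\<dots> = (\<Sum>p\<in>Sigma (jump_times t s) ?C. h (level_before t s (snd p)))"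
    by (simp add: case_prod_beta')
  also have "\<dots> = (\<Sum>m\<in>{n t<..n s}. h (level_before t s m))"
  proof (rule sum.reindex_bij_betw)
    show "bij_betw snd (Sigma (jump_times t s) ?C) {n t<..n s}"
      unfolding bij_betw_def
    proof
      show "inj_on snd (Sigma (jump_times t s) ?C)"
        using crossing_time_unique[OF assms(1)] by (auto simp: inj_on_def)
      show "snd ` Sigma (jump_times t s) ?C = {n t<..n s}"
      proof (intro equalityI subsetI)
        fix m assume "m \<in> snd ` Sigma (jump_times t s) ?C"
        then show "m \<in> {n t<..n s}" using crossed_level[OF assms(1)] by fastforce
      next
        fix m assume "m \<in> {n t<..n s}"
        from crossing_time_exists[OF assms this] obtain u where
          "u \<in> jump_times t s" "left_limit n u < m" "m \<le> n u" by blast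
        then have "(u, m) \<in> Sigma (jump_times t s) ?C" by auto
        then show "m \<in> snd ` Sigma (jump_times t s) ?C" by force
      qed
    qed
  qed
  finally show ?thesis .
qed

lemma level_before_less:
  assumes "0 \<le> t" "t \<le> s" "m \<in> {n t<..n s}"
  shows "level_before t s m < m"
proof -
  obtain u where u: "u \<in> jump_times t s" "left_limit n u < m" "m \<le> n u"
    using crossing_time_exists[OF assms] by blast
  then show ?thesis using level_before_crossing[OF assms(1) u] by simp
qed

lemma counting_integral_bound:
  fixes h :: "nat \<Rightarrow> 'b::real_normed_vector"
  assumes "0 \<le> t" "t \<le> s" "s \<le> T"
  shows "norm (counting_integral (\<lambda>u. h (1 + left_limit n u)) n t s) \<le> real (n T) * (\<Sum>j=1..n T. norm (h j))"
proof -
  let ?S = "\<Sum>j=1..n T. norm (h j)"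
  have nT: "n s \<le> n T" using assms by (intro le) auto
  have "norm (counting_integral (\<lambda>u. h (1 + left_limit n u)) n t s) \<le>
      (\<Sum>m\<in>{n t<..n s}. norm (h (1 + level_before t s m)))"
    unfolding counting_integral_eq_sum_levels[OF assms(1,2), of "\<lambda>j. h (1 + j)"] by (rule norm_sum)
  also have "\<dots> \<le> (\<Sum>m\<in>{n t<..n s}. ?S)"
  proof (rule sum_mono)
    fix m assume "m \<in> {n t<..n s}"
    then have "1 + level_before t s m \<in> {1..n T}"
      using level_before_less[OF assms(1,2)] nT by fastforce
    then show "norm (h (1 + level_before t s m)) \<le> ?S"
      by (intro member_le_sum) auto
  qed
  also have "\<dots> = real (n s - n t) * ?S" by simp
  also have "\<dots> \<le> real (n T) * ?S"
    using nT by (intro mult_right_mono sum_nonneg) auto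
  finally show ?thesis .
qed

lemma counting_integral_const:
  assumes "0 \<le> t" "t \<le> s" "s \<le> s'" "n s = n s'"
  shows "counting_integral f n t s' = counting_integral f n t s"
proof -
  have "n u = left_limit n u" if u: "s < u" "u \<le> s'" for u
    using le_left_limit[of s u] left_limit_le[of u] le[of u s'] u assms by auto
  then have "{u \<in> {t<..s'}. n u \<noteq> left_limit n u} = {u \<in> {t<..s}. n u \<noteq> left_limit n u}"
    using assms(3) by (auto simp: not_le[symmetric])
  then show ?thesis by (simp add: counting_integral_def)
qed

lemma counting_integral_cadlag:
  fixes f :: "real \<Rightarrow> 'b::real_normed_vector"
  assumes "0 \<le> t"
  shows "cadlag_on t T (counting_integral f n t)"
  unfolding cadlag_on_def
proof (intro conjI ballI)
  fix s assume s: "s \<in> {t..<T}"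
  have "eventually (\<lambda>r. counting_integral f n t r = counting_integral f n t s) (at_right s)"
    using eventually_conj[OF eventually_constant_right[of s] eventually_at_right_less[of s]] s assms
    by (auto elim!: eventually_mono intro!: counting_integral_const)
  then show "(counting_integral f n t \<longlongrightarrow> counting_integral f n t s) (at_right s)"
    by (rule tendsto_eventually)
next
  fix s assume s: "s \<in> {t<..T}"
  obtain q where q: "0 \<le> q" "q < s" "\<And>p. q \<le> p \<Longrightarrow> p < s \<Longrightarrow> n p = left_limit n s"
    using constant_on_left[of s] assms s by auto
  define p where "p = max q t"
  have p: "t \<le> p" "p < s" "q \<le> p" using q s by (auto simp: p_def)
  have "eventually (\<lambda>r. r \<in> {p<..<s}) (at_left s)"
    using p by (intro eventually_at_left_real)
  then have "eventually (\<lambda>r. counting_integral f n t r = counting_integral f n t p) (at_left s)"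
    by eventually_elim (use p q assms in \<open>auto intro!: counting_integral_const\<close>)
  then have "(counting_integral f n t \<longlongrightarrow> counting_integral f n t p) (at_left s)"
    by (rule tendsto_eventually)
  then show "\<exists>l. (counting_integral f n t \<longlongrightarrow> l) (at_left s)" ..
qed

text \<open>
By right continuity every value taken before \<open>s\<close> is taken at a rational time, which leaves a countable
set of times to inspect. The end point has to be kept.
\<close>

lemma level_before_rational:
  assumes "0 \<le> t" "t \<le> s"
  shows "level_before t s m = Max {j. j < m \<and> (\<exists>r\<in>insert s (\<rat> \<inter> {t..s}). n r = j)}"
proof -
  have "\<exists>r'\<in>insert s (\<rat> \<inter> {t..s}). n r' = n r" if r: "r \<in> {t..s}" for r
  proof (cases "r = s")
    case False
    obtain b where b: "r < b" "\<And>q. r < q \<Longrightarrow> q < b \<Longrightarrow> n q = n r"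
      using eventually_constant_right[of r] r assms unfolding eventually_at_right_field by auto
    obtain q where q: "q \<in> \<rat>" "r < q" "q < min b s"
      using Rats_dense_in_real[of r "min b s"] b(1) r False by auto
    then show ?thesis using b(2)[of q] r by auto
  qed auto
  moreover have "insert s (\<rat> \<inter> {t..s}) \<subseteq> {t..s}" using assms by auto
  ultimately have "(\<exists>r\<in>{t..s}. n r = j) \<longleftrightarrow> (\<exists>r\<in>insert s (\<rat> \<inter> {t..s}). n r = j)" for j
    by (metis subsetD)
  then show ?thesis by (simp only: level_before_def)
qed

end

text \<open>
A summand \<open>h j\<close> is known at time \<open>s\<close> only on the event \<open>j \<le> N s\<close>. This suffices: the index that belongs to
level \<open>m\<close> is at most \<open>m\<close>, and only levels up to \<open>N s\<close> occur.
\<close>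

lemma counting_integral_measurable:
  fixes N :: "real \<Rightarrow> 'a \<Rightarrow> nat" and h :: "nat \<Rightarrow> 'a \<Rightarrow> 'b::euclidean_space"
  assumes paths: "\<And>\<omega>. \<omega> \<in> space F \<Longrightarrow> counting_path (\<lambda>r. N r \<omega>)"
    and ts: "0 \<le> t" "t \<le> s"
    and N[measurable]: "\<And>r. r \<in> {t..s} \<Longrightarrow> N r \<in> measurable F (count_space UNIV)"
    and h: "\<And>j. 1 \<le> j \<Longrightarrow> (\<lambda>\<omega>. if j \<le> N s \<omega> then h j \<omega> else 0) \<in> borel_measurable F"
  shows "(\<lambda>\<omega>. counting_integral (\<lambda>u. h (1 + left_limit (\<lambda>r. N r \<omega>) u) \<omega>) (\<lambda>r. N r \<omega>) t s) \<in> borel_measurable F"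
proof -
  define D where "D = insert s (\<rat> \<inter> {t..s})"
  have D: "countable D" "D \<subseteq> {t..s}" using ts by (auto simp: D_def intro: countable_Int1 countable_rat)
  \<comment> \<open>the summands, set to zero outside the event on which they are revealed by time \<open>s\<close>\<close>
  define H where "H j \<omega> = (if Suc j \<le> N s \<omega> then h (Suc j) \<omega> else 0)" for j \<omega>
  have H[measurable]: "H j \<in> borel_measurable F" for j
    using h[of "Suc j"] by (simp add: H_def[abs_def])
  define a where "a m \<omega> = Max {j. j < m \<and> (\<exists>r\<in>D. N r \<omega> = j)}" for m \<omega>
  have a[measurable]: "a m \<in> measurable F (count_space UNIV)" for m
    unfolding a_def
  proof (rule measurable_Max_nat)
    fix j
    have "Measurable.pred F (\<lambda>\<omega>. \<exists>r\<in>D. N r \<omega> = j)"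
      unfolding pred_def
    proof (rule sets.sets_Collect_countable_Ex'[OF _ D(1)])
      fix r assume "r \<in> D"
      then have [measurable]: "N r \<in> measurable F (count_space UNIV)" using D(2) N by blast
      show "{\<omega> \<in> space F. N r \<omega> = j} \<in> sets F" by measurable
    qed
    then show "Measurable.pred F (\<lambda>\<omega>. j < m \<and> (\<exists>r\<in>D. N r \<omega> = j))" by simp
  qed
  have Nts: "N t \<in> measurable F (count_space UNIV)" "N s \<in> measurable F (count_space UNIV)"
    using ts by (auto intro: N)
  have "(\<lambda>\<omega>. H (a m \<omega>) \<omega>) \<in> borel_measurable F" for m
    by (rule measurable_compose_countable'[where I = UNIV]) auto
  then have "(\<lambda>\<omega>. \<Sum>m\<in>{p<..q}. H (a m \<omega>) \<omega>) \<in> borel_measurable F" for p q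
    by measurable
  then have "(\<lambda>\<omega>. \<Sum>m\<in>{N t \<omega><..q}. H (a m \<omega>) \<omega>) \<in> borel_measurable F" for q
    by (rule measurable_compose_countable'[where I = UNIV and f = "\<lambda>p \<omega>. \<Sum>m\<in>{p<..q}. H (a m \<omega>) \<omega>", OF _ Nts(1)]) auto
  then have *: "(\<lambda>\<omega>. \<Sum>m\<in>{N t \<omega><..N s \<omega>}. H (a m \<omega>) \<omega>) \<in> borel_measurable F"
    by (rule measurable_compose_countable'[where I = UNIV and f = "\<lambda>q \<omega>. \<Sum>m\<in>{N t \<omega><..q}. H (a m \<omega>) \<omega>", OF _ Nts(2)]) auto
  have "counting_integral (\<lambda>u. h (1 + left_limit (\<lambda>r. N r \<omega>) u) \<omega>) (\<lambda>r. N r \<omega>) t s =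
      (\<Sum>m\<in>{N t \<omega><..N s \<omega>}. H (a m \<omega>) \<omega>)" if "\<omega> \<in> space F" for \<omega>
  proof -
    interpret counting_path "\<lambda>r. N r \<omega>" using paths that by simp
    have lb: "level_before t s m = a m \<omega>" for m
      unfolding a_def D_def by (rule level_before_rational[OF ts])
    show ?thesis
      unfolding counting_integral_eq_sum_levels[OF ts, of "\<lambda>j. h (1 + j) \<omega>"]
    proof (intro sum.cong refl)
      fix m assume "m \<in> {N t \<omega><..N s \<omega>}"
      then have "Suc (a m \<omega>) \<le> N s \<omega>"
        using level_before_less[OF ts, of m] by (simp add: lb)
      then show "h (1 + level_before t s m) \<omega> = H (a m \<omega>) \<omega>" by (simp add: H_def lb)
    qed
  qed
  then show ?thesis using * by (simp cong: measurable_cong)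
qed


section \<open>Moments of the driving noise\<close>

text \<open>
A dyadic point of level \<open>n + 1\<close> either is of level \<open>n\<close> or has a left neighbour of level \<open>n\<close>, from which it
is reached by one increment of level \<open>n + 1\<close>.
\<close>

lemma dyadic_point_chaining:
  fixes w :: "real \<Rightarrow> real"
  assumes step: "\<And>n k. k < 2 ^ n \<Longrightarrow> \<bar>w (real (Suc k) * T / 2 ^ n) - w (real k * T / 2 ^ n)\<bar> \<le> a n"
    and "k \<le> 2 ^ n"
  shows "\<bar>w (real k * T / 2 ^ n) - w 0\<bar> \<le> (\<Sum>i\<le>n. a i)"
  using assms(2)
proof (induction n arbitrary: k)
  case 0
  then have "k = 0 \<or> k = 1" by auto
  then show ?case using step[of 0 0] by auto
next
  case (Suc n)
  have a0: "0 \<le> a (Suc n)" using step[of 0 "Suc n"] by (simp add: order_trans[OF abs_ge_zero])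
  have half: "\<bar>w (real (2 * j) * T / 2 ^ Suc n) - w 0\<bar> \<le> (\<Sum>i\<le>n. a i)" if "j \<le> 2 ^ n" for j
    using Suc.IH[OF that] by simp
  show ?case
  proof (cases "even k")
    case True
    then obtain j where j: "k = 2 * j" by (elim evenE)
    then show ?thesis using half[of j] Suc.prems a0 by simp
  next
    case False
    then obtain j where j: "k = Suc (2 * j)" by (metis oddE Suc_eq_plus1)
    then have "j \<le> 2 ^ n" "2 * j < 2 ^ Suc n" using Suc.prems by auto
    then show ?thesis using half[of j] step[of "2 * j" "Suc n"] unfolding j sum.atMost_Suc by linarith
  qed
qed

lemma dyadic_chaining:
  fixes w :: "real \<Rightarrow> real"
  assumes "0 < T" and cont: "continuous_on {0..T} w"
    and step: "\<And>n k. k < 2 ^ n \<Longrightarrow> \<bar>w (real (Suc k) * T / 2 ^ n) - w (real k * T / 2 ^ n)\<bar> \<le> a n"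
    and a: "summable a" and s: "s \<in> {0..T}"
  shows "\<bar>w s - w 0\<bar> \<le> suminf a"
proof -
  define k where "k n = nat \<lfloor>s * 2 ^ n / T\<rfloor>" for n
  define p where "p n = real (k n) * T / 2 ^ n" for n
  have sT: "0 \<le> s * 2 ^ n / T" for n using s \<open>0 < T\<close> by auto
  have k: "real (k n) \<le> s * 2 ^ n / T" "s * 2 ^ n / T < real (k n) + 1" for n
    using sT[of n] unfolding k_def by linarith+
  have p_le: "p n \<le> s" for n
  proof -
    have "real (k n) * T \<le> s * 2 ^ n" using k(1)[of n] \<open>0 < T\<close> by (simp add: field_simps)
    then show ?thesis by (simp add: p_def field_simps)
  qed
  have p_ge: "s - T * (1 / 2) ^ n \<le> p n" for n
  proof -
    have "s * 2 ^ n \<le> (real (k n) + 1) * T" using k(2)[of n] \<open>0 < T\<close> by (simp add: field_simps)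
    then have "s * 2 ^ n / 2 ^ n \<le> (real (k n) + 1) * T / 2 ^ n" by (rule divide_right_mono) simp
    then show ?thesis by (simp add: p_def distrib_right add_divide_distrib power_one_over)
  qed
  have p0: "0 \<le> p n" for n using \<open>0 < T\<close> by (simp add: p_def)
  have k_le: "k n \<le> 2 ^ n" for n
  proof -
    have "real (k n) \<le> s * 2 ^ n / T" by (rule k)
    also have "\<dots> \<le> T * 2 ^ n / T" using s \<open>0 < T\<close> by (intro divide_right_mono mult_right_mono) auto
    also have "\<dots> = real (2 ^ n)" using \<open>0 < T\<close> by simp
    finally show ?thesis by (simp only: of_nat_le_iff)
  qed
  have "p \<longlonglongrightarrow> s"
  proof (rule tendsto_sandwich[of "\<lambda>n. s - T * (1 / 2) ^ n" _ _ "\<lambda>_. s"])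
    have "(\<lambda>n. s - T * (1 / 2) ^ n) \<longlonglongrightarrow> s - T * 0"
      by (intro tendsto_intros LIMSEQ_power_zero) auto
    then show "(\<lambda>n. s - T * (1 / 2) ^ n) \<longlonglongrightarrow> s" by simp
  qed (use p_le p_ge in \<open>auto intro: always_eventually\<close>)
  then have "(\<lambda>n. w (p n)) \<longlonglongrightarrow> w s"
    using continuous_on_tendsto_compose[OF cont, of p s] s p0 p_le
    by (auto intro!: always_eventually intro: order_trans)
  then have lim: "(\<lambda>n. \<bar>w (p n) - w 0\<bar>) \<longlonglongrightarrow> \<bar>w s - w 0\<bar>" by (intro tendsto_intros)
  show ?thesis
  proof (rule LIMSEQ_le_const2[OF lim], intro exI allI impI)
    fix n :: nat
    have "0 \<le> a i" for i using step[of 0 i] by (simp add: order_trans[OF abs_ge_zero])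
    then have "(\<Sum>i\<le>n. a i) \<le> suminf a"
      using a by (intro sum_le_suminf) auto
    then show "\<bar>w (p n) - w 0\<bar> \<le> suminf a"
      using dyadic_point_chaining[where w = w and T = T and a = a, OF step k_le[of n]]
      unfolding p_def by linarith
  qed
qed

lemma brownian_increment_moment:
  assumes "brownian_motion M W" "0 \<le> s" "s < t"
  shows "(\<integral>\<^sup>+\<omega>. ennreal ((W t \<omega> - W s \<omega>) ^ (2 * m)) \<partial>M) =
    ennreal (fact (2 * m) / (2 ^ m * fact m) * (t - s) ^ m)"
proof -
  have d: "distributed M lborel (\<lambda>\<omega>. W t \<omega> - W s \<omega>) (normal_density 0 (sqrt (t - s)))"
    using assms by (auto simp: brownian_motion_def)
  have "(\<integral>\<^sup>+\<omega>. ennreal ((W t \<omega> - W s \<omega>) ^ (2 * m)) \<partial>M) =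
      (\<integral>\<^sup>+x. ennreal (normal_density 0 (sqrt (t - s)) x) * ennreal (x ^ (2 * m)) \<partial>lborel)"
    using distributed_nn_integral[OF d, of "\<lambda>x. ennreal (x ^ (2 * m))"] by simp
  also have "\<dots> = (\<integral>\<^sup>+x. ennreal (normal_density 0 (sqrt (t - s)) x * (x - 0) ^ (2 * m)) \<partial>lborel)"
    by (simp add: ennreal_mult)
  also have "\<dots> = ennreal (fact (2 * m) / ((2 / (sqrt (t - s))\<^sup>2) ^ m * fact m))"
    using normal_moment_even[of "sqrt (t - s)" 0 m] assms(3)
    by (subst nn_integral_eq_integral) (auto simp: has_bochner_integral_iff)
  also have "fact (2 * m) / ((2 / (sqrt (t - s))\<^sup>2) ^ m * fact m) = fact (2 * m) / (2 ^ m * fact m) * (t - s) ^ m"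
    using assms(3) by (simp add: power_divide)
  finally show ?thesis .
qed

text \<open>
Let \<open>Q\<close> be the sum over \<open>n\<close> of \<open>(3/2)\<^sup>n\<close> times the sum of the powers \<open>2m\<close> of the increments of level \<open>n\<close>.
There are \<open>2\<^sup>n\<close> of them, each with a moment of order \<open>2\<^bsup>-nm\<^esup>\<close>, so for \<open>m \<ge> 2\<close> the expectation of \<open>Q\<close> is
dominated by a geometric series with ratio \<open>3/4\<close>. Conversely, an increment of level \<open>n\<close> is at most
\<open>((2/3)\<^sup>n Q)\<close> to the power \<open>1/(2m)\<close>, which is summable in \<open>n\<close>, and chaining bounds the running maximum by a
multiple of \<open>Q\<close> to the power \<open>1/(2m)\<close>.
\<close>

lemma brownian_running_max_moment:
  assumes W: "brownian_motion M W" and "0 < T" and m: "2 \<le> m"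
  shows "\<exists>X. X \<in> borel_measurable M \<and> (\<forall>\<omega>. 0 \<le> X \<omega>) \<and> integrable M (\<lambda>\<omega>. X \<omega> ^ (2 * m)) \<and>
    (AE \<omega> in M. \<forall>s\<in>{0..T}. \<bar>W s \<omega> - W 0 \<omega>\<bar> \<le> X \<omega>)"
proof -
  have W_meas[measurable]: "\<And>t. 0 \<le> t \<Longrightarrow> W t \<in> borel_measurable M"
    and W_cont: "\<And>\<omega>. \<omega> \<in> space M \<Longrightarrow> continuous_on {0..} (\<lambda>t. W t \<omega>)"
    using W by (auto simp: brownian_motion_def)
  define \<Delta> where "\<Delta> n k \<omega> = W (real (Suc k) * T / 2 ^ n) \<omega> - W (real k * T / 2 ^ n) \<omega>" for n k \<omega>
  have [measurable]: "\<Delta> n k \<in> borel_measurable M" for n k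
    using \<open>0 < T\<close> unfolding \<Delta>_def by (intro borel_measurable_diff W_meas) auto
  define D where "D n \<omega> = (\<Sum>k<2 ^ n. ennreal (\<Delta> n k \<omega> ^ (2 * m)))" for n \<omega>
  define c where "c = fact (2 * m) / (2 ^ m * fact m) * T ^ m"
  have "0 \<le> c" using \<open>0 < T\<close> by (simp add: c_def)
  have \<Delta>_moment: "(\<integral>\<^sup>+\<omega>. ennreal (\<Delta> n k \<omega> ^ (2 * m)) \<partial>M) = ennreal (c / (2 ^ n) ^ m)" for n k
  proof -
    have "(\<integral>\<^sup>+\<omega>. ennreal (\<Delta> n k \<omega> ^ (2 * m)) \<partial>M) = ennreal (fact (2 * m) / (2 ^ m * fact m) *
        (real (Suc k) * T / 2 ^ n - real k * T / 2 ^ n) ^ m)"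
      unfolding \<Delta>_def using \<open>0 < T\<close>
      by (intro brownian_increment_moment[OF W]) (auto simp: field_simps)
    also have "real (Suc k) * T / 2 ^ n - real k * T / 2 ^ n = T / 2 ^ n" by (simp add: field_simps)
    finally show ?thesis by (simp add: c_def power_divide)
  qed
  define Q where "Q \<omega> = (\<Sum>n. ennreal ((3 / 2) ^ n) * D n \<omega>)" for \<omega>
  have [measurable]: "Q \<in> borel_measurable M" unfolding Q_def D_def by measurable
  have "(\<integral>\<^sup>+\<omega>. Q \<omega> \<partial>M) = (\<Sum>n. \<integral>\<^sup>+\<omega>. ennreal ((3 / 2) ^ n) * D n \<omega> \<partial>M)"
    unfolding Q_def D_def by (intro nn_integral_suminf) measurable
  also have "\<dots> \<le> (\<Sum>n. ennreal (c * (3 / 4) ^ n))"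
  proof (intro suminf_le summableI)
    fix n
    have "(\<integral>\<^sup>+\<omega>. ennreal ((3 / 2) ^ n) * D n \<omega> \<partial>M) = ennreal ((3 / 2) ^ n) * (\<Sum>k<(2::nat) ^ n. ennreal (c / (2 ^ n) ^ m))"
      unfolding D_def by (subst nn_integral_cmult, measurable) (subst nn_integral_sum, auto simp: \<Delta>_moment)
    also have "\<dots> = ennreal ((3 / 2) ^ n * (2 ^ n * (c / (2 ^ n) ^ m)))"
      using \<open>0 \<le> c\<close> by (subst sum_ennreal) (simp_all add: ennreal_mult'[symmetric])
    also have "\<dots> \<le> ennreal (c * (3 / 4) ^ n)"
    proof (rule ennreal_leI)
      have "(2 ^ n) ^ 2 \<le> ((2 ^ n) ^ m :: real)" using m by (intro power_increasing) auto
      then have "c / (2 ^ n) ^ m \<le> c / (2 ^ n) ^ 2" using \<open>0 \<le> c\<close> by (intro divide_left_mono) auto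
      then have "(3 / 2) ^ n * (2 ^ n * (c / (2 ^ n) ^ m)) \<le> (3 / 2) ^ n * (2 ^ n * (c / (2 ^ n) ^ 2))"
        by (intro mult_left_mono) auto
      also have "\<dots> = c * ((3 / 2) ^ n / 2 ^ n)" by (simp add: power2_eq_square)
      also have "\<dots> = c * (3 / 4) ^ n" by (simp flip: power_divide)
      finally show "(3 / 2) ^ n * (2 ^ n * (c / (2 ^ n) ^ m)) \<le> c * (3 / 4) ^ n" .
    qed
    finally show "(\<integral>\<^sup>+\<omega>. ennreal ((3 / 2) ^ n) * D n \<omega> \<partial>M) \<le> ennreal (c * (3 / 4) ^ n)" .
  qed
  also have "\<dots> = ennreal (\<Sum>n. c * (3 / 4) ^ n)"
    using \<open>0 \<le> c\<close> by (intro suminf_ennreal2 summable_mult summable_geometric) auto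
  also have "\<dots> < \<infinity>" by simp
  finally have fin: "(\<integral>\<^sup>+\<omega>. Q \<omega> \<partial>M) < \<infinity>" .
  then have AE_fin: "AE \<omega> in M. Q \<omega> \<noteq> \<infinity>" by (intro nn_integral_PInf_AE) auto
  \<comment> \<open>the bound for an increment of level \<open>n\<close> in the case \<open>Q = 1\<close>\<close>
  define b where "b n = root (2 * m) ((2 / 3) ^ n)" for n
  have m0: "0 < 2 * m" using m by simp
  define r where "r = root (2 * m) (2 / 3)"
  have r: "0 \<le> r" "r < 1" using m0 by (auto simp: r_def)
  have b: "b = (\<lambda>n. r ^ n)" using m0 by (auto simp: b_def r_def real_root_power)
  have sb: "summable b" unfolding b using r by (intro summable_geometric) auto
  have b0: "0 \<le> b n" for n unfolding b using r by simp
  define X where "X \<omega> = suminf b * root (2 * m) (enn2real (Q \<omega>))" for \<omega>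
  have X_meas: "X \<in> borel_measurable M" unfolding X_def by measurable
  have X0: "0 \<le> X \<omega>" for \<omega> unfolding X_def using sb b0 m0 by (intro mult_nonneg_nonneg suminf_nonneg) auto
  have "integrable M (\<lambda>\<omega>. enn2real (Q \<omega>))"
  proof (rule integrableI_bounded)
    have "(\<integral>\<^sup>+\<omega>. ennreal (norm (enn2real (Q \<omega>))) \<partial>M) \<le> (\<integral>\<^sup>+\<omega>. Q \<omega> \<partial>M)"
      using AE_fin by (intro nn_integral_mono_AE) (auto simp: less_top[symmetric] elim!: eventually_mono)
    then show "(\<integral>\<^sup>+\<omega>. ennreal (norm (enn2real (Q \<omega>))) \<partial>M) < \<infinity>" using fin by simp
  qed measurable
  then have "integrable M (\<lambda>\<omega>. X \<omega> ^ (2 * m))"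
    using m0 by (simp add: X_def power_mult_distrib)
  moreover have "AE \<omega> in M. \<forall>s\<in>{0..T}. \<bar>W s \<omega> - W 0 \<omega>\<bar> \<le> X \<omega>"
    using AE_fin AE_space
  proof eventually_elim
    case (elim \<omega>)
    define q where "q = enn2real (Q \<omega>)"
    have q: "Q \<omega> = ennreal q" "0 \<le> q" using elim(1) by (auto simp: q_def less_top[symmetric])
    show ?case
    proof
      fix s assume s: "s \<in> {0..T}"
      have "\<bar>W s \<omega> - W 0 \<omega>\<bar> \<le> (\<Sum>n. b n * root (2 * m) q)"
      proof (rule dyadic_chaining[OF \<open>0 < T\<close> _ _ _ s])
        show "continuous_on {0..T} (\<lambda>s. W s \<omega>)"
          by (rule continuous_on_subset[OF W_cont[OF elim(2)]]) auto
        show "summable (\<lambda>n. b n * root (2 * m) q)" using sb by (rule summable_mult2)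
        fix n k :: nat assume "k < 2 ^ n"
        have "ennreal ((3 / 2) ^ n * \<Delta> n k \<omega> ^ (2 * m)) = ennreal ((3 / 2) ^ n) * ennreal (\<Delta> n k \<omega> ^ (2 * m))"
          by (simp add: ennreal_mult)
        also have "ennreal (\<Delta> n k \<omega> ^ (2 * m)) \<le> D n \<omega>"
          unfolding D_def using \<open>k < 2 ^ n\<close> by (intro member_le_sum) auto
        also have "ennreal ((3 / 2) ^ n) * D n \<omega> \<le> Q \<omega>"
          unfolding Q_def using sum_le_suminf[of "\<lambda>n. ennreal ((3 / 2) ^ n) * D n \<omega>" "{n}"] by simp
        finally have "(3 / 2) ^ n * \<Delta> n k \<omega> ^ (2 * m) \<le> q"
          using q by (simp add: mult_left_mono)
        then have "\<Delta> n k \<omega> ^ (2 * m) \<le> (2 / 3) ^ n * q"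
          by (simp add: power_divide field_simps)
        then have "root (2 * m) (\<bar>\<Delta> n k \<omega>\<bar> ^ (2 * m)) \<le> root (2 * m) ((2 / 3) ^ n * q)"
          using m0 by (subst real_root_le_iff) (auto simp: power_even_abs)
        then show "\<bar>W (real (Suc k) * T / 2 ^ n) \<omega> - W (real k * T / 2 ^ n) \<omega>\<bar> \<le> b n * root (2 * m) q"
          using m0 by (simp add: \<Delta>_def b_def real_root_mult real_root_power_cancel)
      qed
      also have "\<dots> = X \<omega>" using sb by (simp add: X_def q_def suminf_mult2)
      finally show "\<bar>W s \<omega> - W 0 \<omega>\<bar> \<le> X \<omega>" .
    qed
  qed
  ultimately show ?thesis using X_meas X0 by blast
qed

text \<open>
The estimate \<open>n\<^sup>k \<le> k! e\<^sup>n\<close> reduces the moment to the exponential series at \<open>e\<close> times the rate.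
\<close>

lemma poisson_moment_integrable:
  assumes "0 < rate"
  shows "integrable (measure_pmf (poisson_pmf rate)) (\<lambda>n. real n ^ k)"
proof (rule integrableI_bounded)
  have "(\<integral>\<^sup>+n. ennreal (norm (real n ^ k)) \<partial>measure_pmf (poisson_pmf rate)) =
      (\<Sum>n. ennreal (pmf (poisson_pmf rate) n * real n ^ k))"
    by (simp add: nn_integral_measure_pmf nn_integral_count_space_nat ennreal_mult)
  also have "\<dots> \<le> (\<Sum>n. ennreal (fact k * ((exp 1 * rate) ^ n / fact n)))"
  proof (intro suminf_le summableI ennreal_leI)
    fix n
    have "real n ^ k / fact k \<le> exp (real n)"
    proof -
      have "(\<Sum>i\<in>{k}. real n ^ i / fact i) \<le> (\<Sum>i. real n ^ i / fact i)"
        using summable_exp[of "real n"] by (intro sum_le_suminf) (auto simp: divide_inverse mult.commute)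
      then show ?thesis by (simp add: exp_def divide_inverse mult.commute)
    qed
    then have "real n ^ k \<le> fact k * exp 1 ^ n" by (simp add: field_simps flip: exp_of_nat_mult)
    moreover have "pmf (poisson_pmf rate) n \<le> rate ^ n / fact n"
      using assms mult_left_le[of "exp (- rate)" "rate ^ n / fact n"] by (simp add: pmf_poisson)
    ultimately have "pmf (poisson_pmf rate) n * real n ^ k \<le> rate ^ n / fact n * (fact k * exp 1 ^ n)"
      using assms by (intro mult_mono) auto
    then show "pmf (poisson_pmf rate) n * real n ^ k \<le> fact k * ((exp 1 * rate) ^ n / fact n)"
      by (simp add: power_mult_distrib mult_ac)
  qed
  also have "\<dots> = ennreal (\<Sum>n. fact k * ((exp 1 * rate) ^ n / fact n))"
    using assms summable_exp[of "exp 1 * rate"]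
    by (intro suminf_ennreal2 summable_mult) (auto simp: divide_inverse mult.commute)
  also have "\<dots> < \<infinity>" by simp
  finally show "(\<integral>\<^sup>+n. ennreal (norm (real n ^ k)) \<partial>measure_pmf (poisson_pmf rate)) < \<infinity>" .
qed auto

lemma poisson_process_moment:
  assumes N: "poisson_process M lam N" and "0 < lam" "0 < T"
  shows "integrable M (\<lambda>\<omega>. real (N T \<omega>) ^ k)"
proof -
  have [measurable]: "N T \<in> measurable M (count_space UNIV)" "N 0 \<in> measurable M (count_space UNIV)"
    and N0: "AE \<omega> in M. N 0 \<omega> = 0"
    and d: "distr M (count_space UNIV) (\<lambda>\<omega>. N T \<omega> - N 0 \<omega>) = measure_pmf (poisson_pmf (lam * T))"
    using N \<open>0 < T\<close> by (auto simp: poisson_process_def)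
  have "integrable (distr M (count_space UNIV) (\<lambda>\<omega>. N T \<omega> - N 0 \<omega>)) (\<lambda>n. real n ^ k)"
    unfolding d using assms by (intro poisson_moment_integrable) auto
  then have "integrable M (\<lambda>\<omega>. real (N T \<omega> - N 0 \<omega>) ^ k)"
    by (subst (asm) integrable_distr_eq) auto
  then show ?thesis
    by (rule integrable_cong_AE_imp) (use N0 in \<open>auto elim!: eventually_mono\<close>)
qed

lemma sum_power_le:
  fixes f :: "nat \<Rightarrow> real"
  assumes "\<And>j. 0 \<le> f j" "0 < p"
  shows "(\<Sum>j=1..n. f j) ^ p \<le> real n ^ p * (\<Sum>j=1..n. f j ^ p)"
proof (cases "n = 0")
  case False
  define m where "m = Max (f ` {1..n})"
  have "m \<in> f ` {1..n}" unfolding m_def using False by (intro Max_in) auto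
  then obtain i where i: "i \<in> {1..n}" "m = f i" by auto
  have "(\<Sum>j=1..n. f j) \<le> (\<Sum>j=1..n. m)" unfolding m_def by (intro sum_mono Max_ge) auto
  then have "(\<Sum>j=1..n. f j) \<le> real n * m" by simp
  then have "(\<Sum>j=1..n. f j) ^ p \<le> (real n * m) ^ p" using assms by (intro power_mono sum_nonneg) auto
  also have "\<dots> = real n ^ p * f i ^ p" by (simp add: i power_mult_distrib)
  also have "\<dots> \<le> real n ^ p * (\<Sum>j=1..n. f j ^ p)"
    using i assms by (intro mult_left_mono member_le_sum) auto
  finally show ?thesis .
qed (use assms(2) in \<open>simp add: zero_power\<close>)

text \<open>
A sum with a random number of terms is first written as a sum over all \<open>j\<close>. On \<open>j \<le> N\<^sub>T\<close> a factor
\<open>(N\<^sub>T/j)\<^sup>2 \<ge> 1\<close> can be inserted, whose denominator makes the sum converge; then \<open>ab \<le> a\<^sup>2 + b\<^sup>2\<close> separates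
\<open>N\<^sub>T\<close> from the marks.
\<close>

lemma jump_total_moment:
  assumes N: "poisson_process M lam N" and "0 < lam" "0 < T"
    and marks: "\<And>j. 1 \<le> j \<Longrightarrow> \<eta> j \<in> borel_measurable M" "\<And>j. 1 \<le> j \<Longrightarrow> distr M borel (\<eta> j) = \<nu>"
    and moments: "\<And>n::nat. integrable \<nu> (\<lambda>x. x ^ n)" and p: "0 < p"
  shows "(\<lambda>\<omega>. real (N T \<omega>) * (\<Sum>j=1..N T \<omega>. \<bar>\<eta> j \<omega>\<bar>)) \<in> borel_measurable M"
    and "integrable M (\<lambda>\<omega>. (real (N T \<omega>) * (\<Sum>j=1..N T \<omega>. \<bar>\<eta> j \<omega>\<bar>)) ^ p)"
proof -
  define X where "X \<omega> = real (N T \<omega>) * (\<Sum>j=1..N T \<omega>. \<bar>\<eta> j \<omega>\<bar>)" for \<omega>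
  have NT[measurable]: "N T \<in> measurable M (count_space UNIV)"
    using N \<open>0 < T\<close> by (auto simp: poisson_process_def)
  have [measurable]: "X \<in> borel_measurable M"
    unfolding X_def
  proof (rule measurable_compose_countable'[where I = UNIV and f = "\<lambda>n \<omega>. real n * (\<Sum>j=1..n. \<bar>\<eta> j \<omega>\<bar>)", OF _ NT])
    show "(\<lambda>\<omega>. real n * (\<Sum>j=1..n. \<bar>\<eta> j \<omega>\<bar>)) \<in> borel_measurable M" for n
      using marks(1) by (intro borel_measurable_times borel_measurable_sum borel_measurable_abs) auto
  qed auto
  then show "(\<lambda>\<omega>. real (N T \<omega>) * (\<Sum>j=1..N T \<omega>. \<bar>\<eta> j \<omega>\<bar>)) \<in> borel_measurable M"
    by (simp add: X_def[abs_def])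
  have X0: "0 \<le> X \<omega>" for \<omega> unfolding X_def by (intro mult_nonneg_nonneg sum_nonneg) auto
  define A where "A \<omega> = real (N T \<omega>) ^ (2 * (2 * p + 2))" for \<omega>
  have A: "integrable M A" unfolding A_def by (rule poisson_process_moment[OF assms(1-3)])
  define e where "e = (\<integral>x. x ^ (2 * p) \<partial>\<nu>)"
  have \<eta>: "integrable M (\<lambda>\<omega>. \<eta> (Suc i) \<omega> ^ (2 * p))" "(\<integral>\<omega>. \<eta> (Suc i) \<omega> ^ (2 * p) \<partial>M) = e" for i
  proof -
    have [measurable]: "\<eta> (Suc i) \<in> borel_measurable M" using marks(1) by simp
    have "integrable (distr M borel (\<eta> (Suc i))) (\<lambda>x. x ^ (2 * p))"
      using marks(2) moments by simp
    then show "integrable M (\<lambda>\<omega>. \<eta> (Suc i) \<omega> ^ (2 * p))" by (subst (asm) integrable_distr_eq) auto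
    have "(\<integral>x. x ^ (2 * p) \<partial>distr M borel (\<eta> (Suc i))) = e" using marks(2) by (simp add: e_def)
    then show "(\<integral>\<omega>. \<eta> (Suc i) \<omega> ^ (2 * p) \<partial>M) = e" by (subst (asm) integral_distr) auto
  qed
  \<comment> \<open>the convergence factor, with the marks renumbered from 0\<close>
  define w where "w i = 1 / real (Suc i) ^ 2" for i
  have w0: "0 \<le> w i" for i by (simp add: w_def)
  have sw: "summable w"
    using inverse_power_summable[of 2, where 'a = real]
    unfolding w_def by (subst summable_Suc_iff) (simp add: inverse_eq_divide)
  define f where "f i \<omega> = w i * (A \<omega> + \<eta> (Suc i) \<omega> ^ (2 * p))" for i \<omega>
  have f0: "0 \<le> f i \<omega>" for i \<omega> using w0 by (auto simp: f_def A_def)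
  have pointwise: "ennreal (X \<omega> ^ p) \<le> (\<Sum>i. ennreal (f i \<omega>))" for \<omega>
  proof -
    let ?n = "N T \<omega>"
    have "X \<omega> ^ p \<le> real ?n ^ p * (real ?n ^ p * (\<Sum>j=1..?n. \<bar>\<eta> j \<omega>\<bar> ^ p))"
      unfolding X_def power_mult_distrib using p by (intro mult_left_mono sum_power_le) auto
    also have "\<dots> = (\<Sum>j=1..?n. real ?n ^ (2 * p) * \<bar>\<eta> j \<omega>\<bar> ^ p)"
      by (simp add: sum_distrib_left power_add mult_2 mult.assoc)
    also have "\<dots> = (\<Sum>i<?n. real ?n ^ (2 * p) * \<bar>\<eta> (Suc i) \<omega>\<bar> ^ p)"
      by (simp add: sum.atLeast1_atMost_eq)
    also have "\<dots> \<le> (\<Sum>i<?n. f i \<omega>)"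
    proof (rule sum_mono)
      fix i assume i: "i \<in> {..<?n}"
      let ?h = "\<bar>\<eta> (Suc i) \<omega>\<bar> ^ p"
      have "1 \<le> real ?n ^ 2 * w i"
      proof -
        have "real (Suc i) ^ 2 \<le> real ?n ^ 2" using i by (intro power_mono) auto
        then show ?thesis by (simp add: w_def del: of_nat_Suc)
      qed
      then have "real ?n ^ (2 * p) * ?h * 1 \<le> real ?n ^ (2 * p) * ?h * (real ?n ^ 2 * w i)"
        by (intro mult_left_mono) auto
      also have "\<dots> = w i * (real ?n ^ (2 * p + 2) * ?h)" by (simp add: power_add power2_eq_square mult_ac)
      also have "\<dots> \<le> w i * ((real ?n ^ (2 * p + 2)) ^ 2 + ?h ^ 2)"
      proof (rule mult_left_mono[OF _ w0])
        have "2 * (real ?n ^ (2 * p + 2) * ?h) \<le> (real ?n ^ (2 * p + 2)) ^ 2 + ?h ^ 2"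
          using sum_squares_bound[of "real ?n ^ (2 * p + 2)" ?h] by simp
        moreover have "0 \<le> real ?n ^ (2 * p + 2) * ?h" by simp
        ultimately show "real ?n ^ (2 * p + 2) * ?h \<le> (real ?n ^ (2 * p + 2)) ^ 2 + ?h ^ 2" by linarith
      qed
      also have "\<dots> = f i \<omega>"
      proof -
        have "(real ?n ^ (2 * p + 2)) ^ 2 = A \<omega>"
          unfolding A_def power_mult[symmetric] by (simp only: mult.commute)
        moreover have "?h ^ 2 = \<eta> (Suc i) \<omega> ^ (2 * p)"
          by (metis power_mult power2_abs mult.commute)
        ultimately show ?thesis by (simp add: f_def)
      qed
      finally show "real ?n ^ (2 * p) * ?h \<le> f i \<omega>" by simp
    qed
    finally have "ennreal (X \<omega> ^ p) \<le> ennreal (\<Sum>i<?n. f i \<omega>)" by (rule ennreal_leI)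
    also have "\<dots> = (\<Sum>i<?n. ennreal (f i \<omega>))" using f0 by (simp add: sum_ennreal)
    also have "\<dots> \<le> (\<Sum>i. ennreal (f i \<omega>))" by (intro sum_le_suminf) auto
    finally show ?thesis .
  qed
  have fi: "integrable M (f i)" "(\<integral>\<omega>. f i \<omega> \<partial>M) = w i * ((\<integral>\<omega>. A \<omega> \<partial>M) + e)" for i
    using A \<eta>[of i] by (auto simp: f_def[abs_def])
  have "integrable M (\<lambda>\<omega>. X \<omega> ^ p)"
  proof (rule integrableI_bounded)
    have "(\<integral>\<^sup>+\<omega>. ennreal (norm (X \<omega> ^ p)) \<partial>M) \<le> (\<integral>\<^sup>+\<omega>. (\<Sum>i. ennreal (f i \<omega>)) \<partial>M)"
      using pointwise X0 by (intro nn_integral_mono) simp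
    also have "\<dots> = (\<Sum>i. \<integral>\<^sup>+\<omega>. ennreal (f i \<omega>) \<partial>M)"
      using fi(1) by (intro nn_integral_suminf) auto
    also have "\<dots> = (\<Sum>i. ennreal (w i * ((\<integral>\<omega>. A \<omega> \<partial>M) + e)))"
      using fi f0 by (simp add: nn_integral_eq_integral)
    also have "\<dots> = ennreal (\<Sum>i. w i * ((\<integral>\<omega>. A \<omega> \<partial>M) + e))"
    proof (intro suminf_ennreal2 summable_mult2 sw)
      show "0 \<le> w i * ((\<integral>\<omega>. A \<omega> \<partial>M) + e)" for i
        unfolding fi(2)[symmetric] using f0 by (rule Bochner_Integration.integral_nonneg)
    qed
    also have "\<dots> < \<infinity>" by simp
    finally show "(\<integral>\<^sup>+\<omega>. ennreal (norm (X \<omega> ^ p)) \<partial>M) < \<infinity>" .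
  qed measurable
  then show "integrable M (\<lambda>\<omega>. (real (N T \<omega>) * (\<Sum>j=1..N T \<omega>. \<bar>\<eta> j \<omega>\<bar>)) ^ p)"
    by (simp add: X_def)
qed

text \<open>
The part of the equation that does not involve the solution.
\<close>

definition sde_noise :: "(real \<Rightarrow> 'a \<Rightarrow> real) \<Rightarrow> (real \<Rightarrow> 'a \<Rightarrow> nat) \<Rightarrow> (nat \<Rightarrow> 'a \<Rightarrow> real) \<Rightarrow>
    real \<Rightarrow> real \<Rightarrow> real \<Rightarrow> 'a \<Rightarrow> state" where
  "sde_noise W N \<eta> \<sigma> t s \<omega> = (W s \<omega> - W t \<omega>) *\<^sub>R diffusion \<sigma>
     + counting_integral (\<lambda>u. jump (\<eta> (1 + left_limit (\<lambda>r. N r \<omega>) u) \<omega>)) (\<lambda>r. N r \<omega>) t s"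

lemma poisson_counting_path:
  assumes "poisson_process M lam N" "\<omega> \<in> space M"
  shows "counting_path (\<lambda>r. N r \<omega>)"
  using assms by (auto simp: poisson_process_def counting_path_def)

lemma norm_diffusion [simp]: "norm (diffusion \<sigma>) = \<bar>\<sigma>\<bar>"
  by (simp add: diffusion_def norm_Pair)

lemma norm_jump [simp]: "norm (jump e) = \<bar>e\<bar>"
  by (simp add: jump_def norm_Pair)

lemma add_power_le:
  fixes a b :: real
  assumes "0 \<le> a" "0 \<le> b"
  shows "(a + b) ^ p \<le> 2 ^ p * (a ^ p + b ^ p)"
proof -
  have "(a + b) ^ p \<le> (2 * max a b) ^ p" using assms by (intro power_mono) auto
  also have "\<dots> = 2 ^ p * max a b ^ p" by (simp add: power_mult_distrib)
  also have "\<dots> \<le> 2 ^ p * (a ^ p + b ^ p)" using assms by (intro mult_left_mono) (auto simp: max_def)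
  finally show ?thesis .
qed

text \<open>
One random variable dominates the noise for all starting times \<open>t\<close>. This makes the constants of the
moment bound uniform in \<open>t\<close>.
\<close>

lemma sde_noise_moment:
  assumes noise: "driving_noise M lam \<nu> W N \<eta>" and "0 < lam" "0 < T" "2 \<le> m"
    and moments: "\<And>n::nat. integrable \<nu> (\<lambda>x. x ^ n)"
  shows "\<exists>X. X \<in> borel_measurable M \<and> (\<forall>\<omega>. 0 \<le> X \<omega>) \<and> integrable M (\<lambda>\<omega>. X \<omega> ^ (2 * m)) \<and>
    (AE \<omega> in M. \<forall>t\<in>{0..T}. \<forall>s\<in>{t..T}. norm (sde_noise W N \<eta> \<sigma> t s \<omega>) \<le> X \<omega>)"
proof -
  have W: "brownian_motion M W" and N: "poisson_process M lam N" and iid: "iid_marks M \<nu> \<eta>" and P: "prob_space M"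
    using noise by (auto simp: driving_noise_def)
  have marks: "\<And>j. 1 \<le> j \<Longrightarrow> \<eta> j \<in> borel_measurable M" "\<And>j. 1 \<le> j \<Longrightarrow> distr M borel (\<eta> j) = \<nu>"
    using iid P by (auto simp: iid_marks_def prob_space.indep_vars_def2)
  obtain X1 where X1: "X1 \<in> borel_measurable M" "\<And>\<omega>. 0 \<le> X1 \<omega>" "integrable M (\<lambda>\<omega>. X1 \<omega> ^ (2 * m))"
    "AE \<omega> in M. \<forall>s\<in>{0..T}. \<bar>W s \<omega> - W 0 \<omega>\<bar> \<le> X1 \<omega>"
    using brownian_running_max_moment[OF W \<open>0 < T\<close> \<open>2 \<le> m\<close>] by auto
  define X2 where "X2 \<omega> = real (N T \<omega>) * (\<Sum>j=1..N T \<omega>. \<bar>\<eta> j \<omega>\<bar>)" for \<omega>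
  have X2: "X2 \<in> borel_measurable M" "integrable M (\<lambda>\<omega>. X2 \<omega> ^ (2 * m))"
    unfolding X2_def using jump_total_moment[where \<eta> = \<eta>, OF N assms(2,3) marks moments, of "2 * m"] assms(4) by auto
  have X20: "0 \<le> X2 \<omega>" for \<omega> unfolding X2_def by (intro mult_nonneg_nonneg sum_nonneg) auto
  define X where "X \<omega> = 2 * \<bar>\<sigma>\<bar> * X1 \<omega> + X2 \<omega>" for \<omega>
  have X: "X \<in> borel_measurable M" using X1(1) X2(1) unfolding X_def by measurable
  have X0: "0 \<le> X \<omega>" for \<omega> using X1(2) X20 by (auto simp: X_def)
  have "integrable M (\<lambda>\<omega>. X \<omega> ^ (2 * m))"
  proof (rule Bochner_Integration.integrable_bound)
    show "integrable M (\<lambda>\<omega>. 2 ^ (2 * m) * ((2 * \<bar>\<sigma>\<bar>) ^ (2 * m) * X1 \<omega> ^ (2 * m) + X2 \<omega> ^ (2 * m)))"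
      using X1(3) X2(2) by auto
    show "(\<lambda>\<omega>. X \<omega> ^ (2 * m)) \<in> borel_measurable M" using X by measurable
    show "AE \<omega> in M. norm (X \<omega> ^ (2 * m)) \<le>
        norm (2 ^ (2 * m) * ((2 * \<bar>\<sigma>\<bar>) ^ (2 * m) * X1 \<omega> ^ (2 * m) + X2 \<omega> ^ (2 * m)))"
    proof (rule AE_I2)
      fix \<omega>
      have "X \<omega> ^ (2 * m) \<le> 2 ^ (2 * m) * ((2 * \<bar>\<sigma>\<bar> * X1 \<omega>) ^ (2 * m) + X2 \<omega> ^ (2 * m))"
        unfolding X_def using X1(2) X20 by (intro add_power_le) auto
      then show "norm (X \<omega> ^ (2 * m)) \<le>
          norm (2 ^ (2 * m) * ((2 * \<bar>\<sigma>\<bar>) ^ (2 * m) * X1 \<omega> ^ (2 * m) + X2 \<omega> ^ (2 * m)))"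
        using X0[of \<omega>] X1(2)[of \<omega>] X20[of \<omega>] by (simp only: power_mult_distrib real_norm_def) (simp add: abs_mult)
    qed
  qed
  moreover have "AE \<omega> in M. \<forall>t\<in>{0..T}. \<forall>s\<in>{t..T}. norm (sde_noise W N \<eta> \<sigma> t s \<omega>) \<le> X \<omega>"
    using X1(4) AE_space
  proof eventually_elim
    case (elim \<omega>)
    interpret counting_path "\<lambda>r. N r \<omega>" using poisson_counting_path[OF N elim(2)] .
    show ?case
    proof (intro ballI)
      fix t s assume t: "t \<in> {0..T}" and s: "s \<in> {t..T}"
      have "\<bar>W s \<omega> - W t \<omega>\<bar> \<le> 2 * X1 \<omega>"
        using elim(1)[rule_format, of s] elim(1)[rule_format, of t] t s by auto
      then have "norm ((W s \<omega> - W t \<omega>) *\<^sub>R diffusion \<sigma>) \<le> 2 * X1 \<omega> * \<bar>\<sigma>\<bar>"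
        by (simp add: mult_right_mono)
      moreover have "norm (counting_integral (\<lambda>u. jump (\<eta> (1 + left_limit (\<lambda>r. N r \<omega>) u) \<omega>)) (\<lambda>r. N r \<omega>) t s) \<le> X2 \<omega>"
        using counting_integral_bound[of t s T "\<lambda>j. jump (\<eta> j \<omega>)"] t s by (simp add: X2_def)
      ultimately show "norm (sde_noise W N \<eta> \<sigma> t s \<omega>) \<le> X \<omega>"
        unfolding sde_noise_def X_def by (intro norm_triangle_le) (simp add: mult_ac)
    qed
  qed
  ultimately show ?thesis using X X0 by blast
qed


section \<open>Exploratory drift and running cost of a continuous policy\<close>

lemma set_integral_norm_le:
  fixes f :: "'a \<Rightarrow> 'b::{banach, second_countable_topology}" and g :: "'a \<Rightarrow> real"
  assumes "set_integrable M A f" "set_integrable M A g" "\<And>v. v \<in> A \<Longrightarrow> norm (f v) \<le> c * g v"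
  shows "norm (LINT v:A|M. f v) \<le> c * (LINT v:A|M. g v)"
proof -
  have "norm (LINT v:A|M. f v) \<le> (LINT v:A|M. norm (f v))"
    using assms(1) by (rule set_integral_norm_bound)
  also have "\<dots> \<le> (LINT v:A|M. c * g v)"
    using assms by (intro set_integral_mono set_integrable_norm) auto
  finally show ?thesis by simp
qed

lemma regularized_cost_eq:
  "regularized_cost \<phi> \<rho> \<gamma> pol t y v = \<phi> * (v - \<rho> * snd (snd (snd y)))\<^sup>2 + \<gamma> * ln (pol t y v)"
  by (cases y) simp

text \<open>
Lipschitz approximations of \<open>x ln x\<close> with smaller modulus, obtained by clamping the logarithm to \<open>[-n, n]\<close>.
\<close>

definition clamped_entropy :: "nat \<Rightarrow> real \<Rightarrow> real" where
  "clamped_entropy n x = x * max (- real n) (min (real n) (ln x))"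

lemma clamped_entropy_measurable: "clamped_entropy n \<in> borel_measurable borel"
  unfolding clamped_entropy_def[abs_def] by measurable

lemma clamped_entropy_le: "\<bar>clamped_entropy n x\<bar> \<le> \<bar>x * ln x\<bar>"
  unfolding clamped_entropy_def abs_mult by (intro mult_left_mono) (auto simp: max_def min_def)

lemma clamped_entropy_tendsto: "(\<lambda>n. clamped_entropy n x) \<longlonglongrightarrow> x * ln x"
proof (rule tendsto_eventually)
  obtain n0 :: nat where "\<bar>ln x\<bar> \<le> real n0" using real_arch_simple by blast
  then show "eventually (\<lambda>n. clamped_entropy n x = x * ln x) sequentially"
    by (intro eventually_sequentiallyI[of n0]) (auto simp: clamped_entropy_def)
qed

text \<open>
For \<open>x \<le> y\<close> and \<open>c\<close> the clamped logarithm, \<open>y c(y) - x c(x) = (y - x) c(y) + x (c(y) - c(x))\<close>. The first term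
is at most \<open>n (y - x)\<close>, the second at most \<open>y - x\<close> since \<open>ln y - ln x \<le> (y - x)/x\<close>.
\<close>

lemma clamped_entropy_lipschitz:
  assumes "0 \<le> x" "0 \<le> x'"
  shows "\<bar>clamped_entropy n x - clamped_entropy n x'\<bar> \<le> (real n + 1) * \<bar>x - x'\<bar>"
proof -
  have main: "\<bar>clamped_entropy n y - clamped_entropy n x\<bar> \<le> (real n + 1) * (y - x)" if "0 \<le> x" "x \<le> y" for x y
  proof -
    define c where "c x = max (- real n) (min (real n) (ln x))" for x
    have c: "\<bar>c x\<bar> \<le> real n" for x by (auto simp: c_def)
    have "x * \<bar>c y - c x\<bar> \<le> y - x"
    proof (cases "x = 0")
      case False
      then have x: "0 < x" using that by simp
      have "\<bar>c y - c x\<bar> \<le> \<bar>ln y - ln x\<bar>" by (auto simp: c_def)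
      also have "\<dots> = ln y - ln x" using x that by simp
      also have "\<dots> \<le> (y - x) / x"
        using ln_le_minus_one[of "y / x"] x that by (simp add: ln_div diff_divide_distrib)
      finally show ?thesis using x by (simp add: field_simps)
    qed (use that in auto)
    moreover have "(y - x) * \<bar>c y\<bar> \<le> (y - x) * real n" using that c by (intro mult_left_mono) auto
    moreover have "clamped_entropy n y - clamped_entropy n x = (y - x) * c y + x * (c y - c x)"
      by (simp add: clamped_entropy_def c_def algebra_simps)
    moreover have "\<bar>(y - x) * c y + x * (c y - c x)\<bar> \<le> (y - x) * \<bar>c y\<bar> + x * \<bar>c y - c x\<bar>"
      using abs_triangle_ineq[of "(y - x) * c y" "x * (c y - c x)"] that by (simp add: abs_mult)
    ultimately show ?thesis by (simp add: algebra_simps)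
  qed
  show ?thesis
    using main[of x x'] main[of x' x] assms by (cases "x \<le> x'") (auto simp: abs_minus_commute)
qed

text \<open>
The conditions of admissibility that concern the regularity of the policy as a map into \<open>L\<^sup>1\<close>.
\<close>

locale continuous_policy =
  fixes A :: "real set" and T :: real and pol :: policy
  assumes action_space: "A \<in> sets borel"
    and pol_measurable: "\<And>t y. t \<in> {0..T} \<Longrightarrow> set_borel_measurable lborel A (pol t y)"
    and pol_nonneg: "\<And>t y v. t \<in> {0..T} \<Longrightarrow> v \<in> A \<Longrightarrow> 0 \<le> pol t y v"
    and pol_total: "\<And>t y. t \<in> {0..T} \<Longrightarrow> (\<integral>\<^sup>+v\<in>A. ennreal (pol t y v) \<partial>lborel) = 1"
    and pol_continuous: "\<And>t y. t \<in> {0..T} \<Longrightarrow>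
          ((\<lambda>(t', y'). LINT v:A|lborel. \<bar>pol t y v - pol t' y' v\<bar>) \<longlongrightarrow> 0)
            (at (t, y) within {0..T} \<times> UNIV)"
    and pol_lipschitz: "\<exists>C>0. \<forall>t\<in>{0..T}. \<forall>y y'.
          (LINT v:A|lborel. \<bar>pol t y v - pol t y' v\<bar>) \<le> C * norm (y - y')"
begin

lemma pol_integrable: "t \<in> {0..T} \<Longrightarrow> set_integrable lborel A (pol t y)"
  and pol_integral: "t \<in> {0..T} \<Longrightarrow> (LINT v:A|lborel. pol t y v) = 1"
proof -
  assume t: "t \<in> {0..T}"
  have e: "(\<integral>\<^sup>+v. ennreal (indicator A v *\<^sub>R pol t y v) \<partial>lborel) = 1"
    unfolding pol_total[OF t, of y, symmetric] by (intro nn_integral_cong) (auto simp: indicator_def)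
  have "has_bochner_integral lborel (\<lambda>v. indicator A v *\<^sub>R pol t y v) 1"
    using pol_measurable[OF t, of y] pol_nonneg[OF t] e
    by (intro has_bochner_integral_nn_integral) (auto simp: set_borel_measurable_def indicator_def)
  then show "set_integrable lborel A (pol t y)" "(LINT v:A|lborel. pol t y v) = 1"
    by (auto simp: has_bochner_integral_iff set_integrable_def set_lebesgue_integral_def)
qed

lemma pol_diff_integrable:
  "t \<in> {0..T} \<Longrightarrow> t' \<in> {0..T} \<Longrightarrow> set_integrable lborel A (\<lambda>v. \<bar>pol t y v - pol t' y' v\<bar>)"
  by (intro set_integrable_abs set_integral_diff pol_integrable)

lemma pol_transform_integrable:
  fixes w h :: "real \<Rightarrow> real"
  assumes w: "set_borel_measurable lborel A w" "\<And>v. v \<in> A \<Longrightarrow> \<bar>w v\<bar> \<le> K"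
    and h: "h \<in> borel_measurable borel" "h 0 = 0" "\<And>x x'. 0 \<le> x \<Longrightarrow> 0 \<le> x' \<Longrightarrow> \<bar>h x - h x'\<bar> \<le> \<Lambda> * \<bar>x - x'\<bar>"
    and t: "t \<in> {0..T}"
  shows "set_integrable lborel A (\<lambda>v. w v * h (pol t y v))"
proof (rule set_integrable_bound)
  show "set_integrable lborel A (\<lambda>v. K * \<Lambda> * pol t y v)"
    using pol_integrable[OF t] by auto
  have [measurable]: "(\<lambda>v. indicator A v * pol t y v) \<in> borel_measurable borel"
    "(\<lambda>v. indicator A v * w v) \<in> borel_measurable borel" "h \<in> borel_measurable borel"
    using pol_measurable[OF t, of y] w h by (auto simp: set_borel_measurable_def)
  have "(\<lambda>v. (indicator A v * w v) * h (indicator A v * pol t y v)) \<in> borel_measurable borel"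
    by measurable
  also have "(\<lambda>v. (indicator A v * w v) * h (indicator A v * pol t y v)) = (\<lambda>v. indicator A v * (w v * h (pol t y v)))"
    by (auto simp: indicator_def)
  finally show "set_borel_measurable lborel A (\<lambda>v. w v * h (pol t y v))"
    by (simp add: set_borel_measurable_def)
  show "AE v in lborel. v \<in> A \<longrightarrow> norm (w v * h (pol t y v)) \<le> norm (K * \<Lambda> * pol t y v)"
  proof (intro AE_I2 impI)
    fix v assume v: "v \<in> A"
    have p: "0 \<le> pol t y v" using pol_nonneg[OF t v] .
    have "\<bar>h (pol t y v)\<bar> \<le> \<Lambda> * pol t y v" using h(3)[of "pol t y v" 0] h(2) p by simp
    then have "\<bar>w v\<bar> * \<bar>h (pol t y v)\<bar> \<le> K * (\<Lambda> * pol t y v)"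
      using w(2)[OF v] by (intro mult_mono) auto
    then show "norm (w v * h (pol t y v)) \<le> norm (K * \<Lambda> * pol t y v)"
      unfolding real_norm_def abs_mult[of "w v"] using abs_ge_self[of "K * \<Lambda> * pol t y v"] by (simp add: mult.assoc)
  qed
qed

text \<open>
A Lipschitz function acts continuously on densities in \<open>L\<^sup>1\<close>. With the identity for \<open>h\<close> and powers for \<open>w\<close> this
gives the moments of the policy, with a clamped entropy for \<open>h\<close> the approximations of its entropy.
\<close>

lemma pol_transform_continuous:
  fixes w h :: "real \<Rightarrow> real"
  assumes w: "set_borel_measurable lborel A w" "\<And>v. v \<in> A \<Longrightarrow> \<bar>w v\<bar> \<le> K"
    and h: "h \<in> borel_measurable borel" "h 0 = 0" "\<And>x x'. 0 \<le> x \<Longrightarrow> 0 \<le> x' \<Longrightarrow> \<bar>h x - h x'\<bar> \<le> \<Lambda> * \<bar>x - x'\<bar>"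
  shows "continuous_on ({0..T} \<times> UNIV) (\<lambda>(t, y). LINT v:A|lborel. w v * h (pol t y v))"
  unfolding continuous_on_def
proof (clarify)
  fix t :: real and y :: state assume t: "t \<in> {0..T}"
  let ?H = "\<lambda>t y. LINT v:A|lborel. w v * h (pol t y v)"
  let ?D = "\<lambda>t' y'. LINT v:A|lborel. \<bar>pol t y v - pol t' y' v\<bar>"
  have bound: "norm (?H t' y' - ?H t y) \<le> K * \<Lambda> * ?D t' y'" if t': "t' \<in> {0..T}" for t' y'
  proof -
    have i: "set_integrable lborel A (\<lambda>v. w v * h (pol t y v))" if "t \<in> {0..T}" for t y
      by (rule pol_transform_integrable[OF w h that])
    have "norm (?H t' y' - ?H t y) = norm (LINT v:A|lborel. w v * h (pol t' y' v) - w v * h (pol t y v))"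
      using i[OF t] i[OF t'] by (simp add: set_integral_diff)
    also have "\<dots> \<le> K * \<Lambda> * ?D t' y'"
    proof (rule set_integral_norm_le)
      show "set_integrable lborel A (\<lambda>v. w v * h (pol t' y' v) - w v * h (pol t y v))"
        using i[OF t] i[OF t'] by (intro set_integral_diff)
      show "set_integrable lborel A (\<lambda>v. \<bar>pol t y v - pol t' y' v\<bar>)" by (rule pol_diff_integrable[OF t t'])
      fix v assume v: "v \<in> A"
      have "\<bar>w v\<bar> * \<bar>h (pol t' y' v) - h (pol t y v)\<bar> \<le> K * (\<Lambda> * \<bar>pol t' y' v - pol t y v\<bar>)"
        using w(2)[OF v] pol_nonneg[OF t v] pol_nonneg[OF t' v] by (intro mult_mono h(3)) auto
      then show "norm (w v * h (pol t' y' v) - w v * h (pol t y v)) \<le> K * \<Lambda> * \<bar>pol t y v - pol t' y' v\<bar>"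
        by (simp add: abs_mult abs_minus_commute mult.assoc flip: right_diff_distrib)
    qed
    finally show ?thesis .
  qed
  have "((\<lambda>(t', y'). ?H t' y' - ?H t y) \<longlongrightarrow> 0) (at (t, y) within {0..T} \<times> UNIV)"
  proof (rule Lim_null_comparison)
    show "eventually (\<lambda>p. norm ((\<lambda>(t', y'). ?H t' y' - ?H t y) p) \<le> K * \<Lambda> * (\<lambda>(t', y'). ?D t' y') p) (at (t, y) within {0..T} \<times> UNIV)"
      unfolding eventually_at_filter using bound by (intro always_eventually) auto
    show "((\<lambda>p. K * \<Lambda> * (\<lambda>(t', y'). ?D t' y') p) \<longlongrightarrow> 0) (at (t, y) within {0..T} \<times> UNIV)"
      using tendsto_mult_left[OF pol_continuous[OF t, of y], of "K * \<Lambda>"] by simp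
  qed
  then show "((\<lambda>(t, y). ?H t y) \<longlongrightarrow> ?H t y) (at (t, y) within {0..T} \<times> UNIV)"
    by (subst LIM_zero_iff[symmetric]) (simp add: case_prod_beta')
qed

context
  fixes B :: "state \<Rightarrow> real \<Rightarrow> state" and C :: real
  assumes B_measurable: "\<And>y. set_borel_measurable lborel A (B y)"
    and B_lipschitz: "\<And>v y y'. v \<in> A \<Longrightarrow> norm (B y v - B y' v) \<le> C * norm (y - y')"
    and B_growth: "\<And>v y. v \<in> A \<Longrightarrow> norm (B y v) \<le> C * (1 + norm y)"
begin

lemma weighted_field_integrable:
  assumes f: "set_borel_measurable lborel A f" "set_integrable lborel A f"
  shows "set_integrable lborel A (\<lambda>v. f v *\<^sub>R B y v)"
proof (rule set_integrable_bound)
  show "set_integrable lborel A (\<lambda>v. C * (1 + norm y) * f v)" using f(2) by auto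
  have [measurable]: "(\<lambda>v. indicator A v * f v) \<in> borel_measurable borel"
    "(\<lambda>v. indicator A v *\<^sub>R B y v) \<in> borel_measurable borel"
    using f B_measurable[of y] by (auto simp: set_borel_measurable_def)
  have "(\<lambda>v. (indicator A v * f v) *\<^sub>R (indicator A v *\<^sub>R B y v)) \<in> borel_measurable borel" by measurable
  also have "(\<lambda>v. (indicator A v * f v) *\<^sub>R (indicator A v *\<^sub>R B y v)) = (\<lambda>v. indicator A v *\<^sub>R (f v *\<^sub>R B y v))"
    by (auto simp: indicator_def)
  finally show "set_borel_measurable lborel A (\<lambda>v. f v *\<^sub>R B y v)" by (simp add: set_borel_measurable_def)
  show "AE v in lborel. v \<in> A \<longrightarrow> norm (f v *\<^sub>R B y v) \<le> norm (C * (1 + norm y) * f v)"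
  proof (intro AE_I2 impI)
    fix v assume v: "v \<in> A"
    have "\<bar>f v\<bar> * norm (B y v) \<le> \<bar>f v\<bar> * \<bar>C * (1 + norm y)\<bar>"
      using B_growth[OF v, of y] by (intro mult_left_mono) auto
    then show "norm (f v *\<^sub>R B y v) \<le> norm (C * (1 + norm y) * f v)" by (simp add: abs_mult mult_ac)
  qed
qed

lemma exploratory_drift_growth:
  assumes t: "t \<in> {0..T}"
  shows "norm (exploratory_drift A (\<lambda>_. B) pol t y) \<le> C * (1 + norm y)"
proof -
  have "norm (LINT v:A|lborel. pol t y v *\<^sub>R B y v) \<le> C * (1 + norm y) * (LINT v:A|lborel. pol t y v)"
  proof (rule set_integral_norm_le)
    show "set_integrable lborel A (\<lambda>v. pol t y v *\<^sub>R B y v)"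
      by (intro weighted_field_integrable pol_measurable pol_integrable t)
    fix v assume v: "v \<in> A"
    show "norm (pol t y v *\<^sub>R B y v) \<le> C * (1 + norm y) * pol t y v"
      using mult_right_mono[OF B_growth[OF v, of y] pol_nonneg[OF t v, of y]] pol_nonneg[OF t v, of y]
      by (simp add: mult.commute)
  qed (rule pol_integrable[OF t])
  then show ?thesis by (simp add: exploratory_drift_def pol_integral[OF t])
qed

text \<open>
The difference is split into a change of the policy at fixed state and a change of the state under a fixed
policy. The first part carries the factor \<open>1 + |y|\<close>, so the averaged field is only locally Lipschitz.
\<close>

lemma exploratory_drift_diff:
  assumes t: "t \<in> {0..T}" and t': "t' \<in> {0..T}"
  shows "norm (exploratory_drift A (\<lambda>_. B) pol t y - exploratory_drift A (\<lambda>_. B) pol t' y') \<le>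
    C * (1 + norm y) * (LINT v:A|lborel. \<bar>pol t y v - pol t' y' v\<bar>) + C * norm (y - y')"
proof -
  have m: "set_borel_measurable lborel A (\<lambda>v. pol t y v - pol t' y' v)"
    using set_integral_diff(1)[OF pol_integrable[OF t, of y] pol_integrable[OF t', of y']]
    by (simp add: set_borel_measurable_def set_integrable_def borel_measurable_integrable del: set_integral_diff)
  have i: "set_integrable lborel A (\<lambda>v. pol t y v *\<^sub>R B y v)" "set_integrable lborel A (\<lambda>v. pol t' y' v *\<^sub>R B y' v)"
    "set_integrable lborel A (\<lambda>v. pol t' y' v *\<^sub>R B y v)"
    by (intro weighted_field_integrable pol_measurable pol_integrable t t')+
  have i1: "set_integrable lborel A (\<lambda>v. (pol t y v - pol t' y' v) *\<^sub>R B y v)"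
    using set_integral_diff(1)[OF i(1) i(3)] by (simp add: scaleR_diff_left)
  have i2: "set_integrable lborel A (\<lambda>v. pol t' y' v *\<^sub>R (B y v - B y' v))"
    using set_integral_diff(1)[OF i(3) i(2)] by (simp add: scaleR_diff_right)
  have "exploratory_drift A (\<lambda>_. B) pol t y - exploratory_drift A (\<lambda>_. B) pol t' y' =
      (LINT v:A|lborel. pol t y v *\<^sub>R B y v - pol t' y' v *\<^sub>R B y' v)"
    unfolding exploratory_drift_def using i by (simp add: set_integral_diff)
  also have "\<dots> = (LINT v:A|lborel. (pol t y v - pol t' y' v) *\<^sub>R B y v + pol t' y' v *\<^sub>R (B y v - B y' v))"
    by (simp add: algebra_simps)
  also have "\<dots> = (LINT v:A|lborel. (pol t y v - pol t' y' v) *\<^sub>R B y v) + (LINT v:A|lborel. pol t' y' v *\<^sub>R (B y v - B y' v))"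
    using i1 i2 by (rule set_integral_add(2))
  also have "norm \<dots> \<le> C * (1 + norm y) * (LINT v:A|lborel. \<bar>pol t y v - pol t' y' v\<bar>) + C * norm (y - y') * (LINT v:A|lborel. pol t' y' v)"
  proof (intro norm_triangle_mono set_integral_norm_le i1 i2 pol_diff_integrable pol_integrable t t')
    fix v assume v: "v \<in> A"
    show "norm ((pol t y v - pol t' y' v) *\<^sub>R B y v) \<le> C * (1 + norm y) * \<bar>pol t y v - pol t' y' v\<bar>"
      using mult_right_mono[OF B_growth[OF v, of y] abs_ge_zero[of "pol t y v - pol t' y' v"]] by (simp add: mult.commute)
    show "norm (pol t' y' v *\<^sub>R (B y v - B y' v)) \<le> C * norm (y - y') * pol t' y' v"
      using mult_right_mono[OF B_lipschitz[OF v, of y y'] pol_nonneg[OF t' v, of y']] pol_nonneg[OF t' v, of y']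
      by (simp add: mult.commute)
  qed
  finally show ?thesis by (simp add: pol_integral[OF t'])
qed

lemma exploratory_drift_field:
  assumes "0 < C"
  shows "locally_lipschitz_field T C (exploratory_drift A (\<lambda>_. B) pol)"
proof
  let ?\<beta> = "exploratory_drift A (\<lambda>_. B) pol"
  show "0 < C" by fact
  show "norm (?\<beta> t y) \<le> C * (1 + norm y)" if "t \<in> {0..T}" for t y
    using that by (rule exploratory_drift_growth)
  obtain C' where C': "C' > 0" "\<And>t y y'. t \<in> {0..T} \<Longrightarrow> (LINT v:A|lborel. \<bar>pol t y v - pol t y' v\<bar>) \<le> C' * norm (y - y')"
    using pol_lipschitz by auto
  show "\<exists>\<Lambda>>0. \<forall>t\<in>{0..T}. \<forall>y y'. norm y \<le> R \<and> norm y' \<le> R \<longrightarrow> norm (?\<beta> t y - ?\<beta> t y') \<le> \<Lambda> * norm (y - y')" for R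
  proof (intro exI[of _ "C * (1 + \<bar>R\<bar>) * C' + C"] conjI ballI allI impI)
    show "0 < C * (1 + \<bar>R\<bar>) * C' + C" using \<open>0 < C\<close> C'(1) by (intro add_pos_pos[OF mult_pos_pos[OF mult_pos_pos]]) (auto intro: add_pos_nonneg)
    fix t and y y' :: state assume t: "t \<in> {0..T}" and y: "norm y \<le> R \<and> norm y' \<le> R"
    have "norm (?\<beta> t y - ?\<beta> t y') \<le> C * (1 + norm y) * (LINT v:A|lborel. \<bar>pol t y v - pol t y' v\<bar>) + C * norm (y - y')"
      by (rule exploratory_drift_diff[OF t t])
    also have "C * (1 + norm y) * (LINT v:A|lborel. \<bar>pol t y v - pol t y' v\<bar>) \<le> C * (1 + \<bar>R\<bar>) * (C' * norm (y - y'))"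
    proof (intro mult_mono C'(2) t)
      show "0 \<le> (LINT v:A|lborel. \<bar>pol t y v - pol t y' v\<bar>)"
        unfolding set_lebesgue_integral_def by (rule Bochner_Integration.integral_nonneg) simp
    qed (use \<open>0 < C\<close> y in auto)
    finally show "norm (?\<beta> t y - ?\<beta> t y') \<le> (C * (1 + \<bar>R\<bar>) * C' + C) * norm (y - y')"
      by (simp add: algebra_simps)
  qed
  show "continuous_on ({0..T} \<times> UNIV) (\<lambda>(t, y). ?\<beta> t y)"
    unfolding continuous_on_def
  proof clarify
    fix t :: real and y :: state assume t: "t \<in> {0..T}"
    let ?D = "\<lambda>t' y'. LINT v:A|lborel. \<bar>pol t y v - pol t' y' v\<bar>"
    have "((\<lambda>(t', y'). ?\<beta> t' y' - ?\<beta> t y) \<longlongrightarrow> 0) (at (t, y) within {0..T} \<times> UNIV)"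
    proof (rule Lim_null_comparison)
      show "eventually (\<lambda>p. norm ((\<lambda>(t', y'). ?\<beta> t' y' - ?\<beta> t y) p) \<le>
           C * (1 + norm y) * (\<lambda>(t', y'). ?D t' y') p + C * norm (y - snd p)) (at (t, y) within {0..T} \<times> UNIV)"
        unfolding eventually_at_filter using exploratory_drift_diff[OF t]
        by (intro always_eventually) (auto simp: norm_minus_commute[of "?\<beta> _ _" "?\<beta> t y"])
      have "((\<lambda>p. C * (1 + norm y) * (\<lambda>(t', y'). ?D t' y') p + C * norm (y - snd p)) \<longlongrightarrow>
          C * (1 + norm y) * 0 + C * norm (y - snd (t, y))) (at (t, y) within {0..T} \<times> UNIV)"
        by (intro tendsto_intros pol_continuous[OF t])
      then show "((\<lambda>p. C * (1 + norm y) * (\<lambda>(t', y'). ?D t' y') p + C * norm (y - snd p)) \<longlongrightarrow> 0) (at (t, y) within {0..T} \<times> UNIV)"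
        by simp
    qed
    then show "((\<lambda>(t, y). ?\<beta> t y) \<longlongrightarrow> ?\<beta> t y) (at (t, y) within {0..T} \<times> UNIV)"
      by (subst LIM_zero_iff[symmetric]) (simp add: case_prod_beta')
  qed
qed

end

context
  fixes \<phi> \<rho> \<gamma> C p :: real
  assumes cost_bound: "\<And>t y. t \<in> {0..T} \<Longrightarrow>
        (\<integral>\<^sup>+v\<in>A. ennreal (\<bar>regularized_cost \<phi> \<rho> \<gamma> pol t y v\<bar> * pol t y v) \<partial>lborel)
          \<le> ennreal (C * (1 + norm y powr p))"
    and C: "0 \<le> C"
begin

lemma cost_integrable:
  assumes t: "t \<in> {0..T}"
  shows "set_integrable lborel A (\<lambda>v. regularized_cost \<phi> \<rho> \<gamma> pol t y v * pol t y v)"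
    and "\<bar>expected_running_cost A \<phi> \<rho> \<gamma> pol t y\<bar> \<le> C * (1 + norm y powr p)"
proof -
  let ?f = "\<lambda>v. indicator A v *\<^sub>R (regularized_cost \<phi> \<rho> \<gamma> pol t y v * pol t y v)"
  have [measurable]: "(\<lambda>v. indicator A v * pol t y v) \<in> borel_measurable borel"
    using pol_measurable[OF t, of y] by (auto simp: set_borel_measurable_def)
  have "(\<lambda>v. (\<phi> * (v - \<rho> * snd (snd (snd y)))\<^sup>2 + \<gamma> * ln (indicator A v * pol t y v)) * (indicator A v * pol t y v)) \<in> borel_measurable borel"
    by measurable
  also have "(\<lambda>v. (\<phi> * (v - \<rho> * snd (snd (snd y)))\<^sup>2 + \<gamma> * ln (indicator A v * pol t y v)) * (indicator A v * pol t y v)) = ?f"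
    by (auto simp: indicator_def regularized_cost_eq)
  finally have m: "?f \<in> borel_measurable lborel" by simp
  have nn: "(\<integral>\<^sup>+v. ennreal (norm (?f v)) \<partial>lborel) \<le> ennreal (C * (1 + norm y powr p))"
    using cost_bound[OF t, of y]
    by (rule order_trans[rotated], intro nn_integral_mono)
       (auto simp: indicator_def abs_mult pol_nonneg[OF t])
  then have i: "integrable lborel ?f"
    using m by (intro integrableI_bounded) (auto intro: le_less_trans)
  then show "set_integrable lborel A (\<lambda>v. regularized_cost \<phi> \<rho> \<gamma> pol t y v * pol t y v)"
    by (simp add: set_integrable_def)
  have "ennreal (norm (integral\<^sup>L lborel ?f)) \<le> ennreal (C * (1 + norm y powr p))"
    using integral_norm_bound_ennreal[OF i] nn by (rule order_trans)
  then show "\<bar>expected_running_cost A \<phi> \<rho> \<gamma> pol t y\<bar> \<le> C * (1 + norm y powr p)"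
    using C by (simp add: expected_running_cost_def set_lebesgue_integral_def ennreal_le_iff)
qed

text \<open>
On a bounded action space the quadratic part of the cost is a continuous combination of the moments of
order 0 to 2 of the policy. Subtracting it shows that the entropy part is integrable, which provides the
dominating function for its approximation by clamped entropies.
\<close>

lemma expected_running_cost_measurable:
  assumes A_bounded: "\<And>v. v \<in> A \<Longrightarrow> \<bar>v\<bar> \<le> K"
  shows "(\<lambda>(t, y). indicator {0..T} t *\<^sub>R expected_running_cost A \<phi> \<rho> \<gamma> pol t y) \<in> borel_measurable borel"
proof -
  let ?E = "\<lambda>t y. expected_running_cost A \<phi> \<rho> \<gamma> pol t y"
  \<comment> \<open>the moments of the policy\<close>
  define M where "M i t y = (LINT v:A|lborel. v ^ i * pol t y v)" for i :: nat and t and y :: state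
  have wm: "set_borel_measurable lborel A (\<lambda>v. v ^ i)" for i :: nat
    using action_space by (auto simp: set_borel_measurable_def)
  have wb: "\<bar>v ^ i\<bar> \<le> K ^ i" if "v \<in> A" for v and i :: nat
    using A_bounded[OF that] by (simp add: power_abs power_mono)
  have Mi: "set_integrable lborel A (\<lambda>v. v ^ i * pol t y v)" if "t \<in> {0..T}" for i t y
    using pol_transform_integrable[where h = "\<lambda>x. x" and \<Lambda> = 1, OF wm wb _ _ _ that] by simp
  have Mc: "continuous_on ({0..T} \<times> UNIV) (\<lambda>(t, y). M i t y)" for i
    unfolding M_def using pol_transform_continuous[where h = "\<lambda>x. x" and \<Lambda> = 1, OF wm wb] by simp
  have gm: "set_borel_measurable lborel A (\<lambda>v. \<gamma>)" using action_space by (auto simp: set_borel_measurable_def)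
  define H where "H n t y = (LINT v:A|lborel. \<gamma> * clamped_entropy n (pol t y v))" for n t y
  have ce0: "clamped_entropy n 0 = 0" for n by (simp add: clamped_entropy_def)
  have Hc: "continuous_on ({0..T} \<times> UNIV) (\<lambda>(t, y). H n t y)" for n
    unfolding H_def
    by (rule pol_transform_continuous[where K = "\<bar>\<gamma>\<bar>", OF gm _ clamped_entropy_measurable ce0 clamped_entropy_lipschitz]) auto
  have Hi: "set_integrable lborel A (\<lambda>v. \<gamma> * clamped_entropy n (pol t y v))" if "t \<in> {0..T}" for n t y
    by (rule pol_transform_integrable[where K = "\<bar>\<gamma>\<bar>", OF gm _ clamped_entropy_measurable ce0 clamped_entropy_lipschitz that]) auto
  let ?q = "\<lambda>y :: state. \<rho> * snd (snd (snd y))"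
  let ?Q = "\<lambda>t y. \<phi> * M 2 t y - 2 * \<phi> * ?q y * M 1 t y + \<phi> * (?q y)\<^sup>2 * M 0 t y"
  have quadi: "set_integrable lborel A (\<lambda>v. \<phi> * (v - ?q y)\<^sup>2 * pol t y v)"
    and quad: "(LINT v:A|lborel. \<phi> * (v - ?q y)\<^sup>2 * pol t y v) = ?Q t y" if t: "t \<in> {0..T}" for t y
  proof -
    have eq: "\<phi> * (v - ?q y)\<^sup>2 * pol t y v =
        \<phi> * (v ^ 2 * pol t y v) - 2 * \<phi> * ?q y * (v ^ 1 * pol t y v) + \<phi> * (?q y)\<^sup>2 * (v ^ 0 * pol t y v)" for v
      by (simp add: power2_eq_square algebra_simps)
    have i: "set_integrable lborel A (\<lambda>v. \<phi> * (v ^ 2 * pol t y v))"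
      "set_integrable lborel A (\<lambda>v. 2 * \<phi> * ?q y * (v ^ 1 * pol t y v))"
      "set_integrable lborel A (\<lambda>v. \<phi> * (?q y)\<^sup>2 * (v ^ 0 * pol t y v))"
      by (intro set_integrable_mult_right Mi[OF t])+
    note i12 = set_integral_diff[OF i(1) i(2)]
    show "set_integrable lborel A (\<lambda>v. \<phi> * (v - ?q y)\<^sup>2 * pol t y v)"
      unfolding eq by (rule set_integral_add(1)[OF i12(1) i(3)])
    show "(LINT v:A|lborel. \<phi> * (v - ?q y)\<^sup>2 * pol t y v) = ?Q t y"
      unfolding eq set_integral_add(2)[OF i12(1) i(3)] i12(2) set_integral_mult_right M_def ..
  qed
  have ent: "set_integrable lborel A (\<lambda>v. \<gamma> * (pol t y v * ln (pol t y v)))"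
    and split: "?E t y = ?Q t y + (LINT v:A|lborel. \<gamma> * (pol t y v * ln (pol t y v)))" if t: "t \<in> {0..T}" for t y
  proof -
    have eq: "regularized_cost \<phi> \<rho> \<gamma> pol t y v * pol t y v - \<phi> * (v - ?q y)\<^sup>2 * pol t y v = \<gamma> * (pol t y v * ln (pol t y v))" for v
      unfolding regularized_cost_eq by (simp add: algebra_simps)
    note d = set_integral_diff[OF cost_integrable(1)[OF t, of y] quadi[OF t, of y]]
    show "set_integrable lborel A (\<lambda>v. \<gamma> * (pol t y v * ln (pol t y v)))"
      using d(1) unfolding eq .
    show "?E t y = ?Q t y + (LINT v:A|lborel. \<gamma> * (pol t y v * ln (pol t y v)))"
      using d(2) unfolding eq quad[OF t] expected_running_cost_def by simp
  qed
  have lim: "(\<lambda>n. H n t y) \<longlonglongrightarrow> (LINT v:A|lborel. \<gamma> * (pol t y v * ln (pol t y v)))" if t: "t \<in> {0..T}" for t y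
    unfolding H_def set_lebesgue_integral_def
  proof (rule integral_dominated_convergence)
    show "integrable lborel (\<lambda>v. norm (indicator A v *\<^sub>R (\<gamma> * (pol t y v * ln (pol t y v)))))"
      using ent[OF t, of y] unfolding set_integrable_def by (rule integrable_norm)
    show "(\<lambda>v. indicator A v *\<^sub>R (\<gamma> * (pol t y v * ln (pol t y v)))) \<in> borel_measurable lborel"
      using ent[OF t, of y] unfolding set_integrable_def by (rule borel_measurable_integrable)
    show "(\<lambda>v. indicator A v *\<^sub>R (\<gamma> * clamped_entropy n (pol t y v))) \<in> borel_measurable lborel" for n
      using Hi[OF t, of n y] unfolding set_integrable_def by (rule borel_measurable_integrable)
    show "AE v in lborel. (\<lambda>n. indicator A v *\<^sub>R (\<gamma> * clamped_entropy n (pol t y v))) \<longlonglongrightarrow> indicator A v *\<^sub>R (\<gamma> * (pol t y v * ln (pol t y v)))"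
      by (intro AE_I2 tendsto_intros clamped_entropy_tendsto)
    show "AE v in lborel. norm (indicator A v *\<^sub>R (\<gamma> * clamped_entropy n (pol t y v))) \<le> norm (indicator A v *\<^sub>R (\<gamma> * (pol t y v * ln (pol t y v))))" for n
      using clamped_entropy_le by (intro AE_I2) (auto simp: abs_mult[of \<gamma>] abs_mult[of "indicator A _"] intro!: mult_left_mono)
  qed
  have "(\<lambda>p. indicator ({0..T} \<times> UNIV) p *\<^sub>R (case p of (t, y) \<Rightarrow> ?E t y)) \<in> borel_measurable borel"
  proof (rule borel_measurable_LIMSEQ_metric)
    show "(\<lambda>p. indicator ({0..T} \<times> UNIV) p *\<^sub>R (case p of (t, y) \<Rightarrow> ?Q t y + H n t y)) \<in> borel_measurable borel" for n
    proof (rule borel_measurable_continuous_on_indicator)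
      show "continuous_on ({0..T} \<times> UNIV) (\<lambda>(t, y). ?Q t y + H n t y)"
        using Mc[of 0] Mc[of 1] Mc[of 2] Hc[of n] unfolding case_prod_beta'
        by (intro continuous_intros)
    qed (intro borel_closed closed_Times closed_atLeastAtMost closed_UNIV)
    show "(\<lambda>n. indicator ({0..T} \<times> UNIV) p *\<^sub>R (case p of (t, y) \<Rightarrow> ?Q t y + H n t y)) \<longlonglongrightarrow>
        indicator ({0..T} \<times> UNIV) p *\<^sub>R (case p of (t, y) \<Rightarrow> ?E t y)" for p
    proof (cases "p \<in> {0..T} \<times> UNIV")
      case True
      then obtain t y where p: "p = (t, y)" "t \<in> {0..T}" by auto
      show ?thesis unfolding p(1) prod.case split[OF p(2)]
        by (intro tendsto_intros lim[OF p(2)])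
    qed auto
  qed
  also have "(\<lambda>p. indicator ({0..T} \<times> UNIV) p *\<^sub>R (case p of (t, y) \<Rightarrow> ?E t y)) =
      (\<lambda>(t, y). indicator {0..T} t *\<^sub>R ?E t y)"
    by (auto simp: indicator_def)
  finally show ?thesis .
qed

end

end


section \<open>Strong solutions, moment bounds and the value function\<close>

lemma generated_algebra_measurable:
  assumes "i \<in> I" "\<And>i. i \<in> I \<Longrightarrow> X i \<in> space M \<rightarrow> space K"
  shows "X i \<in> measurable (generated_algebra M I K X) K"
proof -
  have "(\<lambda>\<omega>. \<lambda>i\<in>I. X i \<omega>) \<in> measurable (generated_algebra M I K X) (Pi\<^sub>M I (\<lambda>_. K))"
    unfolding generated_algebra_def
    using assms(2) by (intro measurable_vimage_algebra1) (auto simp: space_PiM PiE_def Pi_def)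
  from measurable_compose[OF this measurable_component_singleton[OF assms(1)]]
  show ?thesis using assms(1) by simp
qed

lemma generated_algebra_subset:
  assumes "space F = space M" "\<And>i. i \<in> I \<Longrightarrow> X i \<in> measurable F K"
  shows "sets (generated_algebra M I K X) \<subseteq> sets F"
  unfolding generated_algebra_def using assms
  by (intro sets_image_in_sets measurable_restrict) auto

lemma generated_algebra_Pow: "sets (generated_algebra M I K X) \<subseteq> Pow (space M)"
  using sets.space_closed[of "generated_algebra M I K X"] by (simp add: generated_algebra_def)

lemma space_noise_filtration [simp]: "space (noise_filtration M W N \<eta> t) = space M"
  by (simp add: noise_filtration_def space_measure_of_conv)

lemma sets_noise_filtration:
  "sets (noise_filtration M W N \<eta> t) = sigma_sets (space M)
     (sets (generated_algebra M {0..t} borel W) \<union>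
      sets (generated_algebra M {0..t} (count_space UNIV) N) \<union>
      sets (generated_algebra M ({0..t} \<times> {1..}) borel
        (\<lambda>(s, m) \<omega>. if m \<le> N s \<omega> then \<eta> m \<omega> else 0)))"
  unfolding noise_filtration_def
  by (intro sets_measure_of Un_least generated_algebra_Pow)

text \<open>
The last clause is the form in which a mark is revealed: its value is known from the time at which the
count reaches its index.
\<close>

lemma noise_filtration_measurable:
  assumes "s \<in> {0..t}"
  shows "W s \<in> borel_measurable (noise_filtration M W N \<eta> t)"
    and "N s \<in> measurable (noise_filtration M W N \<eta> t) (count_space UNIV)"
    and "1 \<le> j \<Longrightarrow> (\<lambda>\<omega>. if j \<le> N s \<omega> then \<eta> j \<omega> else 0) \<in> borel_measurable (noise_filtration M W N \<eta> t)"
proof -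
  let ?F = "noise_filtration M W N \<eta> t"
  have mono: "f \<in> measurable ?F K" if "f \<in> measurable (generated_algebra M I K' X) K"
    "sets (generated_algebra M I K' X) \<subseteq> sets ?F" for f I X and K :: "'c measure" and K' :: "'d measure"
    using that by (auto simp: measurable_def generated_algebra_def)
  have sub: "sets (generated_algebra M {0..t} borel W) \<subseteq> sets ?F"
    "sets (generated_algebra M {0..t} (count_space UNIV) N) \<subseteq> sets ?F"
    "sets (generated_algebra M ({0..t} \<times> {1..}) borel (\<lambda>(s, m) \<omega>. if m \<le> N s \<omega> then \<eta> m \<omega> else 0)) \<subseteq> sets ?F"
    unfolding sets_noise_filtration by (auto intro: sigma_sets.Basic)
  show "W s \<in> borel_measurable ?F"
    by (rule mono[OF generated_algebra_measurable sub(1)]) (use assms in auto)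
  show "N s \<in> measurable ?F (count_space UNIV)"
    by (rule mono[OF generated_algebra_measurable sub(2)]) (use assms in auto)
  assume "1 \<le> j"
  then have j: "(s, j) \<in> {0..t} \<times> {1..}" using assms by auto
  have "(\<lambda>(s, m) \<omega>. if m \<le> N s \<omega> then \<eta> m \<omega> else 0) (s, j) \<in> borel_measurable ?F"
    by (rule mono[OF generated_algebra_measurable[OF j] sub(3)]) auto
  then show "(\<lambda>\<omega>. if j \<le> N s \<omega> then \<eta> j \<omega> else 0) \<in> borel_measurable ?F" by simp
qed

lemma noise_filtration_subset:
  assumes "space F = space M"
    and "\<And>s. s \<in> {0..t} \<Longrightarrow> W s \<in> borel_measurable F"
    and "\<And>s. s \<in> {0..t} \<Longrightarrow> N s \<in> measurable F (count_space UNIV)"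
    and "\<And>s j. s \<in> {0..t} \<Longrightarrow> 1 \<le> j \<Longrightarrow> (\<lambda>\<omega>. if j \<le> N s \<omega> then \<eta> j \<omega> else 0) \<in> borel_measurable F"
  shows "sets (noise_filtration M W N \<eta> t) \<subseteq> sets F"
  unfolding sets_noise_filtration assms(1)[symmetric]
proof (rule sets.sigma_sets_subset, intro Un_least)
  show "sets (generated_algebra M {0..t} borel W) \<subseteq> sets F"
    using assms(1,2) by (rule generated_algebra_subset)
  show "sets (generated_algebra M {0..t} (count_space UNIV) N) \<subseteq> sets F"
    using assms(1,3) by (rule generated_algebra_subset)
  show "sets (generated_algebra M ({0..t} \<times> {1..}) borel (\<lambda>(s, m) \<omega>. if m \<le> N s \<omega> then \<eta> m \<omega> else 0)) \<subseteq> sets F"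
    using assms(1,4) by (intro generated_algebra_subset) auto
qed

lemma noise_filtration_filtration: "filtration (space M) (noise_filtration M W N \<eta>)"
proof
  show "sets (noise_filtration M W N \<eta> s) \<subseteq> sets (noise_filtration M W N \<eta> t)" if "s \<le> t" for s t
    using that by (intro noise_filtration_subset noise_filtration_measurable) auto
qed simp

lemma noise_filtration_subset_measure:
  assumes "driving_noise M lam \<nu> W N \<eta>"
  shows "sets (noise_filtration M W N \<eta> t) \<subseteq> sets M"
proof (rule noise_filtration_subset)
  have W: "brownian_motion M W" and N: "poisson_process M lam N" and iid: "iid_marks M \<nu> \<eta>" and P: "prob_space M"
    using assms by (auto simp: driving_noise_def)
  show "W s \<in> borel_measurable M" if "s \<in> {0..t}" for s
    using W that by (auto simp: brownian_motion_def)
  show Nm: "N s \<in> measurable M (count_space UNIV)" if "s \<in> {0..t}" for s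
    using N that by (auto simp: poisson_process_def)
  show "(\<lambda>\<omega>. if j \<le> N s \<omega> then \<eta> j \<omega> else 0) \<in> borel_measurable M" if "s \<in> {0..t}" "1 \<le> j" for s j
  proof -
    have [measurable]: "\<eta> j \<in> borel_measurable M" "N s \<in> measurable M (count_space UNIV)"
      using iid P that Nm by (auto simp: iid_marks_def prob_space.indep_vars_def2)
    show ?thesis by measurable
  qed
qed simp

lemma powr_le_one_plus_power:
  fixes x p :: real
  assumes "0 \<le> x" "0 \<le> p" "p \<le> real n"
  shows "x powr p \<le> 1 + x ^ n"
proof (cases "x \<le> 1")
  case True
  then have "x powr p \<le> 1" using assms by (intro powr_le1) auto
  then show ?thesis using assms(1) by (simp add: add_increasing2)
next
  case False
  then have "x powr p \<le> x powr real n" using assms by (intro powr_mono) auto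
  then show ?thesis using False by (simp add: powr_realpow)
qed

lemma jump_measurable: "jump \<in> borel_measurable borel"
proof -
  have "continuous_on UNIV jump" unfolding jump_def[abs_def] by (intro continuous_intros)
  then show ?thesis by (rule borel_measurable_continuous_onI)
qed

text \<open>
Results on strong solutions hold for every locally Lipschitz field of linear growth, whether or not it comes
from a policy.
\<close>

locale noisy_field = locally_lipschitz_field T L \<beta> for T L and \<beta> :: "real \<Rightarrow> state \<Rightarrow> state" +
  fixes M :: "'a measure" and W :: "real \<Rightarrow> 'a \<Rightarrow> real" and N :: "real \<Rightarrow> 'a \<Rightarrow> nat" and \<eta> :: "nat \<Rightarrow> 'a \<Rightarrow> real"
    and \<nu> :: "real measure" and lam \<sigma> :: real
  assumes noise: "driving_noise M lam \<nu> W N \<eta>"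
    and lam_pos: "0 < lam" and T_pos: "0 < T"
    and mark_moments: "\<And>n::nat. integrable \<nu> (\<lambda>x. x ^ n)"
begin

abbreviation "F \<equiv> noise_filtration M W N \<eta>"
abbreviation "strong t y Y \<equiv> strong_solution M W N \<eta> \<beta> \<sigma> T t y Y"
abbreviation "driver t s \<omega> \<equiv> sde_noise W N \<eta> \<sigma> t s \<omega>"

lemma W: "brownian_motion M W" and N: "poisson_process M lam N" and prob: "prob_space M"
  using noise by (auto simp: driving_noise_def)

lemma adapted_imp_measurable: "f \<in> measurable (F t) K \<Longrightarrow> f \<in> measurable M K"
  using noise_filtration_subset_measure[OF noise, of t] by (auto simp: measurable_def)

lemma driver_adapted:
  assumes "0 \<le> t" "t \<le> s"
  shows "driver t s \<in> borel_measurable (F s)"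
proof -
  have [measurable]: "W s \<in> borel_measurable (F s)" "W t \<in> borel_measurable (F s)"
    using assms by (auto intro: noise_filtration_measurable(1))
  have [measurable]: "(\<lambda>\<omega>. counting_integral (\<lambda>u. (\<lambda>j \<omega>. jump (\<eta> j \<omega>)) (1 + left_limit (\<lambda>r. N r \<omega>) u) \<omega>) (\<lambda>r. N r \<omega>) t s)
      \<in> borel_measurable (F s)"
  proof (rule counting_integral_measurable[OF _ assms])
    show "counting_path (\<lambda>r. N r \<omega>)" if "\<omega> \<in> space (F s)" for \<omega>
      using that by (intro poisson_counting_path[OF N]) simp
    show "N r \<in> measurable (F s) (count_space UNIV)" if "r \<in> {t..s}" for r
      using that assms by (intro noise_filtration_measurable) auto
    fix j :: nat assume "1 \<le> j"
    then have "(\<lambda>\<omega>. if j \<le> N s \<omega> then \<eta> j \<omega> else 0) \<in> borel_measurable (F s)"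
      using assms by (intro noise_filtration_measurable) auto
    from measurable_compose[OF this jump_measurable]
    show "(\<lambda>\<omega>. if j \<le> N s \<omega> then jump (\<eta> j \<omega>) else 0) \<in> borel_measurable (F s)"
      by (rule back_subst[of "\<lambda>f. f \<in> borel_measurable (F s)"]) (auto simp: fun_eq_iff jump_def zero_prod_def)
  qed
  show ?thesis unfolding sde_noise_def[abs_def] by measurable
qed

lemma driver_cadlag:
  assumes "0 \<le> t" "\<omega> \<in> space M"
  shows "cadlag_on t T (\<lambda>s. driver t s \<omega>)"
proof -
  interpret counting_path "\<lambda>r. N r \<omega>" using poisson_counting_path[OF N assms(2)] .
  have Wc: "continuous_on {0..} (\<lambda>s. W s \<omega>)" using W assms(2) by (auto simp: brownian_motion_def)
  let ?c = "\<lambda>s. counting_integral (\<lambda>u. jump (\<eta> (1 + left_limit (\<lambda>r. N r \<omega>) u) \<omega>)) (\<lambda>r. N r \<omega>) t s"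
  have c: "cadlag_on t T ?c" by (rule counting_integral_cadlag[OF assms(1)])
  show ?thesis
    unfolding cadlag_on_def sde_noise_def
  proof (intro conjI ballI)
    fix s assume s: "s \<in> {t..<T}"
    have "continuous_on {s..T} (\<lambda>s. W s \<omega>)" using s assms(1) by (auto intro: continuous_on_subset[OF Wc])
    then have "((\<lambda>s. W s \<omega>) \<longlongrightarrow> W s \<omega>) (at_right s)" using s by (auto intro: continuous_on_Icc_at_rightD)
    moreover have "(?c \<longlongrightarrow> ?c s) (at_right s)" using c s by (auto simp: cadlag_on_def)
    ultimately show "((\<lambda>s. (W s \<omega> - W t \<omega>) *\<^sub>R diffusion \<sigma> + ?c s) \<longlongrightarrow> (W s \<omega> - W t \<omega>) *\<^sub>R diffusion \<sigma> + ?c s) (at_right s)"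
      by (intro tendsto_intros)
  next
    fix s assume s: "s \<in> {t<..T}"
    have "continuous_on {t..s} (\<lambda>s. W s \<omega>)" using s assms(1) by (auto intro: continuous_on_subset[OF Wc])
    then have "((\<lambda>s. W s \<omega>) \<longlongrightarrow> W s \<omega>) (at_left s)" using s by (auto intro: continuous_on_Icc_at_leftD)
    moreover obtain l where "(?c \<longlongrightarrow> l) (at_left s)" using c s unfolding cadlag_on_def by blast
    ultimately have "((\<lambda>s. (W s \<omega> - W t \<omega>) *\<^sub>R diffusion \<sigma> + ?c s) \<longlongrightarrow> (W s \<omega> - W t \<omega>) *\<^sub>R diffusion \<sigma> + l) (at_left s)"
      by (intro tendsto_intros)
    then show "\<exists>l. ((\<lambda>s. (W s \<omega> - W t \<omega>) *\<^sub>R diffusion \<sigma> + ?c s) \<longlongrightarrow> l) (at_left s)" ..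
  qed
qed

lemma driver_bounded:
  assumes "0 \<le> t" "\<omega> \<in> space M"
  shows "\<exists>G. \<forall>s\<in>{t..T}. norm (driver t s \<omega>) \<le> G"
proof -
  interpret counting_path "\<lambda>r. N r \<omega>" using poisson_counting_path[OF N assms(2)] .
  have "continuous_on {t..T} (\<lambda>s. (W s \<omega> - W t \<omega>) *\<^sub>R diffusion \<sigma>)"
  proof -
    have "continuous_on {0..} (\<lambda>s. W s \<omega>)" using W assms(2) by (auto simp: brownian_motion_def)
    then have "continuous_on {t..T} (\<lambda>s. W s \<omega>)" by (rule continuous_on_subset) (use assms(1) in auto)
    then show ?thesis by (intro continuous_intros)
  qed
  then have "compact ((\<lambda>s. (W s \<omega> - W t \<omega>) *\<^sub>R diffusion \<sigma>) ` {t..T})"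
    by (rule compact_continuous_image) simp
  then have "bounded ((\<lambda>s. (W s \<omega> - W t \<omega>) *\<^sub>R diffusion \<sigma>) ` {t..T})"
    by (rule compact_imp_bounded)
  then obtain G where G: "\<And>s. s \<in> {t..T} \<Longrightarrow> norm ((W s \<omega> - W t \<omega>) *\<^sub>R diffusion \<sigma>) \<le> G"
    unfolding bounded_iff by blast
  show ?thesis
  proof (intro exI ballI)
    fix s assume s: "s \<in> {t..T}"
    show "norm (driver t s \<omega>) \<le> G + real (N T \<omega>) * (\<Sum>j=1..N T \<omega>. norm (jump (\<eta> j \<omega>)))"
      unfolding sde_noise_def
      using s assms by (intro norm_triangle_mono G counting_integral_bound[of t s T "\<lambda>j. jump (\<eta> j \<omega>)"]) auto
  qed
qed

lemma strong_solution_exists: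
  assumes "0 \<le> t"
  shows "\<exists>Y. strong t y Y"
proof -
  have "\<exists>x. (\<forall>s\<in>{t..T}. x s \<in> borel_measurable (F s)) \<and>
     (\<forall>\<omega>\<in>space M. cadlag_on t T (\<lambda>s. x s \<omega>) \<and> driven_solution t y (\<lambda>s. driver t s \<omega>) (\<lambda>s. x s \<omega>))"
    by (rule adapted_solution_exists[OF noise_filtration_filtration assms])
       (use assms in \<open>auto intro: driver_adapted driver_cadlag driver_bounded\<close>)
  then obtain Y where Y: "\<And>s. s \<in> {t..T} \<Longrightarrow> Y s \<in> borel_measurable (F s)"
    "\<And>\<omega>. \<omega> \<in> space M \<Longrightarrow> cadlag_on t T (\<lambda>s. Y s \<omega>)"
    "\<And>\<omega>. \<omega> \<in> space M \<Longrightarrow> driven_solution t y (\<lambda>s. driver t s \<omega>) (\<lambda>s. Y s \<omega>)" by blast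
  have "strong t y Y"
    unfolding strong_solution_def sde_solution_def
    using Y by (auto simp: driven_solution_def sde_noise_def add.assoc intro!: AE_I2)
  then show ?thesis by blast
qed

lemma strong_solution_adapted:
  assumes "strong t y Y" "u \<in> {t..T}"
  shows "Y u \<in> borel_measurable (F T)"
proof (rule filtration_measurable_mono[OF noise_filtration_filtration])
  show "u \<le> T" using assms(2) by simp
  show "Y u \<in> borel_measurable (F u)" using assms by (simp add: strong_solution_def sde_solution_def)
qed

lemma strong_solution_right_continuous:
  assumes "strong t y Y" "\<omega> \<in> space M" "u \<in> {t..<T}"
  shows "((\<lambda>r. Y r \<omega>) \<longlongrightarrow> Y u \<omega>) (at_right u)"
  using assms unfolding strong_solution_def sde_solution_def cadlag_on_def by blast

lemma strong_solution_paths: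
  assumes "strong t y Y"
  shows "\<And>\<omega>. \<omega> \<in> space M \<Longrightarrow> set_borel_measurable lborel {t..T} (\<lambda>s. Y s \<omega>)"
    and "AE \<omega> in M. driven_solution t y (\<lambda>s. driver t s \<omega>) (\<lambda>s. Y s \<omega>)"
proof -
  show "set_borel_measurable lborel {t..T} (\<lambda>s. Y s \<omega>)" if "\<omega> \<in> space M" for \<omega>
    by (rule adapted_path_measurable[where F = "F T"])
       (use that in \<open>auto intro: strong_solution_adapted[OF assms] strong_solution_right_continuous[OF assms]\<close>)
  have "AE \<omega> in M. set_integrable lborel {t..T} (\<lambda>u. \<beta> u (Y u \<omega>)) \<and>
        (\<forall>s\<in>{t..T}. Y s \<omega> = y + (LINT u:{t..s}|lborel. \<beta> u (Y u \<omega>))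
           + (W s \<omega> - W t \<omega>) *\<^sub>R diffusion \<sigma>
           + counting_integral (\<lambda>u. jump (\<eta> (1 + left_limit (\<lambda>r. N r \<omega>) u) \<omega>)) (\<lambda>r. N r \<omega>) t s)"
    using assms by (simp add: strong_solution_def sde_solution_def)
  then show "AE \<omega> in M. driven_solution t y (\<lambda>s. driver t s \<omega>) (\<lambda>s. Y s \<omega>)"
    by eventually_elim (simp add: driven_solution_def sde_noise_def add.assoc)
qed

lemma strong_solutions_agree:
  assumes "0 \<le> t" "strong t y Y" "strong t y Y'"
  shows "AE \<omega> in M. \<forall>s\<in>{t..T}. Y' s \<omega> = Y s \<omega>"
  using strong_solution_paths(2)[OF assms(2)] strong_solution_paths(2)[OF assms(3)] AE_space
proof eventually_elim
  case (elim \<omega>)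
  obtain G where G: "\<And>s. s \<in> {t..T} \<Longrightarrow> norm (driver t s \<omega>) \<le> G"
    using driver_bounded[OF assms(1) elim(3)] by blast
  show ?case
    using driven_solution_unique[OF assms(1) elim(2) strong_solution_paths(1)[OF assms(3) elim(3)]
        elim(1) strong_solution_paths(1)[OF assms(2) elim(3)] G] by blast
qed

lemma strong_solution_unique:
  assumes "0 \<le> t"
  shows "unique_strong_solution M W N \<eta> \<beta> \<sigma> T t y"
  unfolding unique_strong_solution_def
  using strong_solution_exists[OF assms] strong_solutions_agree[OF assms] by blast

text \<open>
Every strong solution, whatever its starting time and state, obeys one linear bound with the same random
variable \<open>X\<close>. The moment bound and the integrability of payoffs both rest on this.
\<close>

lemma strong_solution_dominated:
  assumes "2 \<le> m"
  obtains X K where "X \<in> borel_measurable M" "\<And>\<omega>. 0 \<le> X \<omega>" "integrable M (\<lambda>\<omega>. X \<omega> ^ (2 * m))" "0 < K"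
    "\<And>t y Y. t \<in> {0..T} \<Longrightarrow> strong t y Y \<Longrightarrow> AE \<omega> in M. \<forall>s\<in>{t..T}. norm (Y s \<omega>) \<le> K * (norm y + X \<omega>)"
proof -
  obtain X where X: "X \<in> borel_measurable M" "\<And>\<omega>. 0 \<le> X \<omega>" "integrable M (\<lambda>\<omega>. X \<omega> ^ (2 * m))"
    "AE \<omega> in M. \<forall>t\<in>{0..T}. \<forall>s\<in>{t..T}. norm (driver t s \<omega>) \<le> X \<omega>"
    using sde_noise_moment[OF noise lam_pos T_pos assms mark_moments] by blast
  interpret prob_space M by (rule prob)
  define K where "K = 2 * exp (2 * L * T)"
  have LT: "0 \<le> L * T" using L_pos T_pos by simp
  have int: "integrable M (\<lambda>\<omega>. (L * T + X \<omega>) ^ (2 * m))"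
  proof (rule Bochner_Integration.integrable_bound)
    show "integrable M (\<lambda>\<omega>. 2 ^ (2 * m) * ((L * T) ^ (2 * m) + X \<omega> ^ (2 * m)))" using X(3) by auto
    show "(\<lambda>\<omega>. (L * T + X \<omega>) ^ (2 * m)) \<in> borel_measurable M" using X(1) by measurable
    show "AE \<omega> in M. norm ((L * T + X \<omega>) ^ (2 * m)) \<le> norm (2 ^ (2 * m) * ((L * T) ^ (2 * m) + X \<omega> ^ (2 * m)))"
    proof (rule AE_I2)
      fix \<omega>
      have "\<bar>(L * T + X \<omega>) ^ (2 * m)\<bar> = (L * T + X \<omega>) ^ (2 * m)" using LT X(2)[of \<omega>] by simp
      also have "\<dots> \<le> 2 ^ (2 * m) * ((L * T) ^ (2 * m) + X \<omega> ^ (2 * m))" by (rule add_power_le[OF LT X(2)])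
      finally show "norm ((L * T + X \<omega>) ^ (2 * m)) \<le> norm (2 ^ (2 * m) * ((L * T) ^ (2 * m) + X \<omega> ^ (2 * m)))"
        unfolding real_norm_def by (rule order_trans[OF _ abs_ge_self])
    qed
  qed
  have dom: "AE \<omega> in M. \<forall>s\<in>{t..T}. norm (Y s \<omega>) \<le> K * (norm y + (L * T + X \<omega>))"
    if t: "t \<in> {0..T}" and Y: "strong t y Y" for t y Y
    using X(4) strong_solution_paths(2)[OF Y] AE_space
  proof eventually_elim
    case (elim \<omega>)
    show ?case
    proof
      fix s assume s: "s \<in> {t..T}"
      have "norm (Y s \<omega>) \<le> 2 * (norm y + L * T + X \<omega>) * exp (2 * L * (s - t))"
        by (rule driven_solution_growth[OF _ elim(2) strong_solution_paths(1)[OF Y elim(3)] _ s])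
           (use t elim(1) in auto)
      also have "\<dots> \<le> 2 * (norm y + L * T + X \<omega>) * exp (2 * L * T)"
        using s t L_pos X(2)[of \<omega>] LT by (intro mult_left_mono) auto
      also have "\<dots> = K * (norm y + (L * T + X \<omega>))" by (simp add: K_def mult_ac add_ac)
      finally show "norm (Y s \<omega>) \<le> K * (norm y + (L * T + X \<omega>))" .
    qed
  qed
  have meas: "(\<lambda>\<omega>. L * T + X \<omega>) \<in> borel_measurable M" using X(1) by measurable
  have nonneg: "0 \<le> L * T + X \<omega>" for \<omega> using LT X(2)[of \<omega>] by simp
  have "0 < K" by (simp add: K_def)
  show ?thesis by (rule that[OF meas nonneg int \<open>0 < K\<close> dom])
qed

lemma strong_solution_moment_bound:
  assumes "2 \<le> p"
  shows "\<exists>C>0. \<forall>t\<in>{0..T}. \<forall>y Y. strong t y Y \<longrightarrow>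
    (\<integral>\<^sup>+\<omega>. (SUP s\<in>{t..T}. ennreal (norm (Y s \<omega>) powr p)) \<partial>M) \<le> ennreal (C * (1 + norm y powr p))"
proof -
  define m where "m = nat \<lceil>p\<rceil>"
  have m: "2 \<le> m" "p \<le> real (2 * m)" using assms unfolding m_def by linarith+
  obtain X K where X: "X \<in> borel_measurable M" "\<And>\<omega>. 0 \<le> X \<omega>" "integrable M (\<lambda>\<omega>. X \<omega> ^ (2 * m))" "0 < K"
    "\<And>t y Y. t \<in> {0..T} \<Longrightarrow> strong t y Y \<Longrightarrow> AE \<omega> in M. \<forall>s\<in>{t..T}. norm (Y s \<omega>) \<le> K * (norm y + X \<omega>)"
    using strong_solution_dominated[OF m(1)] by blast
  interpret prob_space M by (rule prob)
  define c where "c = (2 * K) powr p"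
  have c: "0 < c" using X(4) by (simp add: c_def)
  define E where "E = (\<integral>\<omega>. X \<omega> ^ (2 * m) \<partial>M)"
  have E: "0 \<le> E" unfolding E_def using X(2) by (intro Bochner_Integration.integral_nonneg) auto
  have pointwise: "(K * (a + X \<omega>)) powr p \<le> c * (a powr p + 1 + X \<omega> ^ (2 * m))" if "0 \<le> a" for a \<omega>
  proof -
    have "(K * (a + X \<omega>)) powr p \<le> (2 * K * max a (X \<omega>)) powr p"
      using X(2)[of \<omega>] X(4) that assms mult_left_mono[of "a + X \<omega>" "2 * max a (X \<omega>)" K]
      by (intro powr_mono2) (auto simp: mult_ac)
    also have "\<dots> = c * max a (X \<omega>) powr p"
      using X(2)[of \<omega>] X(4) that unfolding c_def by (intro powr_mult) 
    also have "max a (X \<omega>) powr p \<le> a powr p + X \<omega> powr p" by (auto simp: max_def)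
    also have "\<dots> \<le> a powr p + (1 + X \<omega> ^ (2 * m))"
      using m assms X(2) by (intro add_left_mono powr_le_one_plus_power) auto
    finally show ?thesis using c by (simp add: add.assoc)
  qed
  show ?thesis
  proof (intro exI[of _ "c * (1 + E)"] conjI ballI allI impI)
    show "0 < c * (1 + E)" using c E by (intro mult_pos_pos) auto
    fix t y Y assume t: "t \<in> {0..T}" and Y: "strong t y Y"
    let ?a = "norm y powr p"
    have "(\<integral>\<^sup>+\<omega>. (SUP s\<in>{t..T}. ennreal (norm (Y s \<omega>) powr p)) \<partial>M) \<le>
        (\<integral>\<^sup>+\<omega>. ennreal (c * (?a + 1 + X \<omega> ^ (2 * m))) \<partial>M)"
    proof (rule nn_integral_mono_AE)
      show "AE \<omega> in M. (SUP s\<in>{t..T}. ennreal (norm (Y s \<omega>) powr p)) \<le> ennreal (c * (?a + 1 + X \<omega> ^ (2 * m)))"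
        using X(5)[OF t Y]
      proof eventually_elim
        case (elim \<omega>)
        show ?case
        proof (rule SUP_least, rule ennreal_leI)
          fix s assume "s \<in> {t..T}"
          then have "norm (Y s \<omega>) powr p \<le> (K * (norm y + X \<omega>)) powr p"
            using elim assms by (intro powr_mono2) auto
          also have "\<dots> \<le> c * (?a + 1 + X \<omega> ^ (2 * m))" by (rule pointwise) simp
          finally show "norm (Y s \<omega>) powr p \<le> c * (?a + 1 + X \<omega> ^ (2 * m))" .
        qed
      qed
    qed
    also have "\<dots> = ennreal (\<integral>\<omega>. c * (?a + 1 + X \<omega> ^ (2 * m)) \<partial>M)"
      using X(2,3) c by (intro nn_integral_eq_integral) auto
    also have "(\<integral>\<omega>. c * (?a + 1 + X \<omega> ^ (2 * m)) \<partial>M) = c * (?a + 1 + E)"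
      using X(3) by (simp add: E_def prob_space)
    also have "\<dots> \<le> c * (1 + E) * (1 + ?a)"
      using c E by (simp add: algebra_simps)
    finally show "(\<integral>\<^sup>+\<omega>. (SUP s\<in>{t..T}. ennreal (norm (Y s \<omega>) powr p)) \<partial>M) \<le> ennreal (c * (1 + E) * (1 + ?a))"
      by (simp add: ennreal_leI)
  qed
qed

text \<open>
Powers of the norm up to \<open>2m\<close> are dominated by one integrable random variable \<open>R\<close>, simultaneously for all times
in \<open>[t, T]\<close>. This bounds the terminal part and the integrated running part.
\<close>

lemma additive_payoff_integrable:
  fixes f :: "state \<Rightarrow> real" and h :: "real \<Rightarrow> state \<Rightarrow> real"
  assumes f: "f \<in> borel_measurable borel" "\<And>y. \<bar>f y\<bar> \<le> C1 * (1 + norm y powr p1)" "0 \<le> C1" "0 \<le> p1"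
    and h: "(\<lambda>(u, z). indicator {0..T} u *\<^sub>R h u z) \<in> borel_measurable borel"
      "\<And>u z. u \<in> {0..T} \<Longrightarrow> \<bar>h u z\<bar> \<le> C2 * (1 + norm z powr p2)" "0 \<le> C2" "0 \<le> p2"
    and t: "t \<in> {0..T}" and Y: "strong t y Y"
  shows "AE \<omega> in M. set_integrable lborel {t..T} (\<lambda>u. h u (Y u \<omega>))"
    and "integrable M (\<lambda>\<omega>. f (Y T \<omega>) - (LINT u:{t..T}|lborel. h u (Y u \<omega>)))"
proof -
  define m where "m = nat \<lceil>max p1 p2\<rceil> + 2"
  have m: "2 \<le> m" "p1 \<le> real (2 * m)" "p2 \<le> real (2 * m)"
    using real_nat_ceiling_ge[of "max p1 p2"] unfolding m_def by simp_all
  obtain X K where X: "X \<in> borel_measurable M" "\<And>\<omega>. 0 \<le> X \<omega>" "integrable M (\<lambda>\<omega>. X \<omega> ^ (2 * m))" "0 < K"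
    "\<And>t y Y. t \<in> {0..T} \<Longrightarrow> strong t y Y \<Longrightarrow> AE \<omega> in M. \<forall>s\<in>{t..T}. norm (Y s \<omega>) \<le> K * (norm y + X \<omega>)"
    using strong_solution_dominated[OF m(1)] by blast
  interpret prob_space M by (rule prob)
  define R where "R \<omega> = 2 + K ^ (2 * m) * (2 ^ (2 * m) * (norm y ^ (2 * m) + X \<omega> ^ (2 * m)))" for \<omega>
  have R: "integrable M R" using X(3) unfolding R_def by auto
  have dom: "AE \<omega> in M. \<forall>s\<in>{t..T}. \<forall>p. 0 \<le> p \<and> p \<le> real (2 * m) \<longrightarrow> 1 + norm (Y s \<omega>) powr p \<le> R \<omega>"
    using X(5)[OF t Y]
  proof eventually_elim
    case (elim \<omega>)
    show ?case
    proof (intro ballI allI impI)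
      fix s p assume s: "s \<in> {t..T}" and p: "0 \<le> p \<and> p \<le> real (2 * m)"
      have "norm (Y s \<omega>) powr p \<le> 1 + norm (Y s \<omega>) ^ (2 * m)"
        using p by (intro powr_le_one_plus_power) auto
      also have "norm (Y s \<omega>) ^ (2 * m) \<le> (K * (norm y + X \<omega>)) ^ (2 * m)"
        using elim s by (intro power_mono) auto
      also have "\<dots> \<le> K ^ (2 * m) * (2 ^ (2 * m) * (norm y ^ (2 * m) + X \<omega> ^ (2 * m)))"
        unfolding power_mult_distrib[of K] using X(2,4) by (intro mult_left_mono add_power_le) auto
      finally show "1 + norm (Y s \<omega>) powr p \<le> R \<omega>" by (simp add: R_def)
    qed
  qed
  note path = integral_along_adapted_path[where x = Y and F = "F T" and t = t and s = T, OF h(1)]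
  note YF = strong_solution_adapted[OF Y]
  have Yr: "((\<lambda>r. Y r \<omega>) \<longlongrightarrow> Y u \<omega>) (at_right u)" if "\<omega> \<in> space (F T)" "u \<in> {t..<T}" for \<omega> u
    using strong_solution_right_continuous[OF Y] that by simp
  have hm: "(\<lambda>\<omega>. LINT u:{t..T}|lborel. h u (Y u \<omega>)) \<in> borel_measurable M"
    by (rule adapted_imp_measurable[of _ T], rule path(1)[OF YF Yr]) (use t in auto)
  have hp: "set_borel_measurable lborel {t..T} (\<lambda>u. h u (Y u \<omega>))" if "\<omega> \<in> space M" for \<omega>
    using path(2)[OF YF Yr] t that by auto
  have hb: "AE \<omega> in M. set_integrable lborel {t..T} (\<lambda>u. h u (Y u \<omega>)) \<and>
      \<bar>LINT u:{t..T}|lborel. h u (Y u \<omega>)\<bar> \<le> C2 * R \<omega> * T"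
    using dom AE_space
  proof eventually_elim
    case (elim \<omega>)
    have b: "norm (h u (Y u \<omega>)) \<le> C2 * R \<omega>" if u: "u \<in> {t..T}" for u
    proof -
      have "norm (h u (Y u \<omega>)) \<le> C2 * (1 + norm (Y u \<omega>) powr p2)" using u t h(2)[of u "Y u \<omega>"] by auto
      also have "\<dots> \<le> C2 * R \<omega>" using elim(1) u h(3,4) m(3) by (intro mult_left_mono) auto
      finally show ?thesis .
    qed
    have i: "set_integrable lborel {t..T} (\<lambda>u. h u (Y u \<omega>))"
      by (rule bounded_set_integrable[OF hp[OF elim(2)] b])
    have "norm (LINT u:{t..T}|lborel. h u (Y u \<omega>)) \<le> C2 * R \<omega> * (LINT u:{t..T}|lborel. 1)"
      by (rule set_integral_norm_le[OF i set_integrable_const_Icc]) (use b in auto)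
    also have "\<dots> = C2 * R \<omega> * (T - t)" using t by (simp add: set_integral_const_Icc)
    also have "\<dots> \<le> C2 * R \<omega> * T"
      using t b[of T] norm_ge_zero[of "h T (Y T \<omega>)"] by (intro mult_left_mono) (auto simp del: norm_ge_zero)
    finally show ?case using i by simp
  qed
  then show "AE \<omega> in M. set_integrable lborel {t..T} (\<lambda>u. h u (Y u \<omega>))" by (auto elim: eventually_mono)
  show "integrable M (\<lambda>\<omega>. f (Y T \<omega>) - (LINT u:{t..T}|lborel. h u (Y u \<omega>)))"
  proof (rule Bochner_Integration.integrable_bound)
    show "integrable M (\<lambda>\<omega>. C1 * R \<omega> + C2 * R \<omega> * T)" using R by auto
    have "Y T \<in> borel_measurable M" by (rule adapted_imp_measurable[of _ T], rule YF) (use t in auto)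
    then have "(\<lambda>\<omega>. f (Y T \<omega>)) \<in> borel_measurable M" using f(1) by (rule measurable_compose)
    then show "(\<lambda>\<omega>. f (Y T \<omega>) - (LINT u:{t..T}|lborel. h u (Y u \<omega>))) \<in> borel_measurable M"
      using hm by (rule borel_measurable_diff)
    show "AE \<omega> in M. norm (f (Y T \<omega>) - (LINT u:{t..T}|lborel. h u (Y u \<omega>))) \<le> norm (C1 * R \<omega> + C2 * R \<omega> * T)"
      using dom hb
    proof eventually_elim
      case (elim \<omega>)
      have "\<bar>f (Y T \<omega>)\<bar> \<le> C1 * (1 + norm (Y T \<omega>) powr p1)" by (rule f(2))
      also have "\<dots> \<le> C1 * R \<omega>" using elim(1) t f(3,4) m(2) by (intro mult_left_mono) auto
      finally show ?case using elim(2)[THEN conjunct2] unfolding real_norm_def by linarith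
    qed
  qed
qed

end

lemma terminal_reward_measurable: "terminal_reward \<alpha> \<in> borel_measurable borel"
proof -
  have "terminal_reward \<alpha> = (\<lambda>y. fst (snd y) + fst (snd (snd y)) * (fst y - \<alpha> * fst (snd (snd y))))"
    by (rule ext) auto
  moreover have "continuous_on UNIV (\<lambda>y :: state. fst (snd y) + fst (snd (snd y)) * (fst y - \<alpha> * fst (snd (snd y))))"
    by (intro continuous_intros)
  ultimately show ?thesis by (simp add: borel_measurable_continuous_onI)
qed

lemma drift_autonomous: "drift b k \<kappa> = (\<lambda>_. drift b k \<kappa> 0)"
  by (intro ext) (auto simp: split_paired_all)

lemma drift_measurable: "drift b k \<kappa> t y \<in> borel_measurable borel"
proof (cases y)
  case (fields S x q \<mu>)
  have "continuous_on UNIV (drift b k \<kappa> t (S, x, q, \<mu>))"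
    unfolding drift.simps by (intro continuous_intros)
  then show ?thesis unfolding fields by (rule borel_measurable_continuous_onI)
qed

text \<open>
The cash component of the drift contains the product of midprice and action. A Lipschitz constant in the state
therefore bounds the action.
\<close>

lemma action_space_bounded:
  assumes "\<And>y1 y2. norm (drift b k \<kappa> t y1 v - drift b k \<kappa> t y2 v) \<le> C * norm (y1 - y2)"
  shows "\<bar>v\<bar> \<le> C"
  using assms[of "(1, 0, 0, 0)" "(0, 0, 0, 0)"] by (simp add: norm_Pair algebra_simps)

theorem theorem1:
  fixes T b k \<gamma> \<sigma> \<kappa> \<alpha> \<phi> \<rho> lam :: real
    and A :: "real set"
    and \<nu> :: "real measure"
    and M :: "'a measure"
    and W :: "real \<Rightarrow> 'a \<Rightarrow> real" and N :: "real \<Rightarrow> 'a \<Rightarrow> nat" and \<eta> :: "nat \<Rightarrow> 'a \<Rightarrow> real"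
    and Z :: "'a \<Rightarrow> real"
    and pol :: policy
  assumes "T > 0" "b \<ge> 0" "k \<ge> 0" "\<gamma> \<ge> 0" "lam > 0"
    and action_space: "A \<in> sets borel"
    and mark_law: "AE x in \<nu>. 0 \<le> x" "\<And>n::nat. integrable \<nu> (\<lambda>x. x ^ n)"
    and noise: "driving_noise M lam \<nu> W N \<eta>"
    and randomization: "Z \<in> borel_measurable M"
      "prob_space.indep_set M (sets (vimage_algebra (space M) Z borel)) (sets (noise_algebra M W N \<eta>))"
    and drift_continuous:
      "continuous_on ({0..T} \<times> UNIV \<times> A) (\<lambda>(t, y, v). drift b k \<kappa> t y v)"
    and drift_lipschitz:
      "\<exists>C>0. \<forall>t\<in>{0..T}. \<forall>v\<in>A. \<forall>y1 y2.
         norm (drift b k \<kappa> t y1 v - drift b k \<kappa> t y2 v) \<le> C * norm (y1 - y2)"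
    and drift_growth:
      "\<exists>C>0. \<forall>t\<in>{0..T}. \<forall>v\<in>A. \<forall>y. norm (drift b k \<kappa> t y v) \<le> C * (1 + norm y)"
    and reward_growth:
      "\<exists>C>0. \<exists>p0\<ge>1. \<forall>y.
         (\<forall>v\<in>A. \<bar>running_reward \<phi> \<rho> y v\<bar> \<le> C * (1 + \<bar>v\<bar> powr p0 + norm y powr p0)) \<and>
         \<bar>terminal_reward \<alpha> y\<bar> \<le> C * (1 + norm y powr p0)"
    and admissible:
      "admissible_policy A T \<phi> \<rho> \<gamma> \<sigma> lam \<nu> (drift b k \<kappa>) (enlarged_filtration M W N \<eta> Z) pol"
  shows "(\<forall>t\<in>{0..T}. \<forall>y.
           unique_strong_solution M W N \<eta> (exploratory_drift A (drift b k \<kappa>) pol) \<sigma> T t y) \<and>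
         (\<forall>p\<ge>2. \<exists>C>0. \<forall>t\<in>{0..T}. \<forall>y Y.
           strong_solution M W N \<eta> (exploratory_drift A (drift b k \<kappa>) pol) \<sigma> T t y Y \<longrightarrow>
             (\<integral>\<^sup>+\<omega>. (SUP s\<in>{t..T}. ennreal (norm (Y s \<omega>) powr p)) \<partial>M)
               \<le> ennreal (C * (1 + norm y powr p))) \<and>
         (\<exists>V :: real \<Rightarrow> state \<Rightarrow> real. \<forall>t\<in>{0..T}. \<forall>y Y.
           strong_solution M W N \<eta> (exploratory_drift A (drift b k \<kappa>) pol) \<sigma> T t y Y \<longrightarrow>
             has_value M A \<phi> \<rho> \<gamma> \<alpha> T pol t Y (V t y))"
proof -
  let ?B = "drift b k \<kappa> 0"
  let ?\<beta> = "exploratory_drift A (drift b k \<kappa>) pol"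
  interpret continuous_policy A T pol
  proof
    note adm = admissible[unfolded admissible_policy_def]
    note density = adm[THEN conjunct1, rule_format]
    show "A \<in> sets borel" by (rule action_space)
    show "set_borel_measurable lborel A (pol t y)" "(\<integral>\<^sup>+v\<in>A. ennreal (pol t y v) \<partial>lborel) = 1"
      if "t \<in> {0..T}" for t y
      using density[OF that, of y] by simp_all
    show "0 \<le> pol t y v" if "t \<in> {0..T}" "v \<in> A" for t y v
      using density[OF that(1), of y] that(2) by simp
    show "((\<lambda>(t', y'). LINT v:A|lborel. \<bar>pol t y v - pol t' y' v\<bar>) \<longlongrightarrow> 0) (at (t, y) within {0..T} \<times> UNIV)"
      if "t \<in> {0..T}" for t y
      using adm[THEN conjunct2, THEN conjunct2, THEN conjunct2, THEN conjunct1] that by blast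
    show "\<exists>C>0. \<forall>t\<in>{0..T}. \<forall>y y'. (LINT v:A|lborel. \<bar>pol t y v - pol t y' v\<bar>) \<le> C * norm (y - y')"
      by (rule adm[THEN conjunct2, THEN conjunct2, THEN conjunct2, THEN conjunct2, THEN conjunct1])
  qed
  have T0: "0 \<in> {0..T}" using \<open>T > 0\<close> by simp
  obtain C1 where C1: "\<And>v y1 y2. v \<in> A \<Longrightarrow> norm (?B y1 v - ?B y2 v) \<le> C1 * norm (y1 - y2)"
    using drift_lipschitz T0 by blast
  obtain C2 where C2: "C2 > 0" "\<And>v y. v \<in> A \<Longrightarrow> norm (?B y v) \<le> C2 * (1 + norm y)"
    using drift_growth T0 by blast
  define L where "L = max C1 C2"
  have L: "0 < L" using C2(1) by (auto simp: L_def)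
  have B_lip: "norm (?B y1 v - ?B y2 v) \<le> L * norm (y1 - y2)" if "v \<in> A" for v y1 y2
    using C1[OF that, of y1 y2] mult_right_mono[of C1 L "norm (y1 - y2)"] by (simp add: L_def)
  have B_growth: "norm (?B y v) \<le> L * (1 + norm y)" if "v \<in> A" for v y
    using C2(2)[OF that, of y] mult_right_mono[of C2 L "1 + norm y"] by (simp add: L_def)
  have B_meas: "set_borel_measurable lborel A (?B y)" for y
    using drift_measurable[of b k \<kappa> 0 y] action_space by (auto simp: set_borel_measurable_def)
  have field: "locally_lipschitz_field T L ?\<beta>"
    using exploratory_drift_field[OF B_meas B_lip B_growth L] by (simp only: drift_autonomous[of b k \<kappa>, symmetric])
  interpret noisy_field T L ?\<beta> M W N \<eta> \<nu> lam \<sigma>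
    using field noise \<open>lam > 0\<close> \<open>T > 0\<close> mark_law(2) by (simp add: noisy_field_def noisy_field_axioms_def)
  obtain Cf p0 where f: "Cf > 0" "p0 \<ge> 1" "\<And>y. \<bar>terminal_reward \<alpha> y\<bar> \<le> Cf * (1 + norm y powr p0)"
    using reward_growth by blast
  obtain Cr p where r: "Cr > 0" "p \<ge> 1" "\<And>t y. t \<in> {0..T} \<Longrightarrow>
        (\<integral>\<^sup>+v\<in>A. ennreal (\<bar>regularized_cost \<phi> \<rho> \<gamma> pol t y v\<bar> * pol t y v) \<partial>lborel)
          \<le> ennreal (Cr * (1 + norm y powr p))"
    using admissible[unfolded admissible_policy_def, THEN conjunct2, THEN conjunct2, THEN conjunct2, THEN conjunct2, THEN conjunct2]
    by blast
  have Cr0: "0 \<le> Cr" using r(1) by simp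
  have A_bounded: "\<bar>v\<bar> \<le> C1" if "v \<in> A" for v
    using C1[OF that] by (rule action_space_bounded)
  note cost = cost_integrable[OF r(3) Cr0] expected_running_cost_measurable[OF r(3) Cr0 A_bounded]
  let ?h = "expected_running_cost A \<phi> \<rho> \<gamma> pol"
  let ?payoff = "payoff A \<phi> \<rho> \<gamma> \<alpha> T pol"
  \<comment> \<open>strong solutions agree almost surely, so the choice of one does not affect the value\<close>
  define V where "V t y = (\<integral>\<omega>. ?payoff t (SOME Y. strong t y Y) \<omega> \<partial>M)" for t y
  have "has_value M A \<phi> \<rho> \<gamma> \<alpha> T pol t Y (V t y)" if t: "t \<in> {0..T}" and Y: "strong t y Y" for t y Y
  proof -
    note int = additive_payoff_integrable[where f = "terminal_reward \<alpha>" and h = ?h,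
        OF terminal_reward_measurable f(3) _ _ cost(3) cost(2) Cr0 _ t]
    have payoff: "integrable M (?payoff t Y')" if "strong t y Y'" for Y'
      unfolding payoff_def[abs_def] by (rule int(2)) (use f r that in auto)
    have "strong t y (SOME Y. strong t y Y)" using Y by (rule someI[of "\<lambda>Y. strong t y Y"])
    note some = this
    have "AE \<omega> in M. ?payoff t (SOME Y. strong t y Y) \<omega> = ?payoff t Y \<omega>"
      using strong_solutions_agree[OF _ Y some]
    proof (rule AE_mp)
      show "0 \<le> t" using t by simp
      show "AE \<omega> in M. (\<forall>s\<in>{t..T}. (SOME Y. strong t y Y) s \<omega> = Y s \<omega>) \<longrightarrow>
          ?payoff t (SOME Y. strong t y Y) \<omega> = ?payoff t Y \<omega>"
        using t by (intro AE_I2 impI) (auto simp: payoff_def intro!: set_lebesgue_integral_cong)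
    qed
    then have "V t y = (\<integral>\<omega>. ?payoff t Y \<omega> \<partial>M)"
      unfolding V_def using payoff[OF some] payoff[OF Y] by (intro integral_cong_AE) auto
    then have "has_bochner_integral M (?payoff t Y) (V t y)"
      using payoff[OF Y] by (simp add: has_bochner_integral_iff)
    moreover have "AE \<omega> in M. set_integrable lborel {t..T} (\<lambda>u. ?h u (Y u \<omega>))"
      by (rule int(1)) (use f r Y in auto)
    ultimately show ?thesis
      unfolding has_value_def using cost(1) t by (auto elim!: eventually_mono)
  qed
  then have "\<exists>V. \<forall>t\<in>{0..T}. \<forall>y Y. strong t y Y \<longrightarrow> has_value M A \<phi> \<rho> \<gamma> \<alpha> T pol t Y (V t y)"
    by (intro exI[of _ V]) blast
  moreover have "\<forall>t\<in>{0..T}. \<forall>y. unique_strong_solution M W N \<eta> ?\<beta> \<sigma> T t y"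
    by (intro ballI allI strong_solution_unique) simp
  ultimately show ?thesis
    using strong_solution_moment_bound by blast
qed


end
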